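(* Let $t$ be an essentially bounded traction field on $\Gamma_t$. (i) (Existence of stresses) There is a (nonempty) collection $\Sigma_t$ of essentially bounded symmetric tensor fields on $\Omega$, interpreted physically as stress fields, that represent $t$ in the form $$\int_{\Gamma_t} t\cdot w\,\mathrm{d}A=\int_\Omega \sigma_{ij}\,\varepsilon_{ij}(w)\,\mathrm{d}V\quad\text{for all }\sigma\in\Sigma_t\text{ and all } w\in C^\infty(\overline{\Omega},\mathbb{R}^3)\text{ with } w=0 \text{ on }\Gamma_0,$$ where $\varepsilon(w)=\frac12(\nabla w+\nabla w^{T})$. (ii) (Existence of optimal stress fields) There is a stress field $\widehat{\sigma}\in\Sigma_t$ such that $$\sigma_t^{\mathrm{opt}}:=\inf_{\sigma\in\Sigma_t}\Bigl\{\operatorname*{ess\,sup}_{x\in\Omega}|\sigma(x)|\Bigr\}=\operatorname*{ess\,sup}_{x\in\Omega}|\widehat{\sigma}(x)|.$$ (iii) (The expression for $\sigma_t^{\mathrm{opt}}$) The optimum satisfies $$\sigma_t^{\mathrm{opt}}=\sup_{w}\frac{\left|\int_{\Gamma_t}t\cdot w\,\mathrm{d}A\right|}{\int_\Omega|\varepsilon(w)|\,\mathrm{d}V},$$ where the supremum is over nonzero $w\in C^\infty(\overline{\Omega},\mathbb{R}^3)$ with $w=0$ on $\Gamma_0$, and the magnitude of $\varepsilon(w)(x)$ is evaluated using the norm dual to the one used for the values of stresses.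
   Context: $\Omega\subset\mathbb{R}^3$ is open and bounded, with $C^1$ boundary $\partial\Omega$; it is the region occupied by a body. $\Gamma_0,\Gamma_t\subset\partial\Omega$ are nonempty, disjoint, open subsets of $\partial\Omega$ with $\overline{\Gamma}_0\cup\overline{\Gamma}_t=\partial\Omega$, and $\Lambda=\partial\Gamma_0=\partial\Gamma_t$ (boundaries relative to $\partial\Omega$) is a differentiable 1-dimensional submanifold of $\partial\Omega$. The body is supported on $\Gamma_0$, and tractions act on $\Gamma_t$. $\mathrm{d}A$ is surface measure and $\mathrm{d}V$ is Lebesgue measure. $\mathbb{R}^6$ denotes the space of symmetric $3\times3$ real matrices. Essentially bounded traction fields are elements $t\in L^\infty(\Gamma_t,\mathbb{R}^3)$, and essentially bounded symmetric tensor fields are elements $\sigma\in L^\infty(\Omega,\mathbb{R}^6)$; $\Sigma_t$ is the set of all such $\sigma$ representing $t$ in the form displayed in (i). Stress values $\sigma(x)$ and strain values $\varepsilon(w)(x)$ are measured with norms on matrices, both denoted $|\cdot|$, that are dual to each other with respect to the pairing $(\sigma,\varepsilon)\mapsto\sigma_{ij}\varepsilon_{ij}$. $C^\infty(\overline{\Omega},\mathbb{R}^3)$ is the space of smooth vector fields on $\overline{\Omega}$.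
   Formalization: Ω is additionally assumed connected (the usual sense of a region occupied by a body); for a disconnected Ω with a component not touching Γ_0, a constant nonzero traction on that component's boundary makes Σ_t empty, so the claim as stated fails. *)

theory Defs
  imports "HOL-Analysis.Analysis" "HOL-Probability.Essential_Supremum"
begin

section \<open>Surface measure\<close>

text \<open>
  Surface measure is rendered as the two-dimensional Hausdorff measure. The factor \<open>pi / 4\<close> is the
  area of a disc of unit diameter; with this normalisation the measure agrees with the elementary
  area on embedded \<open>C\<^sup>1\<close> surfaces.
\<close>

definition hausdorff2_premeasure :: "real \<Rightarrow> 'a::metric_space set \<Rightarrow> ennreal" where
  "hausdorff2_premeasure \<delta> A =
     (INF C \<in> {C :: nat \<Rightarrow> 'a set. (\<forall>i. bounded (C i) \<and> diameter (C i) \<le> \<delta>) \<and> A \<subseteq> (\<Union>i. C i)}.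
        \<Sum>i. ennreal (pi / 4 * (diameter (C i))\<^sup>2))"

definition hausdorff2_outer :: "'a::metric_space set \<Rightarrow> ennreal" where
  "hausdorff2_outer A = (SUP \<delta> \<in> {0<..}. hausdorff2_premeasure \<delta> A)"

definition hausdorff2 :: "'a::metric_space measure" where
  "hausdorff2 = measure_of UNIV (sets borel) hausdorff2_outer"

lemma space_hausdorff2 [simp]: "space hausdorff2 = UNIV"
  by (simp add: hausdorff2_def space_measure_of_conv)

lemma sets_hausdorff2 [simp, measurable_cong]: "sets hausdorff2 = sets borel"
  unfolding hausdorff2_def
  using sets.sigma_sets_eq[of borel] by (simp add: sets_measure_of)

text \<open>
  \<^const>\<open>measure_of\<close> is only meaningful for a countably additive set function; the following lemmas
  establish this for the Borel sets (Caratheodory's criterion for metric outer measures).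
\<close>

lemma hausdorff2_premeasure_le:
  assumes "\<And>i. bounded (C i)" "\<And>i. diameter (C i) \<le> \<delta>" "A \<subseteq> (\<Union>i. C i)"
  shows "hausdorff2_premeasure \<delta> A \<le> (\<Sum>i. ennreal (pi / 4 * (diameter (C i))\<^sup>2))"
  unfolding hausdorff2_premeasure_def using assms by (intro INF_lower) auto

lemma hausdorff2_premeasure_mono: "A \<subseteq> B \<Longrightarrow> hausdorff2_premeasure \<delta> A \<le> hausdorff2_premeasure \<delta> B"
  unfolding hausdorff2_premeasure_def by (intro INF_superset_mono) auto

lemma hausdorff2_premeasure_antimono:
  "\<delta> \<le> \<delta>' \<Longrightarrow> hausdorff2_premeasure \<delta>' A \<le> hausdorff2_premeasure \<delta> A"
  unfolding hausdorff2_premeasure_def by (intro INF_superset_mono) (auto intro: order_trans)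

lemma hausdorff2_premeasure_empty: "0 < \<delta> \<Longrightarrow> hausdorff2_premeasure \<delta> {} = 0"
  using hausdorff2_premeasure_le[of "\<lambda>_. {}" \<delta> "{}"] by simp

lemma hausdorff2_premeasure_subadditive:
  fixes A :: "nat \<Rightarrow> 'a::metric_space set"
  assumes "0 < \<delta>"
  shows "hausdorff2_premeasure \<delta> (\<Union>n. A n) \<le> (\<Sum>n. hausdorff2_premeasure \<delta> (A n))"
proof (rule ennreal_le_epsilon)
  fix e :: real assume fin: "(\<Sum>n. hausdorff2_premeasure \<delta> (A n)) < top" and e: "0 < e"
  let ?S = "\<lambda>C :: nat \<Rightarrow> 'a set. \<Sum>i. ennreal (pi / 4 * (diameter (C i))\<^sup>2)"
  have "\<exists>C. (\<forall>i. bounded (C i) \<and> diameter (C i) \<le> \<delta>) \<and> A n \<subseteq> (\<Union>i. C i) \<and>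
          ?S C \<le> hausdorff2_premeasure \<delta> (A n) + ennreal (e * (1/2)^Suc n)" for n
  proof -
    have "hausdorff2_premeasure \<delta> (A n) < top"
      using ennreal_suminf_lessD[OF fin] .
    then have "hausdorff2_premeasure \<delta> (A n) <
        hausdorff2_premeasure \<delta> (A n) + ennreal (e * (1/2)^Suc n)"
      using e by (cases "hausdorff2_premeasure \<delta> (A n)")
        (auto simp flip: ennreal_plus simp: ennreal_less_iff)
    then show ?thesis
      by (subst (asm) (1) hausdorff2_premeasure_def) (auto simp: INF_less_iff intro: less_imp_le)
  qed
  then obtain C where C: "\<And>n i. bounded (C n i)" "\<And>n i. diameter (C n i) \<le> \<delta>"
      "\<And>n. A n \<subseteq> (\<Union>i. C n i)"
      "\<And>n. ?S (C n) \<le> hausdorff2_premeasure \<delta> (A n) + ennreal (e * (1/2)^Suc n)"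
    by metis
  define D where "D k = (case prod_decode k of (n, i) \<Rightarrow> C n i)" for k
  have "hausdorff2_premeasure \<delta> (\<Union>n. A n) \<le> ?S D"
  proof (rule hausdorff2_premeasure_le)
    show "(\<Union>n. A n) \<subseteq> (\<Union>k. D k)"
    proof safe
      fix x n assume "x \<in> A n"
      then obtain i where "x \<in> C n i" using C(3) by blast
      then show "x \<in> (\<Union>k. D k)"
        by (intro UN_I[of "prod_encode (n, i)"]) (auto simp: D_def)
    qed
  qed (auto simp: D_def C split: prod.splits)
  also have "?S D = (\<Sum>k. (\<lambda>(n, i). ennreal (pi / 4 * (diameter (C n i))\<^sup>2)) (prod_decode k))"
    by (intro suminf_cong) (auto simp: D_def split: prod.splits)
  also have "\<dots> = (\<Sum>n. ?S (C n))"
    by (rule suminf_ennreal_2dimen) auto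
  also have "\<dots> \<le> (\<Sum>n. hausdorff2_premeasure \<delta> (A n) + ennreal (e * (1/2)^Suc n))"
    by (intro suminf_le C) auto
  also have "\<dots> = (\<Sum>n. hausdorff2_premeasure \<delta> (A n)) + (\<Sum>n. ennreal (e * (1/2)^Suc n))"
    by (rule suminf_add[symmetric]) auto
  also have "(\<Sum>n. ennreal (e * (1/2)^Suc n)) = ennreal e"
  proof (rule suminf_ennreal_eq)
    show "(\<lambda>n. e * (1/2)^Suc n) sums e"
      using sums_mult[OF power_half_series, of e] by simp
  qed (use e in auto)
  finally show "hausdorff2_premeasure \<delta> (\<Union>n. A n) \<le>
      (\<Sum>n. hausdorff2_premeasure \<delta> (A n)) + ennreal e" .
qed

lemma hausdorff2_outer_measure_space:
  "outer_measure_space (Pow UNIV) (hausdorff2_outer :: 'a::metric_space set \<Rightarrow> ennreal)"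
  unfolding outer_measure_space_def
proof (intro conjI)
  show "positive (Pow UNIV) (hausdorff2_outer :: 'a set \<Rightarrow> ennreal)"
    by (auto simp: positive_def hausdorff2_outer_def hausdorff2_premeasure_empty)
  show "increasing (Pow UNIV) (hausdorff2_outer :: 'a set \<Rightarrow> ennreal)"
    unfolding increasing_def hausdorff2_outer_def
    by (auto intro!: SUP_mono intro: hausdorff2_premeasure_mono)
  show "countably_subadditive (Pow UNIV) (hausdorff2_outer :: 'a set \<Rightarrow> ennreal)"
    unfolding countably_subadditive_def
  proof safe
    fix A :: "nat \<Rightarrow> 'a set"
    show "hausdorff2_outer (\<Union>n. A n) \<le> (\<Sum>n. hausdorff2_outer (A n))"
      unfolding hausdorff2_outer_def[of "\<Union>n. A n"]
    proof (rule SUP_least)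
      fix \<delta> :: real assume \<delta>: "\<delta> \<in> {0<..}"
      have "hausdorff2_premeasure \<delta> (\<Union>n. A n) \<le> (\<Sum>n. hausdorff2_premeasure \<delta> (A n))"
        using \<delta> by (intro hausdorff2_premeasure_subadditive) auto
      also have "\<dots> \<le> (\<Sum>n. hausdorff2_outer (A n))"
        using \<delta> unfolding hausdorff2_outer_def by (intro suminf_le SUP_upper) auto
      finally show "hausdorff2_premeasure \<delta> (\<Union>n. A n) \<le> (\<Sum>n. hausdorff2_outer (A n))" .
    qed
  qed
qed

lemma hausdorff2_outer_mono: "A \<subseteq> B \<Longrightarrow> hausdorff2_outer A \<le> hausdorff2_outer B"
  using hausdorff2_outer_measure_space[where 'a='a]
  by (auto simp: outer_measure_space_def increasing_def)

lemma hausdorff2_outer_empty [simp]: "hausdorff2_outer {} = 0"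
  using hausdorff2_outer_measure_space[where 'a='a]
  by (auto simp: outer_measure_space_def positive_def)

lemma hausdorff2_outer_Un:
  fixes A B :: "'a::metric_space set"
  shows "hausdorff2_outer (A \<union> B) \<le> hausdorff2_outer A + hausdorff2_outer B"
proof -
  have "hausdorff2_premeasure \<delta> (A \<union> B) \<le> hausdorff2_outer A + hausdorff2_outer B" if "0 < \<delta>" for \<delta>
  proof -
    have "hausdorff2_premeasure \<delta> (A \<union> B) = hausdorff2_premeasure \<delta> (\<Union>n. binaryset A B n)"
      by (simp add: UN_binaryset_eq)
    also have "\<dots> \<le> (\<Sum>n. hausdorff2_premeasure \<delta> (binaryset A B n))"
      by (rule hausdorff2_premeasure_subadditive[OF that])
    also have "\<dots> = hausdorff2_premeasure \<delta> A + hausdorff2_premeasure \<delta> B"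
      using suminf_binaryset_eq[of "hausdorff2_premeasure \<delta>" A B]
        hausdorff2_premeasure_empty[OF that, where 'a='a] by simp
    also have "\<dots> \<le> hausdorff2_outer A + hausdorff2_outer B"
      using that unfolding hausdorff2_outer_def by (intro add_mono SUP_upper) auto
    finally show ?thesis .
  qed
  then show ?thesis
    unfolding hausdorff2_outer_def[of "A \<union> B"] by (intro SUP_least) auto
qed

lemma hausdorff2_outer_separated:
  fixes A B :: "'a::metric_space set"
  assumes d: "0 < d" and sep: "\<And>x y. x \<in> A \<Longrightarrow> y \<in> B \<Longrightarrow> d \<le> dist x y"
  shows "hausdorff2_outer A + hausdorff2_outer B \<le> hausdorff2_outer (A \<union> B)"
proof -
  have small: "hausdorff2_premeasure \<delta> A + hausdorff2_premeasure \<delta> B \<le> hausdorff2_premeasure \<delta> (A \<union> B)"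
    if \<delta>: "0 < \<delta>" "\<delta> < d" for \<delta>
  proof (subst (3) hausdorff2_premeasure_def, rule INF_greatest, clarsimp)
    fix C :: "nat \<Rightarrow> 'a set"
    assume C: "\<forall>i. bounded (C i) \<and> diameter (C i) \<le> \<delta>" and A: "A \<subseteq> (\<Union>i. C i)" and B: "B \<subseteq> (\<Union>i. C i)"
    define CA where "CA i = (if C i \<inter> A = {} then {} else C i)" for i
    define CB where "CB i = (if C i \<inter> B = {} then {} else C i)" for i
    have disj: "C i \<inter> A = {} \<or> C i \<inter> B = {}" for i
    proof (rule ccontr)
      assume "\<not> ?thesis"
      then obtain x y where "x \<in> C i" "x \<in> A" "y \<in> C i" "y \<in> B" by blast
      then have "d \<le> diameter (C i)"
        using sep C diameter_bounded_bound by (meson order_trans)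
      then show False using C \<delta> by (meson leD order_trans)
    qed
    have "hausdorff2_premeasure \<delta> A + hausdorff2_premeasure \<delta> B \<le>
        (\<Sum>i. ennreal (pi / 4 * (diameter (CA i))\<^sup>2)) + (\<Sum>i. ennreal (pi / 4 * (diameter (CB i))\<^sup>2))"
    proof (intro add_mono hausdorff2_premeasure_le)
      show "A \<subseteq> (\<Union>i. CA i)" using A unfolding CA_def by fastforce
      show "B \<subseteq> (\<Union>i. CB i)" using B unfolding CB_def by fastforce
    qed (use C \<delta> in \<open>auto simp: CA_def CB_def\<close>)
    also have "\<dots> = (\<Sum>i. ennreal (pi / 4 * (diameter (CA i))\<^sup>2) + ennreal (pi / 4 * (diameter (CB i))\<^sup>2))"
      by (rule suminf_add) auto
    also have "\<dots> \<le> (\<Sum>i. ennreal (pi / 4 * (diameter (C i))\<^sup>2))"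
      using disj by (intro suminf_le) (auto simp: CA_def CB_def)
    finally show "hausdorff2_premeasure \<delta> A + hausdorff2_premeasure \<delta> B \<le>
       (\<Sum>i. ennreal (pi * (diameter (C i))\<^sup>2 / 4))"
      by simp
  qed
  have "hausdorff2_outer A + hausdorff2_outer B =
      (SUP \<delta>\<in>{0<..}. hausdorff2_premeasure \<delta> A + hausdorff2_premeasure \<delta> B)"
    unfolding hausdorff2_outer_def
  proof (rule SUP_add_directed_ennreal[symmetric])
    fix i j :: real assume "i \<in> {0<..}" "j \<in> {0<..}"
    then show "\<exists>k\<in>{0<..}. hausdorff2_premeasure i A + hausdorff2_premeasure j B \<le>
        hausdorff2_premeasure k A + hausdorff2_premeasure k B"
      by (intro bexI[of _ "min i j"] add_mono hausdorff2_premeasure_antimono) auto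
  qed
  also have "\<dots> \<le> hausdorff2_outer (A \<union> B)"
  proof (rule SUP_least)
    fix \<delta> :: real assume "\<delta> \<in> {0<..}"
    define \<delta>' where "\<delta>' = min \<delta> (d / 2)"
    have \<delta>': "0 < \<delta>'" "\<delta>' < d" "\<delta>' \<le> \<delta>" using \<open>\<delta> \<in> _\<close> d by (auto simp: \<delta>'_def)
    have "hausdorff2_premeasure \<delta> A + hausdorff2_premeasure \<delta> B \<le>
        hausdorff2_premeasure \<delta>' A + hausdorff2_premeasure \<delta>' B"
      using \<delta>' by (intro add_mono hausdorff2_premeasure_antimono)
    also have "\<dots> \<le> hausdorff2_premeasure \<delta>' (A \<union> B)" using small \<delta>' by auto
    also have "\<dots> \<le> hausdorff2_outer (A \<union> B)"
      using \<delta>' unfolding hausdorff2_outer_def by (intro SUP_upper) auto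
    finally show "hausdorff2_premeasure \<delta> A + hausdorff2_premeasure \<delta> B \<le> hausdorff2_outer (A \<union> B)" .
  qed
  finally show ?thesis .
qed

lemma hausdorff2_outer_closed:
  fixes F A :: "'a::metric_space set"
  assumes F: "closed F"
  shows "hausdorff2_outer (A \<inter> F) + hausdorff2_outer (A - F) \<le> hausdorff2_outer A"
proof (cases "F = {} \<or> hausdorff2_outer A = top")
  case True
  then show ?thesis by auto
next
  case False
  then have ne: "F \<noteq> {}" and fin: "hausdorff2_outer A < top" by (auto simp: top.not_eq_extremum)
  define r where "r x = infdist x F" for x
  have rpos: "r x > 0" if "x \<notin> F" for x
    using in_closed_iff_infdist_zero[OF F ne] that infdist_nonneg[of x F] by (force simp: r_def)
  have rlip: "\<bar>r x - r y\<bar> \<le> dist x y" for x y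
    using infdist_triangle[of x F y] infdist_triangle[of y F x] by (auto simp: r_def dist_commute)
  define P where "P n = {x \<in> A. 1 / real (Suc n) \<le> r x}" for n
  define R where "R k = {x \<in> A. 1 / real (Suc (Suc k)) \<le> r x \<and> r x < 1 / real (Suc k)}" for k
  have inner: "hausdorff2_outer (A \<inter> F) + hausdorff2_outer (P n) \<le> hausdorff2_outer A" for n
  proof -
    have "hausdorff2_outer (A \<inter> F) + hausdorff2_outer (P n) \<le> hausdorff2_outer (A \<inter> F \<union> P n)"
    proof (rule hausdorff2_outer_separated[of "1 / real (Suc n)"])
      fix x y assume "x \<in> A \<inter> F" "y \<in> P n"
      then show "1 / real (Suc n) \<le> dist x y"
        using infdist_le[of x F y] by (auto simp: P_def r_def dist_commute)
    qed auto
    also have "\<dots> \<le> hausdorff2_outer A" by (intro hausdorff2_outer_mono) (auto simp: P_def)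
    finally show ?thesis .
  qed
  have alt: "(\<Sum>k<n. hausdorff2_outer (R (2 * k + j))) \<le> hausdorff2_outer (\<Union>k<n. R (2 * k + j))" for j n
  proof (induction n)
    case (Suc n)
    let ?d = "1 / real (2 * n + j) - 1 / real (Suc (2 * n + j))"
    have "hausdorff2_outer (\<Union>k<n. R (2 * k + j)) + hausdorff2_outer (R (2 * n + j)) \<le>
        hausdorff2_outer ((\<Union>k<n. R (2 * k + j)) \<union> R (2 * n + j))"
    proof (cases "n = 0")
      case False
      show ?thesis
      proof (rule hausdorff2_outer_separated[of ?d])
        show "0 < ?d" using False frac_less2[of 1 1 "real (2 * n + j)" "real (Suc (2 * n + j))"] by simp
        fix x y assume "x \<in> (\<Union>k<n. R (2 * k + j))" and y: "y \<in> R (2 * n + j)"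
        then obtain k where k: "k < n" "x \<in> R (2 * k + j)" by auto
        have "1 / real (2 * n + j) \<le> 1 / real (Suc (Suc (2 * k + j)))"
          using k by (intro divide_left_mono) auto
        also have "\<dots> \<le> r x" using k by (simp add: R_def)
        finally show "?d \<le> dist x y"
          using y rlip[of x y] by (auto simp: R_def)
      qed
    qed auto
    then have "(\<Sum>k<Suc n. hausdorff2_outer (R (2 * k + j))) \<le>
        hausdorff2_outer ((\<Union>k<n. R (2 * k + j)) \<union> R (2 * n + j))"
      using Suc.IH by (auto intro: order_trans add_right_mono)
    then show ?case by (simp add: lessThan_Suc Un_commute)
  qed auto
  have alt': "(\<Sum>k<n. hausdorff2_outer (R (2 * k + j))) \<le> hausdorff2_outer A" for j n
    by (rule order_trans[OF alt hausdorff2_outer_mono]) (auto simp: R_def)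
  define h where "h k = enn2real (hausdorff2_outer (R k))" for k
  have h: "hausdorff2_outer (R k) = ennreal (h k)" for k
  proof -
    have "hausdorff2_outer (R k) \<le> hausdorff2_outer A"
      by (intro hausdorff2_outer_mono) (auto simp: R_def)
    then show ?thesis using fin by (auto simp: h_def ennreal_enn2real_if)
  qed
  have h0: "0 \<le> h k" for k by (simp add: h_def)
  define a where "a = enn2real (hausdorff2_outer A)"
  have a: "hausdorff2_outer A = ennreal a" "0 \<le> a" using fin by (auto simp: a_def ennreal_enn2real_if)
  have halt: "(\<Sum>k<n. h (2 * k + j)) \<le> a" for n j
    using alt'[where j=j and n=n] a by (simp add: h h0 sum_nonneg ennreal_le_iff)
  have "summable h"
  proof (rule summableI_nonneg_bounded)
    fix n
    have "(\<Sum>k<n. h k) \<le> (\<Sum>k<2 * n. h k)" by (intro sum_mono2) (auto simp: h0)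
    also have "\<dots> = (\<Sum>k<n. h (2 * k)) + (\<Sum>k<n. h (2 * k + 1))"
      by (induction n) (auto simp: algebra_simps)
    also have "\<dots> \<le> a + a" using halt[where n=n and j=0] halt[where n=n and j=1] by simp
    finally show "(\<Sum>k<n. h k) \<le> a + a" .
  qed (rule h0)
  then have tail: "(\<lambda>n. \<Sum>k. h (k + n)) \<longlonglongrightarrow> 0"
    by (rule suminf_exist_split2)
  have bound: "hausdorff2_outer (A \<inter> F) + hausdorff2_outer (A - F) \<le>
      hausdorff2_outer A + ennreal (\<Sum>k. h (k + n))" for n
  proof -
    have cover: "A - F \<subseteq> P n \<union> (\<Union>k. R (k + n))"
    proof
      fix x assume x: "x \<in> A - F"
      define m where "m = (LEAST m. 1 / real (Suc m) \<le> r x)"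
      have ex: "\<exists>m. 1 / real (Suc m) \<le> r x"
        using rpos[of x] x reals_Archimedean[of "r x"] by (auto simp: inverse_eq_divide intro: less_imp_le)
      then have m: "1 / real (Suc m) \<le> r x" unfolding m_def by (rule LeastI_ex)
      show "x \<in> P n \<union> (\<Union>k. R (k + n))"
      proof (cases "m \<le> n")
        case True
        then have "1 / real (Suc n) \<le> 1 / real (Suc m)" by (intro divide_left_mono) auto
        with m x show ?thesis by (auto simp: P_def)
      next
        case False
        then obtain k where k: "m = Suc (k + n)"
          by (metis add.commute less_imp_Suc_add not_le_imp_less)
        then have "\<not> 1 / real (Suc (k + n)) \<le> r x"
          using not_less_Least[of "k + n" "\<lambda>m. 1 / real (Suc m) \<le> r x"] by (fold m_def) simp
        with m x k have "x \<in> R (k + n)" by (auto simp: R_def)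
        then show ?thesis by blast
      qed
    qed
    have "hausdorff2_outer (\<Union>k. R (k + n)) \<le> (\<Sum>k. hausdorff2_outer (R (k + n)))"
    proof -
      have "hausdorff2_premeasure \<delta> (\<Union>k. R (k + n)) \<le> (\<Sum>k. hausdorff2_outer (R (k + n)))"
        if "0 < \<delta>" for \<delta>
        using that
        by (intro order_trans[OF hausdorff2_premeasure_subadditive] suminf_le)
          (auto simp: hausdorff2_outer_def intro!: SUP_upper)
      then show ?thesis
        unfolding hausdorff2_outer_def[of "\<Union>k. R (k + n)"] by (intro SUP_least) auto
    qed
    also have "\<dots> = ennreal (\<Sum>k. h (k + n))"
      using summable_ignore_initial_segment[OF \<open>summable h\<close>, of n]
      by (simp add: h h0 suminf_ennreal2)
    finally have "hausdorff2_outer (A - F) \<le> hausdorff2_outer (P n) + ennreal (\<Sum>k. h (k + n))"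
      using order_trans[OF hausdorff2_outer_mono[OF cover] hausdorff2_outer_Un]
      by (meson add_left_mono order_trans)
    then have "hausdorff2_outer (A \<inter> F) + hausdorff2_outer (A - F) \<le>
        (hausdorff2_outer (A \<inter> F) + hausdorff2_outer (P n)) + ennreal (\<Sum>k. h (k + n))"
      by (simp add: add.assoc add_left_mono)
    also have "\<dots> \<le> hausdorff2_outer A + ennreal (\<Sum>k. h (k + n))"
      by (intro add_right_mono inner)
    finally show ?thesis .
  qed
  have "(\<lambda>n. ennreal a + ennreal (\<Sum>k. h (k + n))) \<longlonglongrightarrow> ennreal a + ennreal 0"
    by (intro tendsto_add tendsto_const tendsto_ennrealI tail)
  then show ?thesis
    using bound a by (intro LIMSEQ_le_const[where X = "\<lambda>n. ennreal a + ennreal (\<Sum>k. h (k + n))"]) auto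
qed

lemma emeasure_hausdorff2:
  fixes A :: "'a::metric_space set"
  assumes "A \<in> sets borel"
  shows "emeasure hausdorff2 A = hausdorff2_outer A"
proof -
  let ?L = "lambda_system UNIV (Pow UNIV) (hausdorff2_outer :: 'a set \<Rightarrow> ennreal)"
  interpret P: sigma_algebra "UNIV :: 'a set" "Pow UNIV" by (rule sigma_algebra_Pow)
  have ms: "measure_space UNIV ?L (hausdorff2_outer :: 'a set \<Rightarrow> ennreal)"
    by (rule P.caratheodory_lemma[OF hausdorff2_outer_measure_space])
  then interpret L: sigma_algebra UNIV ?L by (simp add: measure_space_def)
  have "hausdorff2_outer (A \<inter> F) + hausdorff2_outer (A - F) = hausdorff2_outer A"
    if "closed F" for A F :: "'a set"
    using hausdorff2_outer_closed[OF that, of A] hausdorff2_outer_Un[of "A \<inter> F" "A - F"]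
    by (simp add: Int_Diff_Un antisym)
  then have "closed F \<Longrightarrow> F \<in> ?L" for F :: "'a set"
    unfolding P.lambda_system_eq by simp
  then have "sigma_sets UNIV {F :: 'a set. closed F} \<subseteq> ?L"
    by (intro L.sigma_sets_subset) auto
  then have sub: "sets (borel :: 'a measure) \<subseteq> ?L"
    by (simp add: borel_eq_closed)
  show ?thesis
    unfolding hausdorff2_def
  proof (rule emeasure_measure_of_sigma)
    show "sigma_algebra UNIV (sets (borel :: 'a measure))"
      using sets.sigma_algebra_axioms[of "borel :: 'a measure"] by simp
    show "positive (sets (borel :: 'a measure)) hausdorff2_outer"
      by (simp add: positive_def)
    show "countably_additive (sets (borel :: 'a measure)) hausdorff2_outer"
      using ms sub unfolding measure_space_def countably_additive_def by blast
  qed (rule assms)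
qed

section \<open>Differentiability classes and the geometry of the boundary\<close>

text \<open>Intended for open \<open>S\<close> only.\<close>

primrec Ck_on :: "nat \<Rightarrow> ('a::real_normed_vector \<Rightarrow> 'b::real_normed_vector) \<Rightarrow> 'a set \<Rightarrow> bool" where
  "Ck_on 0 f S \<longleftrightarrow> continuous_on S f"
| "Ck_on (Suc k) f S \<longleftrightarrow>
     (\<forall>x\<in>S. f differentiable (at x)) \<and> (\<forall>v. Ck_on k (\<lambda>x. frechet_derivative f (at x) v) S)"

text \<open>Up to an orthogonal change of coordinates, the set is locally the region above a \<open>C\<^sup>1\<close> graph.\<close>

definition C1_boundary :: "(real^3) set \<Rightarrow> bool" where
  "C1_boundary \<Omega> \<longleftrightarrow>
     (\<forall>p \<in> frontier \<Omega>. \<exists>r>0. \<exists>T :: real^3 \<Rightarrow> real^3. \<exists>\<gamma> :: real^2 \<Rightarrow> real.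
        orthogonal_transformation T \<and> Ck_on 1 \<gamma> UNIV \<and>
        \<Omega> \<inter> ball p r = {x \<in> ball p r. \<gamma> (vector [T x $ 1, T x $ 2]) < T x $ 3})"

text \<open>
  An embedded one-dimensional \<open>C\<^sup>1\<close> submanifold \<open>L\<close> of a \<open>C\<^sup>1\<close> surface \<open>S\<close>: around each of its points
  the surface has a \<open>C\<^sup>1\<close> parametrisation \<open>\<phi>\<close> in which \<open>L\<close> is a coordinate line. As a \<open>C\<^sup>1\<close> surface has
  no finer structure, this is what differentiability of a submanifold means here.
\<close>

definition C1_curve_in_surface :: "(real^3) set \<Rightarrow> (real^3) set \<Rightarrow> bool" where
  "C1_curve_in_surface S L \<longleftrightarrow>
     L \<subseteq> S \<and>
     (\<forall>p \<in> L. \<exists>V :: (real^2) set. \<exists>\<phi> \<psi>.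
        open V \<and> Ck_on 1 \<phi> V \<and> (\<forall>y\<in>V. inj (frechet_derivative \<phi> (at y))) \<and>
        homeomorphism V (\<phi> ` V) \<phi> \<psi> \<and> openin (top_of_set S) (\<phi> ` V) \<and> p \<in> \<phi> ` V \<and>
        \<phi> ` V \<inter> L = \<phi> ` {y \<in> V. y $ 2 = 0})"

section \<open>Vector fields, strains and stresses\<close>

text \<open>
  \<open>C\<^sup>\<infinity>(closure \<Omega>, \<real>\<^sup>3)\<close>: the restrictions to the closure of smooth fields on the whole space. The
  values of \<open>w\<close> outside the closure are irrelevant.
\<close>

definition smooth_on_closure :: "(real^3) set \<Rightarrow> (real^3 \<Rightarrow> real^3) \<Rightarrow> bool" where
  "smooth_on_closure \<Omega> w \<longleftrightarrow> (\<exists>W. (\<forall>k. Ck_on k W UNIV) \<and> (\<forall>x \<in> closure \<Omega>. w x = W x))"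

definition test_fields :: "(real^3) set \<Rightarrow> (real^3) set \<Rightarrow> (real^3 \<Rightarrow> real^3) set" where
  "test_fields \<Omega> \<Gamma>0 = {w. smooth_on_closure \<Omega> w \<and> (\<forall>x \<in> \<Gamma>0. w x = 0)}"

definition strain :: "(real^3 \<Rightarrow> real^3) \<Rightarrow> real^3 \<Rightarrow> real^3^3" where
  "strain w x = (1/2) *\<^sub>R (jacobian w (at x) + transpose (jacobian w (at x)))"

definition sym_matrices :: "(real^3^3) set" where
  "sym_matrices = {A. transpose A = A}"

definition norm_on_sym :: "(real^3^3 \<Rightarrow> real) \<Rightarrow> bool" where
  "norm_on_sym N \<longleftrightarrow>
     (\<forall>A \<in> sym_matrices. 0 \<le> N A \<and> (N A = 0 \<longleftrightarrow> A = 0)) \<and>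
     (\<forall>A \<in> sym_matrices. \<forall>c. N (c *\<^sub>R A) = \<bar>c\<bar> * N A) \<and>
     (\<forall>A \<in> sym_matrices. \<forall>B \<in> sym_matrices. N (A + B) \<le> N A + N B)"

text \<open>The inner product on \<^typ>\<open>real^3^3\<close> is the full contraction of the components.\<close>

definition dual_norm_sym :: "(real^3^3 \<Rightarrow> real) \<Rightarrow> real^3^3 \<Rightarrow> real" where
  "dual_norm_sym N E = (SUP S \<in> {S \<in> sym_matrices. N S \<le> 1}. S \<bullet> E)"

definition essentially_bounded :: "'a measure \<Rightarrow> ('a \<Rightarrow> 'b::real_normed_vector) \<Rightarrow> bool" where
  "essentially_bounded M f \<longleftrightarrow> f \<in> borel_measurable M \<and> (\<exists>C. AE x in M. norm (f x) \<le> C)"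

definition traction_power :: "(real^3) set \<Rightarrow> (real^3 \<Rightarrow> real^3) \<Rightarrow> (real^3 \<Rightarrow> real^3) \<Rightarrow> real" where
  "traction_power \<Gamma>t t w = (\<integral>x. t x \<bullet> w x \<partial>(restrict_space hausdorff2 \<Gamma>t))"

definition stress_fields ::
  "(real^3) set \<Rightarrow> (real^3) set \<Rightarrow> (real^3) set \<Rightarrow> (real^3 \<Rightarrow> real^3) \<Rightarrow> (real^3 \<Rightarrow> real^3^3) set" where
  "stress_fields \<Omega> \<Gamma>0 \<Gamma>t t =
     {\<sigma>. essentially_bounded (lebesgue_on \<Omega>) \<sigma> \<and> (\<forall>x\<in>\<Omega>. \<sigma> x \<in> sym_matrices) \<and>
         (\<forall>w \<in> test_fields \<Omega> \<Gamma>0.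
            traction_power \<Gamma>t t w =
            (\<integral>x. (\<Sum>i\<in>UNIV. \<Sum>j\<in>UNIV. \<sigma> x $ i $ j * strain w x $ i $ j) \<partial>(lebesgue_on \<Omega>)))}"

definition stress_sup :: "(real^3) set \<Rightarrow> (real^3^3 \<Rightarrow> real) \<Rightarrow> (real^3 \<Rightarrow> real^3^3) \<Rightarrow> ereal" where
  "stress_sup \<Omega> N \<sigma> = esssup (lebesgue_on \<Omega>) (\<lambda>x. ereal (N (\<sigma> x)))"

definition optimal_stress ::
  "(real^3) set \<Rightarrow> (real^3) set \<Rightarrow> (real^3) set \<Rightarrow> (real^3^3 \<Rightarrow> real) \<Rightarrow> (real^3 \<Rightarrow> real^3) \<Rightarrow> ereal" where
  "optimal_stress \<Omega> \<Gamma>0 \<Gamma>t N t = (INF \<sigma> \<in> stress_fields \<Omega> \<Gamma>0 \<Gamma>t t. stress_sup \<Omega> N \<sigma>)"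

end

theory Submission
  imports Defs
begin

text \<open>
  Everything rests on one inequality: if \<open>w\<close> vanishes on \<open>\<Gamma>0\<close>, then the integral of \<open>|w|\<close> over the
  boundary of \<open>\<Omega>\<close> is at most a constant times the integral of \<open>|\<epsilon>(w)|\<close> over \<open>\<Omega>\<close>
  (\<open>trace_le_strain_L1\<close>).

  Given this, the supremum \<open>c\<close> in the third claim is finite and the power of \<open>t\<close> is a linear function of
  the strain that is bounded by \<open>c\<close> with respect to the \<open>L\<^sup>1\<close> norm built from the dual norm of \<open>N\<close>.
  It extends to all integrable matrix fields with the same bound (\<open>mazur_orlicz_cone\<close>); the extension is
  integration against an essentially bounded matrix field \<open>\<sigma>\<close> (\<open>L1_functional_density_vector\<close>); and since
  \<open>N\<close> is the dual of its dual norm (\<open>bidual_le\<close>), the values of \<open>\<sigma>\<close> satisfy \<open>N (\<sigma> x) \<le> c\<close> almost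
  everywhere (\<open>stress_exists\<close>). On the other hand the pairing inequality shows that no stress field
  representing \<open>t\<close> has an essential supremum below \<open>c\<close> (\<open>ratio_le_stress_sup\<close>). So \<open>\<sigma>\<close> is optimal and
  its essential supremum is \<open>c\<close>.

  The inequality itself uses only that the derivative of \<open>w \<bullet> \<xi>\<close> in the direction \<open>\<xi>\<close> is
  \<open>\<epsilon>(w)\<xi> \<bullet> \<xi>\<close>: along a segment of direction \<open>\<xi>\<close>, the component \<open>w \<bullet> \<xi>\<close> changes by at most the
  integral of \<open>|\<xi>|\<^sup>2 |\<epsilon>(w)|\<close> (\<open>segment_bound\<close>). Averaged over all parallel translates of the segment this
  line integral becomes the volume integral (\<open>nn_integral_segments\<close>), and the components of \<open>w\<close> in all
  directions near a fixed one determine \<open>w\<close> (\<open>norm_le_nearby_directions\<close>). Segments that end on \<open>\<Gamma>0\<close>,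
  where \<open>w\<close> vanishes, bound \<open>w\<close> in \<open>L\<^sup>1\<close> on a small ball; translating sets inside \<open>\<Omega>\<close> carries the
  bound through the connected set \<open>\<Omega>\<close> and up to its boundary (\<open>korn_poincare_L1\<close>).

  For the boundary values, consider the layer of thickness \<open>h\<close> above a boundary patch. A line in a direction
  transversal to the boundary stays in this layer for a time of order \<open>h\<close>, so the integral of \<open>|w|\<close>
  over the layer is of order \<open>h\<close> (\<open>surface_trace\<close>). Dividing by \<open>h\<close> and letting \<open>h\<close> tend to zero bounds
  the surface integral (\<open>surface_integral_le_layer\<close>): the part of the surface in a ball of radius \<open>h\<close> has
  Hausdorff measure of order at most \<open>h\<^sup>2\<close>, while the layer above it contains a ball with volume of order
  \<open>h\<^sup>3\<close>. Counting disjoint balls turns this into a comparison of the two integrals.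
\<close>

section \<open>A dominated extension theorem\<close>

text \<open>
  Functionals on a subspace are represented by functions on the whole function type; they carry a meaning only on
  the subspace.
\<close>

definition function_space :: "('a \<Rightarrow> 'b::real_vector) set \<Rightarrow> bool" where
  "function_space V \<longleftrightarrow> (\<lambda>x. 0) \<in> V \<and> (\<forall>f\<in>V. \<forall>g\<in>V. (\<lambda>x. f x + g x) \<in> V) \<and>
     (\<forall>f\<in>V. \<forall>c. (\<lambda>x. c *\<^sub>R f x) \<in> V)"

definition sublinear_on :: "('a \<Rightarrow> 'b::real_vector) set \<Rightarrow> (('a \<Rightarrow> 'b) \<Rightarrow> real) \<Rightarrow> bool" where
  "sublinear_on V p \<longleftrightarrow> (\<forall>f\<in>V. \<forall>g\<in>V. p (\<lambda>x. f x + g x) \<le> p f + p g) \<and>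
     (\<forall>f\<in>V. \<forall>c\<ge>0. p (\<lambda>x. c *\<^sub>R f x) = c * p f)"

definition linear_functional_on :: "('a \<Rightarrow> 'b::real_vector) set \<Rightarrow> (('a \<Rightarrow> 'b) \<Rightarrow> real) \<Rightarrow> bool" where
  "linear_functional_on V \<phi> \<longleftrightarrow> (\<forall>f\<in>V. \<forall>g\<in>V. \<phi> (\<lambda>x. f x + g x) = \<phi> f + \<phi> g) \<and>
     (\<forall>f\<in>V. \<forall>c. \<phi> (\<lambda>x. c *\<^sub>R f x) = c * \<phi> f)"

lemma function_spaceD:
  assumes "function_space V"
  shows "(\<lambda>x. 0) \<in> V" "f \<in> V \<Longrightarrow> g \<in> V \<Longrightarrow> (\<lambda>x. f x + g x) \<in> V" "f \<in> V \<Longrightarrow> (\<lambda>x. c *\<^sub>R f x) \<in> V"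
    "f \<in> V \<Longrightarrow> (\<lambda>x. - f x) \<in> V" "f \<in> V \<Longrightarrow> g \<in> V \<Longrightarrow> (\<lambda>x. f x - g x) \<in> V"
proof -
  show 1: "(\<lambda>x. 0) \<in> V" "f \<in> V \<Longrightarrow> g \<in> V \<Longrightarrow> (\<lambda>x. f x + g x) \<in> V" "f \<in> V \<Longrightarrow> (\<lambda>x. c *\<^sub>R f x) \<in> V"
    for f g c using assms by (auto simp: function_space_def)
  show 2: "(\<lambda>x. - f x) \<in> V" if "f \<in> V" for f using 1(3)[OF that, of "-1"] by simp
  show "f \<in> V \<Longrightarrow> g \<in> V \<Longrightarrow> (\<lambda>x. f x - g x) \<in> V" using 1(2)[OF _ 2, of f g] by simp
qed

lemma sublinear_onD:
  assumes "sublinear_on V p"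
  shows "f \<in> V \<Longrightarrow> g \<in> V \<Longrightarrow> p (\<lambda>x. f x + g x) \<le> p f + p g"
    "f \<in> V \<Longrightarrow> c \<ge> 0 \<Longrightarrow> p (\<lambda>x. c *\<^sub>R f x) = c * p f"
  using assms by (auto simp: sublinear_on_def)

lemma sublinear_on_zero: "sublinear_on V p \<Longrightarrow> (\<lambda>x. 0) \<in> V \<Longrightarrow> p (\<lambda>x. 0) = 0"
  using sublinear_onD(2)[of V p "\<lambda>x. 0" 0] by simp

lemma sublinear_on_minus:
  assumes "function_space V" "sublinear_on V p" "f \<in> V"
  shows "- p (\<lambda>x. - f x) \<le> p f"
  using sublinear_onD(1)[OF assms(2,3) function_spaceD(4)[OF assms(1,3)]]
    sublinear_on_zero[OF assms(2) function_spaceD(1)[OF assms(1)]] by simp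

text \<open>
  The candidate is the infimum of \<open>p (g + f) - r\<close> over all \<open>(f, r)\<close> in the cone. The condition \<open>r \<le> p f\<close>
  keeps it above \<open>- p (- g)\<close>; taking \<open>(0, 0)\<close> puts it below \<open>p\<close>, and \<open>g = - f\<close> gives the last claim.
\<close>

lemma sublinear_below_cone:
  fixes p :: "('a \<Rightarrow> 'b::real_vector) \<Rightarrow> real"
  assumes V: "function_space V" and p: "sublinear_on V p"
    and K: "\<And>f r. (f, r) \<in> K \<Longrightarrow> f \<in> V \<and> r \<le> p f"
    and K0: "(\<lambda>x. 0, 0) \<in> K"
    and Kadd: "\<And>f r g s. (f, r) \<in> K \<Longrightarrow> (g, s) \<in> K \<Longrightarrow> (\<lambda>x. f x + g x, r + s) \<in> K"
    and Kscale: "\<And>f r c. (f, r) \<in> K \<Longrightarrow> c > 0 \<Longrightarrow> (\<lambda>x. c *\<^sub>R f x, c * r) \<in> K"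
  obtains q where "sublinear_on V q" "\<And>f. f \<in> V \<Longrightarrow> q f \<le> p f"
    "\<And>f r. (f, r) \<in> K \<Longrightarrow> q (\<lambda>x. - f x) \<le> - r"
proof -
  define q where "q g = (INF k\<in>K. p (\<lambda>x. g x + fst k x) - snd k)" for g
  note VD = function_spaceD[OF V] and pD = sublinear_onD[OF p]
  have p0: "p (\<lambda>x. 0) = 0" by (rule sublinear_on_zero[OF p VD(1)])
  have low: "- p (\<lambda>x. - g x) \<le> p (\<lambda>x. g x + f x) - r" if "g \<in> V" "(f, r) \<in> K" for f g r
  proof -
    have "p (\<lambda>x. (g x + f x) + (- g x)) \<le> p (\<lambda>x. g x + f x) + p (\<lambda>x. - g x)"
      using that K by (intro pD VD) auto
    then show ?thesis using K[OF that(2)] by simp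
  qed
  have bdd: "bdd_below ((\<lambda>k. p (\<lambda>x. g x + fst k x) - snd k) ` K)" if "g \<in> V" for g
    using low[OF that] by (intro bdd_belowI2[where m="- p (\<lambda>x. - g x)"]) auto
  have q_le: "q g \<le> p (\<lambda>x. g x + f x) - r" if "g \<in> V" "(f, r) \<in> K" for f g r
    unfolding q_def using cINF_lower[OF bdd[OF that(1)] that(2)] by simp
  have q_ge: "z \<le> q g" if "\<And>f r. (f, r) \<in> K \<Longrightarrow> z \<le> p (\<lambda>x. g x + f x) - r" for z g
    unfolding q_def using K0 that by (intro cINF_greatest) auto
  have qp: "q f \<le> p f" if "f \<in> V" for f using q_le[OF that K0] by simp
  have hom_le: "c * q f \<le> q (\<lambda>x. c *\<^sub>R f x)" if "f \<in> V" "c > 0" for f c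
  proof (rule q_ge)
    fix g r assume gr: "(g, r) \<in> K"
    have "q f \<le> p (\<lambda>x. f x + (1 / c) *\<^sub>R g x) - (1 / c) * r"
      using that Kscale[OF gr, of "1/c"] by (intro q_le) auto
    then have "c * q f \<le> c * p (\<lambda>x. f x + (1 / c) *\<^sub>R g x) - r"
      using \<open>c > 0\<close> mult_left_mono[of "q f" _ c] by (fastforce simp: right_diff_distrib)
    also have "c * p (\<lambda>x. f x + (1 / c) *\<^sub>R g x) = p (\<lambda>x. c *\<^sub>R (f x + (1 / c) *\<^sub>R g x))"
      using that K[OF gr] by (intro pD(2)[symmetric] VD) auto
    also have "(\<lambda>x. c *\<^sub>R (f x + (1 / c) *\<^sub>R g x)) = (\<lambda>x. c *\<^sub>R f x + g x)"
      using \<open>c > 0\<close> by (auto simp: scaleR_add_right)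
    finally show "c * q f \<le> p (\<lambda>x. c *\<^sub>R f x + g x) - r" .
  qed
  have hom: "q (\<lambda>x. c *\<^sub>R f x) = c * q f" if "f \<in> V" "c \<ge> 0" for f c
  proof (cases "c = 0")
    case True
    have "q (\<lambda>x. 0) = 0"
      using qp[OF VD(1)] p0 K by (intro antisym q_ge) auto
    then show ?thesis using True by simp
  next
    case False
    then have c: "c > 0" using that by simp
    have "(1/c) * q (\<lambda>x. c *\<^sub>R f x) \<le> q (\<lambda>x. (1/c) *\<^sub>R (c *\<^sub>R f x))"
      using that c by (intro hom_le VD) auto
    then have "q (\<lambda>x. c *\<^sub>R f x) \<le> c * q f" using c by (simp add: field_simps)
    with hom_le[OF that(1) c] show ?thesis by simp
  qed
  have sub: "q (\<lambda>x. f x + g x) \<le> q f + q g" if "f \<in> V" "g \<in> V" for f g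
  proof -
    have "q (\<lambda>x. f x + g x) - q g \<le> q f"
    proof (rule q_ge)
      fix h r assume h: "(h, r) \<in> K"
      have "q (\<lambda>x. f x + g x) - (p (\<lambda>x. f x + h x) - r) \<le> q g"
      proof (rule q_ge)
        fix l s assume l: "(l, s) \<in> K"
        have "q (\<lambda>x. f x + g x) \<le> p (\<lambda>x. f x + g x + (h x + l x)) - (r + s)"
          using that Kadd[OF h l] by (intro q_le VD) auto
        also have "p (\<lambda>x. f x + g x + (h x + l x)) = p (\<lambda>x. (f x + h x) + (g x + l x))"
          by (simp add: algebra_simps)
        also have "\<dots> \<le> p (\<lambda>x. f x + h x) + p (\<lambda>x. g x + l x)"
          using that K[OF h] K[OF l] by (intro pD VD) auto
        finally show "q (\<lambda>x. f x + g x) - (p (\<lambda>x. f x + h x) - r) \<le> p (\<lambda>x. g x + l x) - s" by simp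
      qed
      then show "q (\<lambda>x. f x + g x) - q g \<le> p (\<lambda>x. f x + h x) - r" by simp
    qed
    then show ?thesis by simp
  qed
  have "q (\<lambda>x. - f x) \<le> - r" if "(f, r) \<in> K" for f r
    using q_le[OF VD(4) that, of f] K[OF that] p0 by simp
  then show thesis using that[of q] hom sub qp by (auto simp: sublinear_on_def)
qed

text \<open>
  Zorn's lemma: the pointwise infimum of a chain of sublinear functionals is sublinear, and it is finite because
  all of them lie above \<open>- p (- f)\<close>. Members of the ordered set are set to \<open>0\<close> outside the subspace so
  that the pointwise order is antisymmetric.
\<close>

lemma minimal_sublinear_below:
  fixes p :: "('a \<Rightarrow> 'b::real_vector) \<Rightarrow> real"
  assumes V: "function_space V" and p: "sublinear_on V p"
  obtains m where "sublinear_on V m" "\<And>f. f \<in> V \<Longrightarrow> m f \<le> p f"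
    "\<And>q f. sublinear_on V q \<Longrightarrow> (\<And>f. f \<in> V \<Longrightarrow> q f \<le> m f) \<Longrightarrow> f \<in> V \<Longrightarrow> q f = m f"
proof -
  note VD = function_spaceD[OF V] and pD = sublinear_onD[OF p]
  define A where "A = {q. sublinear_on V q \<and> (\<forall>f\<in>V. q f \<le> p f) \<and> (\<forall>f. f \<notin> V \<longrightarrow> q f = 0)}"
  define P where "P q q' \<longleftrightarrow> (\<forall>f\<in>V. q' f \<le> q f)" for q q' :: "('a \<Rightarrow> 'b) \<Rightarrow> real"
  have restr: "sublinear_on V (\<lambda>f. if f \<in> V then q f else 0)" if "sublinear_on V q" for q
    using that VD(2,3) by (auto simp: sublinear_on_def)
  have inA: "(\<lambda>f. if f \<in> V then q f else 0) \<in> A" if "sublinear_on V q" "\<And>f. f \<in> V \<Longrightarrow> q f \<le> p f" for q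
    using restr[OF that(1)] that(2) by (auto simp: A_def)
  have po: "partial_order_on A (relation_of P A)"
  proof -
    have "f = g" if "f \<in> A" "g \<in> A" "P f g" "P g f" for f g
    proof
      fix x show "f x = g x" using that by (cases "x \<in> V") (auto simp: A_def P_def intro: antisym)
    qed
    then show ?thesis
      unfolding partial_order_on_def preorder_on_def refl_on_def trans_def antisym_def relation_of_def P_def
      by (auto intro: order_trans)
  qed
  have "\<exists>m\<in>A. \<forall>a\<in>A. P m a \<longrightarrow> a = m"
  proof (rule predicate_Zorn[OF po])
    fix C assume C: "C \<in> Chains (relation_of P A)"
    then have CA: "\<And>q. q \<in> C \<Longrightarrow> q \<in> A" and tot: "\<And>q q'. q \<in> C \<Longrightarrow> q' \<in> C \<Longrightarrow> P q q' \<or> P q' q"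
      by (auto simp: Chains_def relation_of_def)
    show "\<exists>u\<in>A. \<forall>a\<in>C. P a u"
    proof (cases "C = {}")
      case True
      then show ?thesis using inA[OF p] by auto
    next
      case False
      define u where "u f = (INF q\<in>C. q f)" for f
      have sl: "sublinear_on V q" "f \<in> V \<Longrightarrow> q f \<le> p f" if "q \<in> C" for q f
        using CA[OF that] by (auto simp: A_def)
      have low: "- p (\<lambda>x. - f x) \<le> q f" if "q \<in> C" "f \<in> V" for q f
        using sublinear_on_minus[OF V sl(1)[OF that(1)] that(2)] sl(2)[OF that(1) VD(4)[OF that(2)]] by simp
      have u_le: "u f \<le> q f" if "q \<in> C" "f \<in> V" for q f
        unfolding u_def using that low by (intro cINF_lower bdd_belowI2[where m="- p (\<lambda>x. - f x)"]) auto
      have u_ge: "z \<le> u f" if "\<And>q. q \<in> C \<Longrightarrow> z \<le> q f" for z f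
        unfolding u_def using False that by (intro cINF_greatest) auto
      have "sublinear_on V u"
        unfolding sublinear_on_def
      proof (intro conjI ballI allI impI)
        fix f g assume fg: "f \<in> V" "g \<in> V"
        have "u (\<lambda>x. f x + g x) - u g \<le> u f"
        proof (rule u_ge)
          fix q assume q: "q \<in> C"
          have "u (\<lambda>x. f x + g x) - q f \<le> u g"
          proof (rule u_ge)
            fix q' assume q': "q' \<in> C"
            obtain r where r: "r \<in> C" "P q r" "P q' r"
              using tot[OF q q'] q q' by (auto simp: P_def)
            have "u (\<lambda>x. f x + g x) \<le> r (\<lambda>x. f x + g x)" using fg r VD by (intro u_le) auto
            also have "\<dots> \<le> r f + r g" using sublinear_onD(1)[OF sl(1)[OF r(1)] fg] .
            also have "\<dots> \<le> q f + q' g" using r fg by (auto simp: P_def intro: add_mono)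
            finally show "u (\<lambda>x. f x + g x) - q f \<le> q' g" by simp
          qed
          then show "u (\<lambda>x. f x + g x) - u g \<le> q f" by simp
        qed
        then show "u (\<lambda>x. f x + g x) \<le> u f + u g" by simp
      next
        fix f and c :: real assume fc: "f \<in> V" "0 \<le> c"
        have sc: "q (\<lambda>x. c *\<^sub>R f x) = c * q f" if "q \<in> C" for q
          using sublinear_onD(2)[OF sl(1)[OF that] fc] .
        show "u (\<lambda>x. c *\<^sub>R f x) = c * u f"
        proof (cases "c = 0")
          case True
          have "q (\<lambda>x. c *\<^sub>R f x) = 0" if "q \<in> C" for q using sc[OF that] True by simp
          then have "(\<lambda>q. q (\<lambda>x. c *\<^sub>R f x)) ` C = (\<lambda>q. 0) ` C" by (intro image_cong refl)
          then show ?thesis using True False by (simp add: u_def)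
        next
          case c: False
          then have "c > 0" using fc by simp
          show ?thesis
          proof (rule antisym)
            have "u (\<lambda>x. c *\<^sub>R f x) / c \<le> u f"
            proof (rule u_ge)
              fix q assume q: "q \<in> C"
              have "u (\<lambda>x. c *\<^sub>R f x) \<le> c * q f"
                using u_le[OF q, of "\<lambda>x. c *\<^sub>R f x"] VD fc sc[OF q] by auto
              then show "u (\<lambda>x. c *\<^sub>R f x) / c \<le> q f" using \<open>c > 0\<close> by (simp add: field_simps)
            qed
            then show "u (\<lambda>x. c *\<^sub>R f x) \<le> c * u f" using \<open>c > 0\<close> by (simp add: field_simps)
            show "c * u f \<le> u (\<lambda>x. c *\<^sub>R f x)"
              using u_le[OF _ fc(1)] fc(2) by (intro u_ge) (simp add: sc mult_left_mono)
          qed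
        qed
      qed
      moreover have "u f \<le> p f" if "f \<in> V" for f
        using False u_le sl(2) that by (meson ex_in_conv order_trans)
      ultimately show ?thesis using u_le inA[of u]
        by (intro bexI[of _ "\<lambda>f. if f \<in> V then u f else 0"]) (auto simp: P_def)
    qed
  qed
  then obtain m where m: "m \<in> A" "\<And>a. a \<in> A \<Longrightarrow> P m a \<Longrightarrow> a = m" by blast
  have min: "q f = m f" if q: "sublinear_on V q" "\<And>f. f \<in> V \<Longrightarrow> q f \<le> m f" and f: "f \<in> V" for q f
  proof -
    have "(\<lambda>f. if f \<in> V then q f else 0) = m"
    proof (rule m(2))
      show "(\<lambda>f. if f \<in> V then q f else 0) \<in> A"
        using m(1) q by (intro inA) (auto simp: A_def intro: order_trans)
    qed (use q in \<open>auto simp: P_def\<close>)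
    from fun_cong[OF this, of f] show ?thesis using f by simp
  qed
  show thesis
  proof (rule that[of m])
    show "sublinear_on V m" using m(1) by (simp add: A_def)
    show "m f \<le> p f" if "f \<in> V" for f using m(1) that by (auto simp: A_def)
  qed (rule min)
qed

text \<open>
  A minimal sublinear functional is linear. Lowering it along the ray through \<open>f\<close> changes nothing, which
  forces \<open>m (- f) = - m f\<close>, and a sublinear functional with this symmetry is additive.
\<close>

lemma linear_functional_below_sublinear:
  fixes p :: "('a \<Rightarrow> 'b::real_vector) \<Rightarrow> real"
  assumes V: "function_space V" and p: "sublinear_on V p"
  obtains \<phi> where "linear_functional_on V \<phi>" "\<And>f. f \<in> V \<Longrightarrow> \<phi> f \<le> p f"
proof -
  note VD = function_spaceD[OF V]
  obtain m where m: "sublinear_on V m" "\<And>f. f \<in> V \<Longrightarrow> m f \<le> p f"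
    and min: "\<And>q f. sublinear_on V q \<Longrightarrow> (\<And>f. f \<in> V \<Longrightarrow> q f \<le> m f) \<Longrightarrow> f \<in> V \<Longrightarrow> q f = m f"
    using minimal_sublinear_below[OF V p] by blast
  note mD = sublinear_onD[OF m(1)]
  have neg: "m (\<lambda>x. - f x) = - m f" if f: "f \<in> V" for f
  proof -
    \<comment> \<open>The ray through \<open>f\<close>: by minimality, the functional that it yields is again \<open>m\<close>.\<close>
    define K where "K = {(\<lambda>x. s *\<^sub>R f x, s * m f) | s. s \<ge> 0}"
    have KE: "\<exists>a\<ge>0. g = (\<lambda>x. a *\<^sub>R f x) \<and> r = a * m f" if "(g, r) \<in> K" for g r
      using that unfolding K_def mem_Collect_eq prod.inject by blast
    have K0: "(\<lambda>x. 0, 0) \<in> K" unfolding K_def by (intro CollectI exI[of _ 0]) simp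
    have Kadd: "(\<lambda>x. g x + h x, r + s) \<in> K" if gh: "(g, r) \<in> K" "(h, s) \<in> K" for g h r s
    proof -
      obtain a where a: "g = (\<lambda>x. a *\<^sub>R f x)" "r = a * m f" "a \<ge> 0" using KE[OF gh(1)] by blast
      obtain b where b: "h = (\<lambda>x. b *\<^sub>R f x)" "s = b * m f" "b \<ge> 0" using KE[OF gh(2)] by blast
      with a b show ?thesis unfolding K_def by (intro CollectI exI[of _ "a + b"]) (auto simp: algebra_simps)
    qed
    have Kscale: "(\<lambda>x. c *\<^sub>R g x, c * r) \<in> K" if gc: "(g, r) \<in> K" "c > 0" for g r c
    proof -
      obtain a where "g = (\<lambda>x. a *\<^sub>R f x)" "r = a * m f" "a \<ge> 0" using KE[OF gc(1)] by blast
      then show ?thesis unfolding K_def using gc(2) by (intro CollectI exI[of _ "c * a"]) auto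
    qed
    have KV: "g \<in> V \<and> r \<le> m g" if "(g, r) \<in> K" for g r
      using that f mD(2)[OF f] VD(3)[OF f] by (auto simp: K_def)
    obtain q where q: "sublinear_on V q" "\<And>f. f \<in> V \<Longrightarrow> q f \<le> m f"
      "\<And>g r. (g, r) \<in> K \<Longrightarrow> q (\<lambda>x. - g x) \<le> - r"
      using sublinear_below_cone[OF V m(1) KV K0 Kadd Kscale] by metis
    have "(f, m f) \<in> K" unfolding K_def by (intro CollectI exI[of _ 1]) simp
    then have "m (\<lambda>x. - f x) \<le> - m f" using q(3) min[OF q(1,2) VD(4)[OF f]] by metis
    with sublinear_on_minus[OF V m(1) f] show ?thesis by simp
  qed
  have add: "m (\<lambda>x. f x + g x) = m f + m g" if "f \<in> V" "g \<in> V" for f g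
  proof (rule antisym)
    show "m (\<lambda>x. f x + g x) \<le> m f + m g" using mD(1)[OF that] .
    have "m (\<lambda>x. (f x + g x) + - g x) \<le> m (\<lambda>x. f x + g x) + m (\<lambda>x. - g x)"
      using that by (intro mD VD) auto
    then show "m f + m g \<le> m (\<lambda>x. f x + g x)" using neg[OF that(2)] by simp
  qed
  have scale: "m (\<lambda>x. c *\<^sub>R f x) = c * m f" if f: "f \<in> V" for f c
  proof (cases "c \<ge> 0")
    case False
    then have "m (\<lambda>x. - ((-c) *\<^sub>R f x)) = - ((-c) * m f)"
      using neg[OF VD(3)[OF f, of "-c"]] mD(2)[OF f, of "-c"] by simp
    then show ?thesis by simp
  qed (use mD f in auto)
  show thesis using that[of m] m(2) add scale by (auto simp: linear_functional_on_def)
qed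

text \<open>
  A form of the Hahn--Banach theorem due to Mazur and Orlicz: prescribing lower bounds on a convex cone instead
  of values on a subspace avoids having to show that a functional of the strain is well defined.
\<close>

theorem mazur_orlicz_cone:
  fixes p :: "('a \<Rightarrow> 'b::real_vector) \<Rightarrow> real"
  assumes V: "function_space V" and p: "sublinear_on V p"
    and K: "\<And>f r. (f, r) \<in> K \<Longrightarrow> f \<in> V \<and> r \<le> p f"
    and K0: "(\<lambda>x. 0, 0) \<in> K"
    and Kadd: "\<And>f r g s. (f, r) \<in> K \<Longrightarrow> (g, s) \<in> K \<Longrightarrow> (\<lambda>x. f x + g x, r + s) \<in> K"
    and Kscale: "\<And>f r c. (f, r) \<in> K \<Longrightarrow> c > 0 \<Longrightarrow> (\<lambda>x. c *\<^sub>R f x, c * r) \<in> K"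
  obtains \<phi> where "linear_functional_on V \<phi>" "\<And>f. f \<in> V \<Longrightarrow> \<phi> f \<le> p f"
    "\<And>f r. (f, r) \<in> K \<Longrightarrow> r \<le> \<phi> f"
proof -
  obtain q where q: "sublinear_on V q" "\<And>f. f \<in> V \<Longrightarrow> q f \<le> p f"
    "\<And>f r. (f, r) \<in> K \<Longrightarrow> q (\<lambda>x. - f x) \<le> - r"
    using sublinear_below_cone[OF V p K K0 Kadd Kscale] by metis
  obtain \<phi> where \<phi>: "linear_functional_on V \<phi>" "\<And>f. f \<in> V \<Longrightarrow> \<phi> f \<le> q f"
    using linear_functional_below_sublinear[OF V q(1)] by blast
  have "r \<le> \<phi> f" if "(f, r) \<in> K" for f r
  proof -
    have fV: "f \<in> V" using K[OF that] by simp
    have "\<phi> (\<lambda>x. (-1) *\<^sub>R f x) = (-1) * \<phi> f" using \<phi>(1) fV unfolding linear_functional_on_def by blast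
    then have "- \<phi> f \<le> q (\<lambda>x. - f x)" using \<phi>(2)[OF function_spaceD(4)[OF V fV]] by simp
    also have "\<dots> \<le> - r" by (rule q(3)[OF that])
    finally show ?thesis by simp
  qed
  then show thesis using that[of \<phi>] \<phi> q(2) by (meson order_trans)
qed

section \<open>The dual of the space of integrable functions\<close>

lemma AE_le_const_if_set_integrals_le:
  fixes g :: "'a \<Rightarrow> real"
  assumes "finite_measure M" and g: "integrable M g"
    and le: "\<And>A. A \<in> sets M \<Longrightarrow> (\<integral>x. indicator A x * g x \<partial>M) \<le> c * measure M A"
  shows "AE x in M. g x \<le> c"
proof -
  interpret finite_measure M by fact
  note g[measurable]
  define A where "A = {x \<in> space M. c < g x}"
  have A[measurable]: "A \<in> sets M" unfolding A_def by measurable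
  have int: "integrable M (\<lambda>x. indicator A x * (g x - c))"
    using integrable_real_mult_indicator[OF A, of "\<lambda>x. g x - c"] g by (simp add: mult.commute)
  have int1: "integrable M (\<lambda>x. indicator A x * g x)"
    using integrable_real_mult_indicator[OF A, of g] g by (simp add: mult.commute)
  have int2: "integrable M (\<lambda>x. indicator A x * c)" by (auto simp: emeasure_eq_measure)
  have nn: "0 \<le> indicator A x * (g x - c)" for x by (auto simp: A_def indicator_def)
  have "(\<integral>x. indicator A x * (g x - c) \<partial>M) = (\<integral>x. indicator A x * g x \<partial>M) - c * measure M A"
    using int1 int2 by (simp add: right_diff_distrib)
  also have "\<dots> \<le> 0" using le[OF A] by simp
  finally have "(\<integral>x. indicator A x * (g x - c) \<partial>M) = 0"
    using nn by (intro antisym) (auto intro!: integral_nonneg)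
  then have "AE x in M. indicator A x * (g x - c) = 0"
    using integral_nonneg_eq_0_iff_AE[OF int] nn by auto
  then show ?thesis
    using AE_space by eventually_elim (auto simp: A_def indicator_def split: if_splits)
qed

text \<open>
  The set function \<open>A \<mapsto> \<phi> (indicator A)\<close> is a signed measure. Adding \<open>B\<close> times the given measure makes it
  nonnegative, so that the Radon--Nikodym theorem applies; the density minus \<open>B\<close> is the required function.
\<close>

theorem L1_functional_density:
  fixes \<phi> :: "('a \<Rightarrow> real) \<Rightarrow> real"
  assumes M: "finite_measure M" and B: "0 \<le> B"
    and add: "\<And>f g. integrable M f \<Longrightarrow> integrable M g \<Longrightarrow> \<phi> (\<lambda>x. f x + g x) = \<phi> f + \<phi> g"
    and scale: "\<And>f c. integrable M f \<Longrightarrow> \<phi> (\<lambda>x. c * f x) = c * \<phi> f"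
    and bound: "\<And>f. integrable M f \<Longrightarrow> \<bar>\<phi> f\<bar> \<le> B * (\<integral>x. \<bar>f x\<bar> \<partial>M)"
  shows "\<exists>g\<in>borel_measurable M. (AE x in M. \<bar>g x\<bar> \<le> B) \<and>
    (\<forall>f. integrable M f \<longrightarrow> \<phi> f = (\<integral>x. f x * g x \<partial>M))"
proof -
  interpret finite_measure M by fact
  have ind[simp]: "integrable M (indicator A :: 'a \<Rightarrow> real)" if "A \<in> sets M" for A
    using that by (auto simp: emeasure_eq_measure)
  have ind_bound: "\<bar>\<phi> (indicator A)\<bar> \<le> B * measure M A" if "A \<in> sets M" for A
    using bound[OF ind[OF that]] that by simp
  \<comment> \<open>The multiple of the measure of \<open>A\<close> makes \<open>\<nu>\<close> nonnegative.\<close>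
  define \<nu> where "\<nu> A = \<phi> (indicator A) + B * measure M A" for A
  have \<nu>0: "0 \<le> \<nu> A" and \<nu>_le: "\<nu> A \<le> 2 * B * measure M A" if "A \<in> sets M" for A
    using ind_bound[OF that] by (auto simp: \<nu>_def)
  have \<nu>_empty: "\<nu> {} = 0" using \<nu>_le[of "{}"] \<nu>0[of "{}"] by simp
  have \<nu>_add: "\<nu> (X \<union> Y) = \<nu> X + \<nu> Y" if "X \<in> sets M" "Y \<in> sets M" "X \<inter> Y = {}" for X Y
  proof -
    have "\<phi> (indicator (X \<union> Y)) = \<phi> (\<lambda>x. indicator X x + indicator Y x)"
      using that(3) by (intro arg_cong[where f=\<phi>]) (auto simp: fun_eq_iff indicator_def)
    then show ?thesis
      using that by (simp add: \<nu>_def add finite_measure_Union algebra_simps)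
  qed
  define N where "N = measure_of (space M) (sets M) (\<lambda>A. ennreal (\<nu> A))"
  have setsN: "sets N = sets M" unfolding N_def by simp
  have ca: "countably_additive (sets M) (\<lambda>A. ennreal (\<nu> A))"
  proof (rule sets.empty_continuous_imp_countably_additive)
    show "positive (sets M) (\<lambda>A. ennreal (\<nu> A))" by (auto simp: positive_def \<nu>_empty)
    show "additive (sets M) (\<lambda>A. ennreal (\<nu> A))"
      using \<nu>0 by (auto simp: additive_def \<nu>_add)
    show "\<forall>A\<in>sets M. ennreal (\<nu> A) \<noteq> \<infinity>" by simp
    fix A :: "nat \<Rightarrow> 'a set" assume A: "range A \<subseteq> sets M" "decseq A" "(\<Inter>i. A i) = {}"
    have "(\<lambda>i. measure M (A i)) \<longlonglongrightarrow> measure M (\<Inter>i. A i)"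
      by (rule finite_Lim_measure_decseq[OF A(1,2)])
    then have lim: "(\<lambda>i. 2 * B * measure M (A i)) \<longlonglongrightarrow> 0"
      using tendsto_mult_right_zero A(3) by (auto intro!: tendsto_eq_intros)
    have "(\<lambda>i. \<nu> (A i)) \<longlonglongrightarrow> 0"
      by (rule tendsto_sandwich[OF _ _ tendsto_const lim]) (use A \<nu>0 \<nu>_le in auto)
    then show "(\<lambda>i. ennreal (\<nu> (A i))) \<longlonglongrightarrow> 0" using tendsto_ennrealI by fastforce
  qed
  have emN: "emeasure N A = ennreal (\<nu> A)" if "A \<in> sets M" for A
    unfolding N_def
  proof (rule emeasure_measure_of_sigma)
    show "sigma_algebra (space M) (sets M)" by (rule sets.sigma_algebra_axioms)
    show "positive (sets M) (\<lambda>A. ennreal (\<nu> A))" by (auto simp: positive_def \<nu>_empty)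
  qed (rule ca that)+
  have "absolutely_continuous M N"
    unfolding absolutely_continuous_def
  proof
    fix A assume "A \<in> null_sets M"
    then have "A \<in> sets M" "measure M A = 0" by (auto simp: null_sets_def measure_def)
    then have "\<nu> A = 0" using \<nu>0[of A] \<nu>_le[of A] by simp
    then show "A \<in> null_sets N" using emN \<open>A \<in> sets M\<close> setsN by auto
  qed
  then obtain f where f[measurable]: "f \<in> borel_measurable M" and fN: "density M f = N"
    using Radon_Nikodym setsN by blast
  have fA: "(\<integral>\<^sup>+x. f x * indicator A x \<partial>M) = ennreal (\<nu> A)" if "A \<in> sets M" for A
    using emeasure_density[OF f that] fN emN[OF that] by simp
  have "(\<integral>\<^sup>+x. f x \<partial>M) = (\<integral>\<^sup>+x. f x * indicator (space M) x \<partial>M)"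
    by (intro nn_integral_cong) auto
  also have "\<dots> < \<infinity>" by (subst fA) auto
  finally have fin: "(\<integral>\<^sup>+x. f x \<partial>M) < \<infinity>" .
  then have AEf: "AE x in M. f x \<noteq> \<infinity>" by (intro nn_integral_PInf_AE) auto
  define r where "r x = enn2real (f x)" for x
  have r[measurable]: "r \<in> borel_measurable M" by (simp add: r_def[abs_def])
  have AEr: "AE x in M. ennreal (r x) = f x"
    using AEf by eventually_elim (auto simp: r_def less_top)
  have intr: "integrable M r"
  proof (rule integrableI_nonneg)
    show "(\<integral>\<^sup>+x. ennreal (r x) \<partial>M) < \<infinity>" using fin nn_integral_cong_AE[OF AEr] by simp
  qed (auto simp: r_def)
  have rA: "(\<integral>x. indicator A x * r x \<partial>M) = \<nu> A" if A: "A \<in> sets M" for A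
  proof -
    have "(\<integral>\<^sup>+x. ennreal (indicator A x * r x) \<partial>M) = (\<integral>\<^sup>+x. f x * indicator A x \<partial>M)"
      using AEr by (intro nn_integral_cong_AE, eventually_elim) (auto simp: indicator_def)
    then have "(\<integral>\<^sup>+x. ennreal (indicator A x * r x) \<partial>M) = ennreal (\<nu> A)" using fA[OF A] by simp
    then show ?thesis
      using A \<nu>0[OF A] by (intro integral_eq_nn_integral[THEN trans]) (auto simp: r_def)
  qed
  define g where "g x = r x - B" for x
  have g[measurable]: "g \<in> borel_measurable M" by (simp add: g_def[abs_def])
  have intg: "integrable M g" using intr by (simp add: g_def[abs_def])
  have gA: "(\<integral>x. indicator A x * g x \<partial>M) = \<phi> (indicator A)" if A: "A \<in> sets M" for A
  proof -
    have "integrable M (\<lambda>x. indicator A x * r x)"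
      using integrable_real_mult_indicator[OF A intr] by (simp add: mult.commute)
    moreover have "integrable M (\<lambda>x. indicator A x * B)" using A by (auto simp: emeasure_eq_measure)
    ultimately show ?thesis using rA[OF A] A by (simp add: g_def right_diff_distrib \<nu>_def)
  qed
  have up: "AE x in M. g x \<le> B"
    using ind_bound gA by (intro AE_le_const_if_set_integrals_le[OF M intg]) force
  have "AE x in M. - g x \<le> B"
    using ind_bound gA intg by (intro AE_le_const_if_set_integrals_le[OF M]) force+
  with up have gB: "AE x in M. \<bar>g x\<bar> \<le> B" by eventually_elim auto
  have mult: "integrable M (\<lambda>x. f x * g x)" if "integrable M f" for f
  proof (rule Bochner_Integration.integrable_bound[of M "\<lambda>x. B * f x"])
    show "AE x in M. norm (f x * g x) \<le> norm (B * f x)"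
      using gB
    proof eventually_elim
      case (elim x)
      from mult_right_mono[OF elim, of "\<bar>f x\<bar>"] show ?case using B by (simp add: abs_mult mult.commute)
    qed
  qed (use that in auto)
  have main: "\<phi> f = (\<integral>x. f x * g x \<partial>M)" if "integrable M f" for f
    using that
  proof (induction f rule: integrable_induct)
    case (base A c)
    have "\<phi> (\<lambda>x. c * indicator A x) = c * \<phi> (indicator A)" using base by (intro scale) simp
    then show ?case using gA[OF base(1)] by (simp add: mult_ac)
  next
    case (add f g)
    note [simp] = mult[OF add.hyps(1)] mult[OF add.hyps(2)]
    show ?case
      unfolding assms(3)[OF add.hyps(1,2)] add.IH by (simp add: distrib_right)
  next
    case (lim f s)
    note [measurable] = borel_measurable_integrable[OF lim.hyps(4)] borel_measurable_integrable[OF lim.hyps(1)]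
    have 1: "(\<lambda>i. \<integral>x. s i x * g x \<partial>M) \<longlonglongrightarrow> (\<integral>x. f x * g x \<partial>M)"
    proof (rule integral_dominated_convergence[where w="\<lambda>x. B * (2 * \<bar>f x\<bar>)"])
      show "AE x in M. (\<lambda>i. s i x * g x) \<longlonglongrightarrow> f x * g x"
        using AE_space by eventually_elim (auto intro!: tendsto_intros lim.hyps(2))
      show "AE x in M. norm (s i x * g x) \<le> B * (2 * \<bar>f x\<bar>)" for i
        using AE_space gB
      proof eventually_elim
        case (elim x)
        have "\<bar>s i x\<bar> \<le> 2 * \<bar>f x\<bar>" using lim.hyps(3)[OF elim(1), of i] by simp
        then show ?case using elim(2) B mult_mono[of "\<bar>g x\<bar>" B "\<bar>s i x\<bar>" "2 * \<bar>f x\<bar>"] by (simp add: abs_mult mult.commute)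
      qed
    qed (use lim.hyps(4) in auto)
    have 2: "(\<lambda>i. \<integral>x. \<bar>s i x - f x\<bar> \<partial>M) \<longlonglongrightarrow> (\<integral>x. 0 \<partial>M)"
    proof (rule integral_dominated_convergence[where w="\<lambda>x. 3 * \<bar>f x\<bar>"])
      show "AE x in M. (\<lambda>i. \<bar>s i x - f x\<bar>) \<longlonglongrightarrow> 0"
        using AE_space by eventually_elim (auto intro!: tendsto_rabs_zero LIM_zero lim.hyps(2))
      show "AE x in M. norm \<bar>s i x - f x\<bar> \<le> 3 * \<bar>f x\<bar>" for i
        using AE_space
      proof eventually_elim
        case (elim x)
        then show ?case using lim.hyps(3)[OF elim(1), of i] by simp
      qed
    qed (use lim.hyps(4) in auto)
    have diff: "\<bar>\<phi> (s i) - \<phi> f\<bar> \<le> B * (\<integral>x. \<bar>s i x - f x\<bar> \<partial>M)" for i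
    proof -
      have "\<phi> (s i) - \<phi> f = \<phi> (\<lambda>x. s i x + (-1) * f x)"
        using assms(3)[OF lim.hyps(1), of "\<lambda>x. (-1) * f x" i] scale[OF lim.hyps(4), of "-1"] lim.hyps(4) by simp
      then show ?thesis using bound[of "\<lambda>x. s i x + (-1) * f x"] lim.hyps(1,4) by simp
    qed
    have "(\<lambda>i. \<phi> (s i) - \<phi> f) \<longlonglongrightarrow> 0"
    proof (rule tendsto_rabs_zero_cancel, rule tendsto_sandwich[OF _ _ tendsto_const])
      show "(\<lambda>i. B * (\<integral>x. \<bar>s i x - f x\<bar> \<partial>M)) \<longlonglongrightarrow> 0"
        using tendsto_mult_right_zero[OF 2[simplified], of B] by simp
    qed (use diff in auto)
    then have "(\<lambda>i. \<phi> (s i)) \<longlonglongrightarrow> \<phi> f" by (rule LIM_zero_cancel)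
    then show ?case using 1 lim.IH LIMSEQ_unique by simp
  qed
  show ?thesis
  proof (rule bexI[OF _ g], rule conjI[OF gB], intro allI impI)
    fix f :: "'a \<Rightarrow> real" assume "integrable M f"
    then show "\<phi> f = (\<integral>x. f x * g x \<partial>M)" by (rule main)
  qed
qed

lemma function_space_integrable: "function_space {f. integrable M f}"
  unfolding function_space_def mem_Collect_eq by (intro conjI ballI allI) simp_all

text \<open>
  The scalar case applied to each coordinate.
\<close>

theorem L1_functional_density_vector:
  fixes \<phi> :: "('a \<Rightarrow> 'b::euclidean_space) \<Rightarrow> real"
  assumes M: "finite_measure M" and B: "0 \<le> B"
    and lin: "linear_functional_on {f. integrable M f} \<phi>"
    and bound: "\<And>f. integrable M f \<Longrightarrow> \<bar>\<phi> f\<bar> \<le> B * (\<integral>x. norm (f x) \<partial>M)"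
  shows "\<exists>g\<in>borel_measurable M. (\<exists>C. AE x in M. norm (g x) \<le> C) \<and>
    (\<forall>f. integrable M f \<longrightarrow> integrable M (\<lambda>x. f x \<bullet> g x) \<and> \<phi> f = (\<integral>x. f x \<bullet> g x \<partial>M))"
proof -
  have add: "\<phi> (\<lambda>x. f x + g x) = \<phi> f + \<phi> g" if "integrable M f" "integrable M g" for f g
    using lin that by (auto simp: linear_functional_on_def)
  have scale: "\<phi> (\<lambda>x. c *\<^sub>R f x) = c * \<phi> f" if "integrable M f" for f c
    using lin that by (auto simp: linear_functional_on_def)
  have "\<exists>g. g \<in> borel_measurable M \<and> (AE x in M. \<bar>g x\<bar> \<le> B) \<and>
      (\<forall>f. integrable M f \<longrightarrow> \<phi> (\<lambda>x. f x *\<^sub>R b) = (\<integral>x. f x * g x \<partial>M))" if b: "b \<in> Basis" for b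
  proof -
    have "\<exists>g\<in>borel_measurable M. (AE x in M. \<bar>g x\<bar> \<le> B) \<and>
      (\<forall>f. integrable M f \<longrightarrow> \<phi> (\<lambda>x. f x *\<^sub>R b) = (\<integral>x. f x * g x \<partial>M))"
    proof (rule L1_functional_density[OF M B, of "\<lambda>f. \<phi> (\<lambda>x. f x *\<^sub>R b)"])
      fix f g :: "'a \<Rightarrow> real" and c :: real
      assume f: "integrable M f"
      show "\<phi> (\<lambda>x. (f x + g x) *\<^sub>R b) = \<phi> (\<lambda>x. f x *\<^sub>R b) + \<phi> (\<lambda>x. g x *\<^sub>R b)" if "integrable M g"
        using add[of "\<lambda>x. f x *\<^sub>R b" "\<lambda>x. g x *\<^sub>R b"] f that by (simp add: scaleR_add_left)
      show "\<phi> (\<lambda>x. (c * f x) *\<^sub>R b) = c * \<phi> (\<lambda>x. f x *\<^sub>R b)"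
        using scale[of "\<lambda>x. f x *\<^sub>R b" c] f by simp
      show "\<bar>\<phi> (\<lambda>x. f x *\<^sub>R b)\<bar> \<le> B * (\<integral>x. \<bar>f x\<bar> \<partial>M)"
        using bound[of "\<lambda>x. f x *\<^sub>R b"] f b by simp
    qed
    then show ?thesis unfolding Bex_def .
  qed
  then have "\<forall>b\<in>Basis. \<exists>g. g \<in> borel_measurable M \<and> (AE x in M. \<bar>g x\<bar> \<le> B) \<and>
      (\<forall>f. integrable M f \<longrightarrow> \<phi> (\<lambda>x. f x *\<^sub>R b) = (\<integral>x. f x * g x \<partial>M))" by (rule ballI)
  from bchoice[OF this] obtain G where G': "\<forall>b\<in>Basis. G b \<in> borel_measurable M \<and> (AE x in M. \<bar>G b x\<bar> \<le> B) \<and>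
      (\<forall>f. integrable M f \<longrightarrow> \<phi> (\<lambda>x. f x *\<^sub>R b) = (\<integral>x. f x * G b x \<partial>M))" ..
  have G: "b \<in> Basis \<Longrightarrow> G b \<in> borel_measurable M"
    "b \<in> Basis \<Longrightarrow> AE x in M. \<bar>G b x\<bar> \<le> B"
    "b \<in> Basis \<Longrightarrow> integrable M f \<Longrightarrow> \<phi> (\<lambda>x. f x *\<^sub>R b) = (\<integral>x. f x * G b x \<partial>M)" for b f
    using G' by simp_all
  define g where "g x = (\<Sum>b\<in>Basis. G b x *\<^sub>R b)" for x
  have g: "g \<in> borel_measurable M"
    unfolding g_def[abs_def] using G(1) by (intro borel_measurable_sum borel_measurable_scaleR) auto
  have gb: "g x \<bullet> b = G b x" if "b \<in> Basis" for x b
    using that by (simp add: g_def inner_sum_left_Basis)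
  have AEall: "AE x in M. \<forall>b\<in>Basis. \<bar>G b x\<bar> \<le> B" using G(2) by (simp add: AE_finite_all)
  then have "AE x in M. norm (g x) \<le> real DIM('b) * B"
  proof eventually_elim
    case (elim x)
    have "norm (g x) \<le> (\<Sum>b\<in>Basis. \<bar>g x \<bullet> b\<bar>)" by (rule norm_le_l1)
    also have "\<dots> \<le> (\<Sum>b\<in>(Basis::'b set). B)" using elim gb by (intro sum_mono) auto
    finally show ?case by simp
  qed
  note AEg = this
  have main: "integrable M (\<lambda>x. f x \<bullet> g x) \<and> \<phi> f = (\<integral>x. f x \<bullet> g x \<partial>M)" if f: "integrable M f" for f
  proof -
    have fb: "integrable M (\<lambda>x. f x \<bullet> b)" for b using f by simp
    have intb: "integrable M (\<lambda>x. (f x \<bullet> b) * G b x)" if b: "b \<in> Basis" for b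
    proof (rule Bochner_Integration.integrable_bound[of M "\<lambda>x. B * (f x \<bullet> b)"])
      show "AE x in M. norm ((f x \<bullet> b) * G b x) \<le> norm (B * (f x \<bullet> b))"
        using G(2)[OF b]
      proof eventually_elim
        case (elim x)
        from mult_right_mono[OF elim, of "\<bar>f x \<bullet> b\<bar>"] show ?case using B by (simp add: abs_mult mult.commute)
      qed
    qed (use fb G(1)[OF b] in auto)
    have "\<phi> (\<lambda>x. \<Sum>b\<in>A. (f x \<bullet> b) *\<^sub>R b) = (\<Sum>b\<in>A. \<phi> (\<lambda>x. (f x \<bullet> b) *\<^sub>R b))"
      if "finite A" for A
      using that
    proof (induction A rule: finite_induct)
      case empty
      then show ?case using scale[of "\<lambda>x. 0" 0] by simp
    next
      case (insert a A)
      then show ?case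
        using add[of "\<lambda>x. (f x \<bullet> a) *\<^sub>R a" "\<lambda>x. \<Sum>b\<in>A. (f x \<bullet> b) *\<^sub>R b"] fb by simp
    qed
    from this[OF finite_Basis] have "\<phi> f = (\<Sum>b\<in>Basis. \<integral>x. (f x \<bullet> b) * G b x \<partial>M)"
      using G(3) fb by (simp add: euclidean_representation)
    also have "\<dots> = (\<integral>x. (\<Sum>b\<in>Basis. (f x \<bullet> b) * G b x) \<partial>M)"
      using intb by simp
    finally have "\<phi> f = (\<integral>x. f x \<bullet> g x \<partial>M)"
      using gb by (simp add: euclidean_inner[of "f _" "g _"])
    moreover have "integrable M (\<lambda>x. \<Sum>b\<in>Basis. (f x \<bullet> b) * G b x)" using intb by simp
    then have "integrable M (\<lambda>x. f x \<bullet> g x)" using gb by (simp add: euclidean_inner[of "f _" "g _"])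
    ultimately show ?thesis by simp
  qed
  show ?thesis
  proof (rule bexI[OF _ g], rule conjI, rule exI, rule AEg, intro allI impI)
    fix f :: "'a \<Rightarrow> 'b" assume "integrable M f"
    then show "integrable M (\<lambda>x. f x \<bullet> g x) \<and> \<phi> f = (\<integral>x. f x \<bullet> g x \<partial>M)" by (rule main)
  qed
qed

section \<open>Norms on symmetric matrices and their duals\<close>

definition symmetric_part :: "real^3^3 \<Rightarrow> real^3^3" where
  "symmetric_part A = (1/2) *\<^sub>R (A + transpose A)"

lemma linear_transpose: "linear (transpose :: real^'n^'m \<Rightarrow> real^'m^'n)"
  by (intro linearI) (auto simp: transpose_def vec_eq_iff)

lemma transpose_add: "transpose (A + B) = transpose A + transpose (B::real^'n^'m)"
  by (rule linear_add[OF linear_transpose])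

lemma transpose_scaleR: "transpose (c *\<^sub>R A) = c *\<^sub>R transpose (A::real^'n^'m)"
  by (rule linear_scale[OF linear_transpose])

lemma symmetric_part_in [simp]: "symmetric_part A \<in> sym_matrices"
  by (simp add: symmetric_part_def sym_matrices_def transpose_add transpose_scaleR transpose_transpose add.commute)

lemma symmetric_part_sym: "A \<in> sym_matrices \<Longrightarrow> symmetric_part A = A"
  by (simp add: symmetric_part_def sym_matrices_def scaleR_add_left[symmetric] flip: scaleR_2)

lemma linear_symmetric_part: "linear symmetric_part"
  by (intro linearI) (auto simp: symmetric_part_def transpose_add transpose_scaleR algebra_simps)

lemma subspace_sym_matrices: "subspace sym_matrices"
  by (auto simp: subspace_def sym_matrices_def transpose_add transpose_scaleR
      linear_0[OF linear_transpose])

lemma closed_sym_matrices: "closed sym_matrices"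
  using closed_subspace[OF subspace_sym_matrices] .

lemma inner_transpose: "transpose A \<bullet> transpose B = A \<bullet> (B::real^'n^'m)"
proof -
  have "transpose A \<bullet> transpose B = (\<Sum>i\<in>UNIV. \<Sum>j\<in>UNIV. A $ j $ i * B $ j $ i)"
    by (simp add: inner_vec_def transpose_def)
  also have "\<dots> = (\<Sum>j\<in>UNIV. \<Sum>i\<in>UNIV. A $ j $ i * B $ j $ i)" by (rule sum.swap)
  finally show ?thesis by (simp add: inner_vec_def)
qed

lemma inner_symmetric_part:
  assumes "S \<in> sym_matrices"
  shows "S \<bullet> symmetric_part E = S \<bullet> E"
proof -
  have "S \<bullet> transpose E = S \<bullet> E"
    using inner_transpose[of S E] assms by (simp add: sym_matrices_def)
  then show ?thesis by (simp add: symmetric_part_def inner_add_right)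
qed

locale sym_norm =
  fixes N :: "real^3^3 \<Rightarrow> real"
  assumes norm_on_sym: "norm_on_sym N"
begin

lemma N_nonneg: "A \<in> sym_matrices \<Longrightarrow> 0 \<le> N A"
  and N_eq_0: "A \<in> sym_matrices \<Longrightarrow> N A = 0 \<longleftrightarrow> A = 0"
  and N_scale: "A \<in> sym_matrices \<Longrightarrow> N (c *\<^sub>R A) = \<bar>c\<bar> * N A"
  and N_triangle: "A \<in> sym_matrices \<Longrightarrow> B \<in> sym_matrices \<Longrightarrow> N (A + B) \<le> N A + N B"
  using norm_on_sym by (auto simp: norm_on_sym_def)

lemmas sym_closed = subspace_0[OF subspace_sym_matrices] subspace_add[OF subspace_sym_matrices]
  subspace_scale[OF subspace_sym_matrices] subspace_diff[OF subspace_sym_matrices]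
  subspace_neg[OF subspace_sym_matrices]

lemma N_0: "N 0 = 0" using N_eq_0 sym_closed by blast

lemma N_minus: "A \<in> sym_matrices \<Longrightarrow> N (- A) = N A"
  using N_scale[of A "-1"] by simp

lemma N_upper: "\<exists>M>0. \<forall>A\<in>sym_matrices. N A \<le> M * norm A"
proof -
  define M where "M = 1 + (\<Sum>b\<in>Basis. N (symmetric_part b))"
  have "M > 0" unfolding M_def by (intro add_pos_nonneg sum_nonneg) (auto simp: N_nonneg)
  moreover have "N A \<le> M * norm A" if A: "A \<in> sym_matrices" for A
  proof -
    have fin: "N (\<Sum>b\<in>B. (A \<bullet> b) *\<^sub>R symmetric_part b) \<le> (\<Sum>b\<in>B. \<bar>A \<bullet> b\<bar> * N (symmetric_part b))"
      if "finite B" for B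
      using that
    proof (induction B rule: finite_induct)
      case empty
      then show ?case by (simp add: N_0)
    next
      case (insert a B)
      have "(\<Sum>b\<in>B. (A \<bullet> b) *\<^sub>R symmetric_part b) \<in> sym_matrices"
        by (intro subspace_sum[OF subspace_sym_matrices] sym_closed) simp
      then have "N ((A \<bullet> a) *\<^sub>R symmetric_part a + (\<Sum>b\<in>B. (A \<bullet> b) *\<^sub>R symmetric_part b))
        \<le> \<bar>A \<bullet> a\<bar> * N (symmetric_part a) + N (\<Sum>b\<in>B. (A \<bullet> b) *\<^sub>R symmetric_part b)"
        using N_triangle[OF sym_closed(3)[OF symmetric_part_in]] by (simp add: N_scale)
      then show ?case using insert by simp
    qed
    have "(\<Sum>b\<in>Basis. (A \<bullet> b) *\<^sub>R symmetric_part b) = symmetric_part (\<Sum>b\<in>Basis. (A \<bullet> b) *\<^sub>R b)"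
      by (simp add: linear_sum[OF linear_symmetric_part] linear_scale[OF linear_symmetric_part])
    then have rep: "(\<Sum>b\<in>Basis. (A \<bullet> b) *\<^sub>R symmetric_part b) = A"
      using A by (simp add: euclidean_representation symmetric_part_sym)
    have "N A \<le> (\<Sum>b\<in>Basis. \<bar>A \<bullet> b\<bar> * N (symmetric_part b))"
      using fin[OF finite_Basis] unfolding rep .
    also have "\<dots> \<le> (\<Sum>b\<in>Basis. norm A * N (symmetric_part b))"
      by (intro sum_mono mult_right_mono) (auto simp: Basis_le_norm N_nonneg)
    also have "\<dots> \<le> M * norm A" by (simp add: M_def algebra_simps sum_distrib_left)
    finally show ?thesis .
  qed
  ultimately show ?thesis by blast
qed

lemma continuous_on_N: "continuous_on sym_matrices N"
proof -
  obtain M where M: "M > 0" "\<And>A. A \<in> sym_matrices \<Longrightarrow> N A \<le> M * norm A" using N_upper by blast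
  have le: "N A - N B \<le> M * norm (A - B)" if "A \<in> sym_matrices" "B \<in> sym_matrices" for A B
    using N_triangle[OF sym_closed(4)[OF that] that(2)] M(2)[OF sym_closed(4)[OF that]] by simp
  have "M-lipschitz_on sym_matrices N"
  proof (rule lipschitz_onI)
    fix A B assume AB: "A \<in> sym_matrices" "B \<in> sym_matrices"
    show "dist (N A) (N B) \<le> M * dist A B"
      using le[OF AB] le[OF AB(2,1)] unfolding norm_minus_commute[of B A] by (simp add: dist_norm abs_le_iff)
  qed (use M in simp)
  then show ?thesis by (rule lipschitz_on_continuous_on)
qed

lemma continuous_on_N_symmetric_part: "continuous_on UNIV (\<lambda>A. N (symmetric_part A))"
proof (rule continuous_on_compose2[OF continuous_on_N])
  show "continuous_on UNIV symmetric_part"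
    by (rule linear_continuous_on, rule linear_conv_bounded_linear[THEN iffD1, OF linear_symmetric_part])
  show "symmetric_part ` UNIV \<subseteq> sym_matrices" by (rule image_subsetI) simp
qed

text \<open>
  \<open>N\<close> is continuous, so it attains a positive minimum on the compact unit sphere of the symmetric matrices.
\<close>

lemma N_lower: "\<exists>c>0. \<forall>A\<in>sym_matrices. c * norm A \<le> N A"
proof -
  let ?K = "sphere 0 1 \<inter> sym_matrices :: (real^3^3) set"
  have mat1: "mat 1 \<in> (sym_matrices :: (real^3^3) set)" by (simp add: sym_matrices_def transpose_mat)
  have mat_1_entry: "(mat 1 :: real^3^3) $ 1 $ 1 = 1" by (simp add: mat_def)
  then have "(mat 1 :: real^3^3) \<noteq> 0" by (auto dest: arg_cong[where f="\<lambda>A. A $ 1 $ 1"])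
  then have "(1 / norm (mat 1 :: real^3^3)) *\<^sub>R mat 1 \<in> ?K"
    using sym_closed(3)[OF mat1] by auto
  then have ne: "?K \<noteq> {}" by blast
  have "compact ?K" by (intro compact_Int_closed closed_sym_matrices) auto
  moreover have "continuous_on ?K N" by (rule continuous_on_subset[OF continuous_on_N]) simp
  ultimately have "\<exists>A0\<in>?K. \<forall>A\<in>?K. N A0 \<le> N A" using continuous_attains_inf[OF _ ne] by blast
  then obtain A0 where A0: "A0 \<in> ?K" "\<And>A. A \<in> ?K \<Longrightarrow> N A0 \<le> N A" by blast
  show ?thesis
  proof (intro exI[of _ "N A0"] conjI ballI)
    show "N A0 > 0" using A0 N_nonneg[of A0] N_eq_0[of A0] by (auto simp: less_le)
    fix A :: "real^3^3" assume A: "A \<in> sym_matrices"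
    show "N A0 * norm A \<le> N A"
    proof (cases "A = 0")
      case False
      have "N A0 \<le> N ((1 / norm A) *\<^sub>R A)"
        using False A sym_closed by (intro A0) auto
      also have "\<dots> = N A / norm A" using A by (simp add: N_scale)
      finally show ?thesis using False by (simp add: field_simps)
    qed (simp add: N_0)
  qed
qed

abbreviation "D \<equiv> dual_norm_sym N"

lemma inner_unit_ball_le: "\<exists>K>0. \<forall>S\<in>sym_matrices. N S \<le> 1 \<longrightarrow> (\<forall>E. S \<bullet> E \<le> K * norm E)"
proof -
  obtain c where c: "c > 0" "\<And>A. A \<in> sym_matrices \<Longrightarrow> c * norm A \<le> N A" using N_lower by blast
  have "S \<bullet> E \<le> (1 / c) * norm E" if "S \<in> sym_matrices" "N S \<le> 1" for S E
  proof -
    have "norm S \<le> 1 / c" using c(2)[OF that(1)] that(2) c(1) by (simp add: field_simps)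
    then show ?thesis using norm_cauchy_schwarz[of S E] mult_right_mono[of "norm S" "1/c" "norm E"] by simp
  qed
  with c(1) show ?thesis by (intro exI[of _ "1/c"]) auto
qed

lemma inner_bdd: "bdd_above ((\<lambda>S. S \<bullet> E) ` {S \<in> sym_matrices. N S \<le> 1})"
  using inner_unit_ball_le unfolding bdd_above_def by blast

lemma dual_ge: "S \<in> sym_matrices \<Longrightarrow> N S \<le> 1 \<Longrightarrow> S \<bullet> E \<le> D E"
  unfolding dual_norm_sym_def by (rule cSUP_upper[OF _ inner_bdd]) auto

lemma dual_le: "(\<And>S. S \<in> sym_matrices \<Longrightarrow> N S \<le> 1 \<Longrightarrow> S \<bullet> E \<le> z) \<Longrightarrow> D E \<le> z"
  unfolding dual_norm_sym_def using sym_closed(1) N_0 by (intro cSUP_least) auto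

lemma dual_nonneg: "0 \<le> D E" using dual_ge[of 0 E] sym_closed(1) N_0 by simp

lemma dual_0: "D 0 = 0" by (intro antisym dual_nonneg dual_le) simp

lemma dual_triangle: "D (E + F) \<le> D E + D F"
  by (rule dual_le) (auto simp: inner_add_right intro!: add_mono dual_ge)

lemma dual_scale:
  assumes "c \<ge> 0" shows "D (c *\<^sub>R E) = c * D E"
proof (cases "c = 0")
  case False
  have le: "D (c *\<^sub>R E) \<le> c * D E" if "c > 0" for c E
    using that by (intro dual_le) (auto intro!: mult_left_mono dual_ge)
  from le[of "1/c" "c *\<^sub>R E"] le[of c E] False assms show ?thesis by (simp add: field_simps)
qed (simp add: dual_0)

lemma dual_upper: "\<exists>K>0. \<forall>E. D E \<le> K * norm E"
proof -
  obtain K where "K > 0" "\<forall>S\<in>sym_matrices. N S \<le> 1 \<longrightarrow> (\<forall>E. S \<bullet> E \<le> K * norm E)"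
    using inner_unit_ball_le by blast
  then show ?thesis by (intro exI[of _ K] conjI allI dual_le) auto
qed

text \<open>
  Test the supremum that defines the dual norm with a multiple of \<open>E\<close> itself.
\<close>

lemma dual_lower: "\<exists>K>0. \<forall>E\<in>sym_matrices. norm E \<le> K * D E"
proof -
  obtain M where M: "M > 0" "\<And>A. A \<in> sym_matrices \<Longrightarrow> N A \<le> M * norm A" using N_upper by blast
  have "norm E \<le> M * D E" if E: "E \<in> sym_matrices" for E
  proof (cases "E = 0")
    case False
    have "((1 / (M * norm E)) *\<^sub>R E) \<bullet> E \<le> D E"
    proof (rule dual_ge)
      show "N ((1 / (M * norm E)) *\<^sub>R E) \<le> 1"
        using M(2)[OF E] M(1) False E by (simp add: N_scale field_simps)
    qed (use E sym_closed in auto)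
    then have "norm E / M \<le> D E"
      using False by (simp add: dot_square_norm power2_eq_square)
    then show ?thesis using M by (simp add: field_simps)
  qed (simp add: dual_0)
  with M(1) show ?thesis by blast
qed

lemma continuous_on_dual: "continuous_on UNIV D"
proof -
  obtain K where K: "K > 0" "\<And>E. D E \<le> K * norm E" using dual_upper by blast
  have le: "D E - D F \<le> K * norm (E - F)" for E F
    using dual_triangle[of "E - F" F] K(2)[of "E - F"] by simp
  have "K-lipschitz_on UNIV D"
  proof (rule lipschitz_onI)
    fix E F show "dist (D E) (D F) \<le> K * dist E F"
      using le[of E F] le[of F E] unfolding norm_minus_commute[of F E] by (simp add: dist_norm abs_le_iff)
  qed (use K in simp)
  then show ?thesis by (rule lipschitz_on_continuous_on)
qed

lemma borel_measurable_dual [measurable]: "D \<in> borel_measurable borel"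
  by (rule borel_measurable_continuous_onI[OF continuous_on_dual])

lemma pairing_le:
  assumes S: "S \<in> sym_matrices" shows "\<bar>S \<bullet> E\<bar> \<le> N S * D E"
proof -
  have le: "S \<bullet> E \<le> N S * D E" if S: "S \<in> sym_matrices" for S
  proof (cases "S = 0")
    case False
    then have pos: "N S > 0" using N_nonneg[OF S] N_eq_0[OF S] by (simp add: less_le)
    have "((1 / N S) *\<^sub>R S) \<bullet> E \<le> D E"
      using S pos sym_closed by (intro dual_ge) (auto simp: N_scale)
    then show ?thesis using pos by (simp add: field_simps)
  qed (simp add: N_0)
  from le[OF S] le[OF sym_closed(5)[OF S]] show ?thesis by (simp add: N_minus[OF S] abs_le_iff)
qed

text \<open>
  If \<open>N A > C\<close>, then a suitable multiple of \<open>A\<close> lies outside the closed unit ball of \<open>N\<close>, and a hyperplane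
  separating the two provides an \<open>E\<close> that violates the assumed inequality.
\<close>

lemma bidual_le:
  assumes A: "A \<in> sym_matrices" and C: "0 \<le> C" and le: "\<And>E. A \<bullet> E \<le> C * D E"
  shows "N A \<le> C"
proof (rule ccontr)
  assume "\<not> N A \<le> C"
  \<comment> \<open>A number strictly between \<open>C\<close> and \<open>N A\<close>, so that \<open>A / c\<close> is outside the unit ball.\<close>
  define c where "c = (C + N A) / 2"
  have c: "C < c" "c < N A" "0 < c" using \<open>\<not> N A \<le> C\<close> C by (auto simp: c_def)
  let ?K = "{S \<in> sym_matrices. N S \<le> 1}"
  have conv: "convex ?K"
  proof (rule convexI)
    fix x y and u v :: real assume xy: "x \<in> ?K" "y \<in> ?K" and uv: "0 \<le> u" "0 \<le> v" "u + v = 1"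
    have "N (u *\<^sub>R x + v *\<^sub>R y) \<le> u * N x + v * N y"
      using N_triangle[of "u *\<^sub>R x" "v *\<^sub>R y"] xy uv sym_closed by (auto simp: N_scale)
    also have "\<dots> \<le> u * 1 + v * 1" using xy uv by (intro add_mono mult_left_mono) auto
    finally show "u *\<^sub>R x + v *\<^sub>R y \<in> ?K" using xy uv sym_closed by auto
  qed
  have clos: "closed ?K"
    using continuous_closed_preimage[OF continuous_on_N closed_sym_matrices, of "{..1}"]
    by (auto simp: vimage_def Int_def)
  have notin: "(1 / c) *\<^sub>R A \<notin> ?K"
    using c A by (auto simp: N_scale field_simps)
  obtain a b where ab: "a \<bullet> ((1 / c) *\<^sub>R A) < b" "\<And>x. x \<in> ?K \<Longrightarrow> b < a \<bullet> x"
    using separating_hyperplane_closed_point[OF conv clos notin] by blast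
  have "D (- a) \<le> - b"
    using ab(2) by (intro dual_le) (auto simp: inner_commute intro: less_imp_le)
  moreover have "- b < ((1 / c) *\<^sub>R A) \<bullet> (- a)" using ab(1) by (simp add: inner_commute)
  ultimately have "D (- a) < (1 / c) * (A \<bullet> (- a))" by simp
  then have "c * D (- a) < A \<bullet> (- a)" using c by (simp add: field_simps)
  moreover have "C * D (- a) \<le> c * D (- a)" using c dual_nonneg by (intro mult_right_mono) auto
  ultimately show False using le[of "- a"] by simp
qed

lemma dual_symmetric_part: "D (symmetric_part E) = D E"
  unfolding dual_norm_sym_def by (intro SUP_cong refl) (auto simp: inner_symmetric_part)

end

section \<open>Two-dimensional Hausdorff measure of a Lipschitz graph\<close>

definition separated :: "real \<Rightarrow> 'a::metric_space set \<Rightarrow> bool" where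
  "separated \<eta> X \<longleftrightarrow> (\<forall>x\<in>X. \<forall>y\<in>X. x \<noteq> y \<longrightarrow> \<eta> \<le> dist x y)"

text \<open>
  A separated set of maximal cardinality is a net: a point far from all its members could be added.
\<close>

lemma maximal_separated_net:
  assumes bound: "\<And>X. finite X \<Longrightarrow> X \<subseteq> A \<Longrightarrow> separated \<eta> X \<Longrightarrow> card X \<le> B" and \<eta>: "0 < \<eta>"
  shows "\<exists>X. finite X \<and> X \<subseteq> A \<and> separated \<eta> X \<and> A \<subseteq> (\<Union>x\<in>X. ball x \<eta>)"
proof -
  let ?P = "\<lambda>X. finite X \<and> X \<subseteq> A \<and> separated \<eta> X"
  have "?P {}" by (simp add: separated_def)
  moreover have "\<forall>X. ?P X \<longrightarrow> card X < Suc B" using bound by (simp add: less_Suc_eq_le)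
  ultimately have "\<exists>X. ?P X \<and> (\<forall>Y. ?P Y \<longrightarrow> card Y \<le> card X)"
    by (rule ex_has_greatest_nat[of ?P "{}" card "Suc B"])
  then obtain X where Xmax: "?P X \<and> (\<forall>Y. ?P Y \<longrightarrow> card Y \<le> card X)" ..
  note X = conjunct1[OF Xmax] and max = conjunct2[OF Xmax]
  have "A \<subseteq> (\<Union>x\<in>X. ball x \<eta>)"
  proof (rule subsetI, rule ccontr)
    fix a assume a: "a \<in> A" "a \<notin> (\<Union>x\<in>X. ball x \<eta>)"
    then have far: "\<eta> \<le> dist x a" if "x \<in> X" for x using that by (auto simp: not_less)
    have "a \<notin> X" using \<eta> far[of a] by auto
    then have "card (insert a X) = Suc (card X)" using X by simp
    moreover have "?P (insert a X)" using X a(1) far by (auto simp: separated_def dist_commute)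
    then have "card (insert a X) \<le> card X" using max by blast
    ultimately show False by simp
  qed
  with X show ?thesis by blast
qed

lemma hausdorff2_premeasure_finite_cover:
  fixes C :: "'i \<Rightarrow> 'a::metric_space set"
  assumes I: "finite I" and C: "\<And>i. i \<in> I \<Longrightarrow> bounded (C i) \<and> diameter (C i) \<le> \<delta>" and \<delta>: "0 \<le> \<delta>"
    and A: "A \<subseteq> (\<Union>i\<in>I. C i)"
  shows "hausdorff2_premeasure \<delta> A \<le> (\<Sum>i\<in>I. ennreal (pi / 4 * (diameter (C i))\<^sup>2))"
proof -
  obtain g where g: "bij_betw g {..<card I} I"
    using ex_bij_betw_nat_finite[OF I] by (auto simp: atLeast0LessThan)
  define D where "D n = (if n < card I then C (g n) else {})" for n
  have gI: "g n \<in> I" if "n < card I" for n using g that by (auto simp: bij_betw_def)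
  have "hausdorff2_premeasure \<delta> A \<le> (\<Sum>n. ennreal (pi / 4 * (diameter (D n))\<^sup>2))"
  proof (rule hausdorff2_premeasure_le)
    show "A \<subseteq> (\<Union>n. D n)"
    proof
      fix x assume "x \<in> A"
      then obtain i where i: "i \<in> I" "x \<in> C i" using A by blast
      then have "i \<in> g ` {..<card I}" using bij_betw_imp_surj_on[OF g] by simp
      then obtain n where "n < card I" "g n = i" by blast
      then show "x \<in> (\<Union>n. D n)" using i by (auto simp: D_def intro!: exI[of _ n])
    qed
  qed (use C \<delta> gI in \<open>auto simp: D_def\<close>)
  also have "\<dots> = (\<Sum>n<card I. ennreal (pi / 4 * (diameter (D n))\<^sup>2))"
    by (rule suminf_finite) (auto simp: D_def)
  also have "\<dots> = (\<Sum>n<card I. ennreal (pi / 4 * (diameter (C (g n)))\<^sup>2))"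
    by (intro sum.cong) (auto simp: D_def)
  also have "\<dots> = (\<Sum>i\<in>I. ennreal (pi / 4 * (diameter (C i))\<^sup>2))"
    by (rule sum.reindex_bij_betw[OF g])
  finally show ?thesis .
qed

lemma emeasure_ball_3: "0 \<le> r \<Longrightarrow> emeasure lborel (ball (c::real^3) r) = ennreal (unit_ball_vol 3 * r ^ 3)"
  using emeasure_ball[of r c] by simp

text \<open>
  The level set \<open>{x. \<Phi> x = 0}\<close> is a Lipschitz graph over the plane orthogonal to \<open>e\<close>, and \<open>\<Phi> x\<close> is the height
  of \<open>x\<close> above it in the direction \<open>e\<close>. Working with \<open>\<Phi>\<close> keeps all estimates free of coordinates.
\<close>

locale graph_function =
  fixes e :: "real^3" and L :: real and \<Phi> :: "real^3 \<Rightarrow> real"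
  assumes L1: "1 \<le> L" and norm_e: "norm e = 1"
    and lip: "\<And>x y. \<bar>\<Phi> x - \<Phi> y\<bar> \<le> L * dist x y"
    and shift: "\<And>x s. \<Phi> (x + s *\<^sub>R e) = \<Phi> x + s"
begin

lemma continuous_\<Phi>: "continuous_on UNIV \<Phi>"
proof -
  have "L-lipschitz_on UNIV \<Phi>"
    by (rule lipschitz_onI) (use lip L1 in \<open>auto simp: dist_real_def\<close>)
  then show ?thesis by (rule lipschitz_on_continuous_on)
qed

lemma closed_level: "closed {x. \<Phi> x = 0}"
  using continuous_\<Phi> by (intro closed_Collect_eq) auto

lemma open_layer: "open {x. 0 < \<Phi> x \<and> \<Phi> x < h}"
  using continuous_\<Phi> by (intro open_Collect_conj open_Collect_less) auto

text \<open>
  Around each point of \<open>X\<close>, stack balls of radius \<open>\<eta> / (2 * L)\<close> with centres at the heights \<open>0, \<eta>, 2 * \<eta>, \<dots>\<close>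
  up to \<open>h\<close>. Centres at different heights are \<open>\<eta> / L\<close> apart because \<open>\<Phi>\<close> is Lipschitz, centres at the same
  height because \<open>X\<close> is separated. So the balls are disjoint, they all lie in \<open>ball x0 (3 * h)\<close>, and their
  number is about \<open>h / \<eta>\<close> times the cardinality of \<open>X\<close>.
\<close>

lemma card_separated_level:
  fixes \<eta> h :: real
  assumes X: "finite X" "X \<subseteq> {x. \<Phi> x = 0} \<inter> ball x0 h" "separated \<eta> X" and \<eta>: "0 < \<eta>" "\<eta> \<le> h"
  shows "real (card X) * \<eta>\<^sup>2 \<le> 432 * L ^ 3 * h\<^sup>2"
proof -
  define m where "m = nat \<lfloor>h / \<eta>\<rfloor>"
  have q: "1 \<le> h / \<eta>" using \<eta> by simp
  have fl: "1 \<le> \<lfloor>h / \<eta>\<rfloor>" using q by simp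
  then have m_eq: "real m = of_int \<lfloor>h / \<eta>\<rfloor>" by (simp add: m_def)
  have m1: "real m \<le> h / \<eta>" "h / \<eta> < real m + 1" unfolding m_eq by linarith+
  have m2: "1 \<le> real m" unfolding m_eq using fl by simp
  define \<rho> where "\<rho> = \<eta> / (2 * L)"
  have "\<rho> \<le> \<eta> / 2" unfolding \<rho>_def using \<eta> L1 by (intro divide_left_mono) auto
  then have \<rho>: "0 < \<rho>" "\<rho> \<le> h / 2" using \<eta> L1 by (auto simp: \<rho>_def)
  define c where "c k = fst k + (real (snd k) * \<eta>) *\<^sub>R e" for k :: "(real^3) \<times> nat"
  let ?I = "X \<times> {..<m}"
  have far: "\<eta> / L \<le> dist (c k) (c l)" if "k \<in> ?I" "l \<in> ?I" "k \<noteq> l" for k l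
  proof (cases "snd k = snd l")
    case True
    then have "dist (c k) (c l) = dist (fst k) (fst l)" by (simp add: c_def)
    moreover have "\<eta> \<le> dist (fst k) (fst l)"
      using X(3) that True by (auto simp: separated_def prod_eq_iff)
    moreover have "\<eta> / L \<le> \<eta>" using L1 \<eta> by (simp add: field_simps)
    ultimately show ?thesis by simp
  next
    case False
    have "\<Phi> (c k) = snd k * \<eta>" "\<Phi> (c l) = snd l * \<eta>" using that X(2) by (auto simp: c_def shift)
    then have "\<bar>\<Phi> (c k) - \<Phi> (c l)\<bar> = \<bar>real (snd k) - real (snd l)\<bar> * \<eta>"
      using \<eta> by (simp add: left_diff_distrib[symmetric] abs_mult)
    moreover have "1 \<le> \<bar>real (snd k) - real (snd l)\<bar>" using False by linarith
    then have "1 * \<eta> \<le> \<bar>real (snd k) - real (snd l)\<bar> * \<eta>" using \<eta> by (intro mult_right_mono) auto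
    ultimately have "\<eta> \<le> L * dist (c k) (c l)" using lip[of "c k" "c l"] by simp
    then show ?thesis using L1 by (simp add: field_simps)
  qed
  have disj: "disjoint_family_on (\<lambda>k. ball (c k) \<rho>) ?I"
    unfolding disjoint_family_on_def
  proof (intro ballI impI)
    fix k l assume kl: "k \<in> ?I" "l \<in> ?I" "k \<noteq> l"
    have "\<rho> + \<rho> \<le> dist (c k) (c l)" using far[OF kl] by (simp add: \<rho>_def)
    then show "ball (c k) \<rho> \<inter> ball (c l) \<rho> = {}" by (rule disjoint_ballI)
  qed
  have sub: "(\<Union>k\<in>?I. ball (c k) \<rho>) \<subseteq> ball x0 (3 * h)"
  proof
    fix y assume "y \<in> (\<Union>k\<in>?I. ball (c k) \<rho>)"
    then obtain x j where xj: "x \<in> X" "j < m" "dist (c (x, j)) y < \<rho>" by auto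
    have "dist x (c (x, j)) = real j * \<eta>" using \<eta> norm_e by (simp add: c_def dist_norm)
    also have "\<dots> \<le> real m * \<eta>" using xj \<eta> by (intro mult_right_mono) auto
    also have "\<dots> \<le> h" using m1(1) \<eta> by (simp add: field_simps)
    finally have "dist x (c (x, j)) \<le> h" .
    moreover have "dist x0 x < h" using X(2) xj(1) by auto
    ultimately have "dist x0 y < 3 * h"
      using dist_triangle[of x0 y x] dist_triangle[of x y "c (x, j)"] xj(3) \<rho> by linarith
    then show "y \<in> ball x0 (3 * h)" by simp
  qed
  have "(\<Sum>k\<in>?I. emeasure lborel (ball (c k) \<rho>)) = emeasure lborel (\<Union>k\<in>?I. ball (c k) \<rho>)"
    by (rule sum_emeasure) (use disj X in auto)
  also have "\<dots> \<le> emeasure lborel (ball x0 (3 * h))" by (rule emeasure_mono[OF sub]) simp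
  finally have "ennreal (real (card ?I) * (unit_ball_vol 3 * \<rho> ^ 3)) \<le> ennreal (unit_ball_vol 3 * (3 * h) ^ 3)"
    using \<rho> \<eta> by (simp add: emeasure_ball_3 ennreal_mult ennreal_of_nat_eq_real_of_nat)
  then have "real (card ?I) * (unit_ball_vol 3 * \<rho> ^ 3) \<le> unit_ball_vol 3 * (3 * h) ^ 3"
    using \<eta> by (subst (asm) ennreal_le_iff) auto
  then have "unit_ball_vol 3 * (real (card ?I) * \<rho> ^ 3) \<le> unit_ball_vol 3 * (3 * h) ^ 3"
    by (simp add: mult_ac)
  then have "real (card ?I) * \<rho> ^ 3 \<le> (3 * h) ^ 3" by (subst (asm) mult_le_cancel_left_pos) auto
  then have main: "card X * real m * \<eta> ^ 3 \<le> 216 * L ^ 3 * h ^ 3"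
    using L1 by (simp add: card_cartesian_product \<rho>_def power_divide power_mult_distrib field_simps)
  have "\<eta> * 1 \<le> \<eta> * real m" using m2 \<eta> by (intro mult_left_mono) auto
  moreover have "h < \<eta> * real m + \<eta>" using m1(2) \<eta> by (simp add: field_simps)
  ultimately have "h \<le> 2 * real m * \<eta>" by (simp add: mult_ac)
  then have "(card X * \<eta>\<^sup>2) * h \<le> (card X * \<eta>\<^sup>2) * (2 * real m * \<eta>)" by (intro mult_left_mono) auto
  also have "\<dots> = 2 * (card X * real m * \<eta> ^ 3)" by (simp add: power2_eq_square power3_eq_cube)
  also have "\<dots> \<le> (432 * L ^ 3 * h\<^sup>2) * h" using main by (simp add: power2_eq_square power3_eq_cube mult_ac)
  finally show ?thesis by (rule mult_right_le_imp_le) (use \<eta> in auto)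
qed

lemma net_of_level:
  fixes \<eta> h :: real
  assumes \<eta>: "0 < \<eta>" "\<eta> \<le> h"
  obtains X where "finite X" "X \<subseteq> {x. \<Phi> x = 0} \<inter> ball x0 h" "separated \<eta> X"
    "{x. \<Phi> x = 0} \<inter> ball x0 h \<subseteq> (\<Union>x\<in>X. ball x \<eta>)" "real (card X) * \<eta>\<^sup>2 \<le> 432 * L ^ 3 * h\<^sup>2"
proof -
  let ?A = "{x. \<Phi> x = 0} \<inter> ball x0 h"
  have "\<exists>X. finite X \<and> X \<subseteq> ?A \<and> separated \<eta> X \<and> ?A \<subseteq> (\<Union>x\<in>X. ball x \<eta>)"
  proof (rule maximal_separated_net[OF _ \<eta>(1)])
    fix X assume X: "finite X" "X \<subseteq> ?A" "separated \<eta> X"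
    have "real (card X) \<le> 432 * L ^ 3 * h\<^sup>2 / \<eta>\<^sup>2"
      using card_separated_level[OF X \<eta>] \<eta> by (simp add: field_simps)
    then show "card X \<le> nat \<lfloor>432 * L ^ 3 * h\<^sup>2 / \<eta>\<^sup>2\<rfloor>" by (simp add: le_nat_floor)
  qed
  then obtain X where X: "finite X" "X \<subseteq> ?A" "separated \<eta> X" "?A \<subseteq> (\<Union>x\<in>X. ball x \<eta>)" by blast
  show thesis by (rule that[OF X card_separated_level[OF X(1-3) \<eta>]])
qed

text \<open>
  Cover the surface by balls of radius \<open>\<eta>\<close> around a maximal separated net: there are of order \<open>(h / \<eta>)\<^sup>2\<close> of
  them, and each contributes \<open>pi * \<eta>\<^sup>2\<close>.
\<close>

lemma hausdorff2_level_le: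
  assumes h: "0 < h"
  shows "emeasure hausdorff2 ({x. \<Phi> x = 0} \<inter> ball x0 h) \<le> ennreal (432 * pi * L ^ 3 * h\<^sup>2)"
proof -
  let ?A = "{x. \<Phi> x = 0} \<inter> ball x0 h"
  have "?A \<in> sets borel" using closed_level by auto
  then have "emeasure hausdorff2 ?A = hausdorff2_outer ?A" by (rule emeasure_hausdorff2)
  also have "\<dots> \<le> ennreal (432 * pi * L ^ 3 * h\<^sup>2)"
    unfolding hausdorff2_outer_def
  proof (rule SUP_least)
    fix \<delta> :: real assume "\<delta> \<in> {0<..}"
    define \<eta> where "\<eta> = min h (\<delta> / 2)"
    have \<eta>: "0 < \<eta>" "\<eta> \<le> h" "2 * \<eta> \<le> \<delta>" using \<open>\<delta> \<in> _\<close> h by (auto simp: \<eta>_def)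
    obtain X where "finite X" "X \<subseteq> ?A" "separated \<eta> X" "?A \<subseteq> (\<Union>x\<in>X. ball x \<eta>)"
        "real (card X) * \<eta>\<^sup>2 \<le> 432 * L ^ 3 * h\<^sup>2"
      by (rule net_of_level[OF \<eta>(1,2), of x0])
    note X = this(1,4,5)
    have "hausdorff2_premeasure \<delta> ?A \<le> (\<Sum>x\<in>X. ennreal (pi / 4 * (diameter (ball x \<eta>))\<^sup>2))"
      using \<eta> X by (intro hausdorff2_premeasure_finite_cover) (auto simp: diameter_ball)
    also have "\<dots> = (\<Sum>x\<in>X. ennreal (pi * \<eta>\<^sup>2))"
      using \<eta> by (intro sum.cong) (auto simp: diameter_ball power2_eq_square)
    also have "\<dots> = ennreal (pi * (card X * \<eta>\<^sup>2))"
      by (simp add: ennreal_of_nat_eq_real_of_nat ennreal_mult[symmetric] mult_ac)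
    also have "\<dots> \<le> ennreal (432 * pi * L ^ 3 * h\<^sup>2)"
      using mult_left_mono[OF X(3), of pi] by (intro ennreal_leI) (simp add: mult_ac)
    finally show "hausdorff2_premeasure \<delta> ?A \<le> ennreal (432 * pi * L ^ 3 * h\<^sup>2)" .
  qed
  finally show ?thesis .
qed

text \<open>
  Up to a factor \<open>h\<close>, the bound \<open>432 * pi * L ^ 3 * h\<^sup>2\<close> for the Hausdorff measure of a patch of radius \<open>h\<close>
  divided by the volume of a ball of radius \<open>h / (4 * L)\<close>.
\<close>

definition layer_const :: real where
  "layer_const = (432 * pi * L ^ 3) * (64 * L ^ 3 / unit_ball_vol 3)"

text \<open>
  For small \<open>h\<close>, the function \<open>f\<close> varies by less than \<open>\<epsilon>\<close> over distances up to \<open>h\<close>. Choose a maximal \<open>h\<close>-separated net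
  of the surface. The surface integral is at most the sum over the net of \<open>f x + \<epsilon>\<close> times the measure of the
  surface in \<open>ball x h\<close>, which is of order \<open>h\<^sup>2\<close>. Each net point also owns a ball of radius \<open>h / (4 * L)\<close> in
  the layer of thickness \<open>h\<close>; these are disjoint and have volume of order \<open>h\<^sup>3\<close>, so that the layer integral is
  at least of order \<open>h\<^sup>3\<close> times the sum of \<open>f x - \<epsilon>\<close>.
\<close>

lemma surface_integral_le_layer:
  fixes f :: "real^3 \<Rightarrow> real"
  assumes f: "continuous_on UNIV f" "\<And>x. 0 \<le> f x" and \<rho>: "0 < \<rho>" and h0: "0 < h0" and B: "0 \<le> B"
    and layer: "\<And>h. 0 < h \<Longrightarrow> h < h0 \<Longrightarrow>
      (\<integral>\<^sup>+x \<in> {x. 0 < \<Phi> x \<and> \<Phi> x < h} \<inter> ball p (2 * \<rho>). ennreal (f x) \<partial>lborel) \<le> ennreal (h * B)"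
  shows "(\<integral>\<^sup>+x \<in> {x. \<Phi> x = 0} \<inter> ball p \<rho>. ennreal (f x) \<partial>hausdorff2) \<le> ennreal (layer_const * B)"
proof (rule ennreal_le_epsilon)
  fix e0 :: real assume e0: "0 < e0"
  let ?A = "{x. \<Phi> x = 0} \<inter> ball p \<rho>"
  define C1 where "C1 = 432 * pi * L ^ 3"
  define \<kappa> where "\<kappa> = unit_ball_vol 3 / (64 * L ^ 3)"
  have pos: "0 < C1" "0 < \<kappa>" using L1 by (auto simp: C1_def \<kappa>_def)
  have lc: "layer_const = C1 / \<kappa>" by (simp add: layer_const_def C1_def \<kappa>_def)
  define C2 where "C2 = 2 * C1 * (432 * L ^ 3 * \<rho>\<^sup>2)"
  have C2: "0 < C2" using pos L1 \<rho> by (auto simp: C2_def)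
  \<comment> \<open>\<open>\<epsilon> * C2\<close> is the total error caused by the oscillation of \<open>f\<close>.\<close>
  define \<epsilon> where "\<epsilon> = e0 / C2"
  have \<epsilon>: "0 < \<epsilon>" using e0 C2 by (simp add: \<epsilon>_def)
  have "uniformly_continuous_on (cball p (2 * \<rho>)) f"
    by (rule compact_uniformly_continuous) (auto intro: continuous_on_subset[OF f(1)])
  then obtain d where d: "0 < d" "\<And>x y. x \<in> cball p (2 * \<rho>) \<Longrightarrow> y \<in> cball p (2 * \<rho>) \<Longrightarrow> dist y x < d \<Longrightarrow> dist (f y) (f x) < \<epsilon>"
    unfolding uniformly_continuous_on_def using \<epsilon> by metis
  define h where "h = min (\<rho> / 2) (min (d / 2) (h0 / 2))"
  have h: "0 < h" "h \<le> \<rho> / 2" "h < d" "h < h0" using \<rho> d(1) h0 by (auto simp: h_def)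
  then have h\<rho>: "h \<le> \<rho>" using \<rho> by simp
  obtain X where X: "finite X" "X \<subseteq> ?A" "separated h X" "?A \<subseteq> (\<Union>x\<in>X. ball x h)"
      "real (card X) * h\<^sup>2 \<le> 432 * L ^ 3 * \<rho>\<^sup>2"
    by (rule net_of_level[OF h(1) h\<rho>, of p])
  define S where "S x = {x. \<Phi> x = 0} \<inter> ball x h" for x
  have S: "S x \<in> sets borel" "emeasure hausdorff2 (S x) \<le> ennreal (C1 * h\<^sup>2)" for x
    using closed_level hausdorff2_level_le[OF h(1), of x] by (auto simp: S_def C1_def)
  have "(\<integral>\<^sup>+x\<in>?A. ennreal (f x) \<partial>hausdorff2) \<le> (\<integral>\<^sup>+y. (\<Sum>x\<in>X. ennreal (f x + \<epsilon>) * indicator (S x) y) \<partial>hausdorff2)"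
  proof (rule nn_integral_mono)
    fix y :: "real^3"
    show "ennreal (f y) * indicator ?A y \<le> (\<Sum>x\<in>X. ennreal (f x + \<epsilon>) * indicator (S x) y)"
    proof (cases "y \<in> ?A")
      case True
      then obtain x where x: "x \<in> X" "y \<in> ball x h" using X(4) by blast
      have "x \<in> cball p (2 * \<rho>)" using X(2) x(1) \<rho> by auto
      moreover have "y \<in> cball p (2 * \<rho>)" using True \<rho> by auto
      moreover have "dist y x < d" using x(2) h(3) by (simp add: dist_commute)
      ultimately have "dist (f y) (f x) < \<epsilon>" by (rule d(2))
      then have "f y \<le> f x + \<epsilon>" by (simp add: dist_real_def)
      then have "ennreal (f y) * indicator ?A y \<le> ennreal (f x + \<epsilon>) * indicator (S x) y"
        using True x(2) by (auto simp: S_def intro: ennreal_leI)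
      also have "\<dots> \<le> (\<Sum>x\<in>X. ennreal (f x + \<epsilon>) * indicator (S x) y)"
        using x(1) X(1) by (intro member_le_sum) auto
      finally show ?thesis .
    qed simp
  qed
  also have "\<dots> = (\<Sum>x\<in>X. ennreal (f x + \<epsilon>) * emeasure hausdorff2 (S x))"
    using S(1) by (subst nn_integral_sum) (auto simp: nn_integral_cmult_indicator)
  also have "\<dots> \<le> (\<Sum>x\<in>X. ennreal (f x + \<epsilon>) * ennreal (C1 * h\<^sup>2))"
    using S(2) by (intro sum_mono mult_left_mono) auto
  also have "\<dots> = ennreal (\<Sum>x\<in>X. (f x + \<epsilon>) * (C1 * h\<^sup>2))"
  proof -
    have nn: "0 \<le> f x + \<epsilon>" for x using f(2)[of x] \<epsilon> by simp
    have "(\<Sum>x\<in>X. ennreal (f x + \<epsilon>) * ennreal (C1 * h\<^sup>2)) = (\<Sum>x\<in>X. ennreal ((f x + \<epsilon>) * (C1 * h\<^sup>2)))"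
      using nn pos by (intro sum.cong refl ennreal_mult[symmetric]) auto
    also have "\<dots> = ennreal (\<Sum>x\<in>X. (f x + \<epsilon>) * (C1 * h\<^sup>2))"
      using nn pos by (intro sum_ennreal mult_nonneg_nonneg) auto
    finally show ?thesis .
  qed
  finally have up: "(\<integral>\<^sup>+x\<in>?A. ennreal (f x) \<partial>hausdorff2) \<le> ennreal (\<Sum>x\<in>X. (f x + \<epsilon>) * (C1 * h\<^sup>2))" .
  define b where "b x = ball (x + (h / 2) *\<^sub>R e) (h / (4 * L))" for x
  have hL: "0 < h / (4 * L)" "h / (4 * L) \<le> h / 4" using h(1) L1 by (auto simp: field_simps)
  have b_em: "emeasure lborel (b x) = ennreal (\<kappa> * h ^ 3)" for x
    unfolding b_def using hL by (subst emeasure_ball_3) (auto simp: \<kappa>_def power_divide power_mult_distrib)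
  have b_near: "dist y x < 3 * h / 4" if "y \<in> b x" for x y
  proof -
    have "dist (x + (h / 2) *\<^sub>R e) x = h / 2" using norm_e h(1) by (simp add: dist_norm)
    then show ?thesis using that hL dist_triangle[of y x "x + (h / 2) *\<^sub>R e"] unfolding b_def
      by (simp add: dist_commute)
  qed
  have b_layer: "0 < \<Phi> y \<and> \<Phi> y < h" if "y \<in> b x" "x \<in> X" for x y
  proof -
    have "\<Phi> (x + (h / 2) *\<^sub>R e) = h / 2" using X(2) that(2) by (auto simp: shift)
    moreover have "L * dist (x + (h / 2) *\<^sub>R e) y < L * (h / (4 * L))"
      using that(1) L1 unfolding b_def by (intro mult_strict_left_mono) auto
    ultimately show ?thesis using lip[of "x + (h / 2) *\<^sub>R e" y] L1 h(1) by (auto simp: abs_less_iff abs_le_iff)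
  qed
  have b_uniq: "x = x'" if "y \<in> b x" "y \<in> b x'" "x \<in> X" "x' \<in> X" for x x' y
  proof (rule ccontr)
    assume "x \<noteq> x'"
    then have "h \<le> dist (x + (h / 2) *\<^sub>R e) (x' + (h / 2) *\<^sub>R e)" using X(3) that by (simp add: separated_def)
    moreover have "dist (x + (h / 2) *\<^sub>R e) (x' + (h / 2) *\<^sub>R e) < h / 4 + h / 4"
      using that(1,2) hL dist_triangle2[of "x + (h / 2) *\<^sub>R e" "x' + (h / 2) *\<^sub>R e" y] unfolding b_def by simp
    ultimately show False using h(1) by simp
  qed
  \<comment> \<open>A nonnegative lower bound of \<open>f\<close> on the ball \<open>b x\<close>.\<close>
  define g where "g x = max 0 (f x - \<epsilon>)" for x
  have "(\<Sum>x\<in>X. ennreal (g x) * ennreal (\<kappa> * h ^ 3)) = (\<integral>\<^sup>+y. (\<Sum>x\<in>X. ennreal (g x) * indicator (b x) y) \<partial>lborel)"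
  proof -
    have "b x \<in> sets lborel" for x by (simp add: b_def)
    then show ?thesis
      by (subst nn_integral_sum) (auto simp: nn_integral_cmult_indicator b_em intro!: borel_measurable_times borel_measurable_indicator)
  qed
  also have "\<dots> \<le> (\<integral>\<^sup>+x \<in> {x. 0 < \<Phi> x \<and> \<Phi> x < h} \<inter> ball p (2 * \<rho>). ennreal (f x) \<partial>lborel)"
  proof (rule nn_integral_mono)
    fix y :: "real^3"
    show "(\<Sum>x\<in>X. ennreal (g x) * indicator (b x) y) \<le>
        ennreal (f y) * indicator ({x. 0 < \<Phi> x \<and> \<Phi> x < h} \<inter> ball p (2 * \<rho>)) y"
    proof (cases "\<exists>x\<in>X. y \<in> b x")
      case True
      then obtain x where x: "x \<in> X" "y \<in> b x" by blast
      have "(\<Sum>x'\<in>X. ennreal (g x') * indicator (b x') y) = (\<Sum>x'\<in>X. if x' = x then ennreal (g x) else 0)"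
        using x b_uniq by (intro sum.cong) (auto simp: indicator_def)
      then have sum: "(\<Sum>x'\<in>X. ennreal (g x') * indicator (b x') y) = ennreal (g x)"
        using x X(1) by simp
      have near: "dist y x < 3 * h / 4" by (rule b_near[OF x(2)])
      have xp: "dist p x < \<rho>" using x(1) X(2) by auto
      have yp: "dist p y < 2 * \<rho>" using near xp h dist_triangle[of p y x] by (simp add: dist_commute)
      have "dist (f y) (f x) < \<epsilon>" using near xp yp h(1,3) \<rho> by (intro d(2)) auto
      then have "g x \<le> f y" using f(2) by (auto simp: g_def dist_real_def)
      then show ?thesis using sum b_layer[OF x(2,1)] yp by (auto intro: ennreal_leI)
    next
      case False
      then have "(\<Sum>x\<in>X. ennreal (g x) * indicator (b x) y) = 0" by (intro sum.neutral) auto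
      then show ?thesis by simp
    qed
  qed
  also have "\<dots> \<le> ennreal (h * B)" by (rule layer[OF h(1,4)])
  finally have "ennreal (\<Sum>x\<in>X. g x * (\<kappa> * h ^ 3)) \<le> ennreal (h * B)"
    using pos h(1) by (simp add: ennreal_mult[symmetric] sum_ennreal g_def)
  then have "(\<Sum>x\<in>X. g x * (\<kappa> * h ^ 3)) \<le> h * B"
    using h(1) B by (subst (asm) ennreal_le_iff) auto
  then have "h * (\<kappa> * h\<^sup>2 * sum g X) \<le> h * B"
    by (simp add: sum_distrib_left sum_distrib_right power2_eq_square power3_eq_cube mult_ac)
  then have "\<kappa> * h\<^sup>2 * sum g X \<le> B" using h(1) by simp
  then have "h\<^sup>2 * sum g X \<le> B / \<kappa>" using pos by (simp add: field_simps)
  moreover have "(\<Sum>x\<in>X. f x + \<epsilon>) \<le> (\<Sum>x\<in>X. g x + 2 * \<epsilon>)" by (intro sum_mono) (auto simp: g_def)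
  then have "(\<Sum>x\<in>X. f x + \<epsilon>) \<le> sum g X + 2 * \<epsilon> * card X" by (simp add: sum.distrib mult_ac)
  then have "h\<^sup>2 * (\<Sum>x\<in>X. f x + \<epsilon>) \<le> h\<^sup>2 * (sum g X + 2 * \<epsilon> * card X)" by (intro mult_left_mono) auto
  ultimately have "h\<^sup>2 * (\<Sum>x\<in>X. f x + \<epsilon>) \<le> B / \<kappa> + 2 * \<epsilon> * (card X * h\<^sup>2)" by (simp add: algebra_simps)
  also have "\<dots> \<le> B / \<kappa> + 2 * \<epsilon> * (432 * L ^ 3 * \<rho>\<^sup>2)"
    using X(5) \<epsilon> by (intro add_left_mono mult_left_mono) auto
  finally have "C1 * (h\<^sup>2 * (\<Sum>x\<in>X. f x + \<epsilon>)) \<le> C1 * (B / \<kappa> + 2 * \<epsilon> * (432 * L ^ 3 * \<rho>\<^sup>2))"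
    using pos by (intro mult_left_mono) auto
  moreover have "(\<Sum>x\<in>X. (f x + \<epsilon>) * (C1 * h\<^sup>2)) = C1 * (h\<^sup>2 * (\<Sum>x\<in>X. f x + \<epsilon>))"
    unfolding sum_distrib_right[symmetric] by (simp only: mult_ac)
  moreover have "C1 * (B / \<kappa> + 2 * \<epsilon> * (432 * L ^ 3 * \<rho>\<^sup>2)) = layer_const * B + \<epsilon> * C2"
    by (simp add: lc C2_def algebra_simps)
  moreover have "\<epsilon> * C2 = e0" using C2 by (simp add: \<epsilon>_def)
  ultimately have "(\<Sum>x\<in>X. (f x + \<epsilon>) * (C1 * h\<^sup>2)) \<le> layer_const * B + e0" by simp
  then have "ennreal (\<Sum>x\<in>X. (f x + \<epsilon>) * (C1 * h\<^sup>2)) \<le> ennreal (layer_const * B) + ennreal e0"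
    using B e0 pos by (simp add: lc ennreal_plus[symmetric] ennreal_leI del: ennreal_plus)
  with up show "(\<integral>\<^sup>+x\<in>?A. ennreal (f x) \<partial>hausdorff2) \<le> ennreal (layer_const * B) + ennreal e0"
    by (rule order_trans)
qed

end

section \<open>Integrating the strain along segments\<close>

lemma norm_matrix_vector_le: "norm (A *v x) \<le> norm A * norm (x :: real^'n)" for A :: "real^'n^'m"
proof -
  have "norm (A *v x) = L2_set (\<lambda>i. norm ((A *v x) $ i)) UNIV" by (simp add: norm_vec_def)
  also have "\<dots> \<le> L2_set (\<lambda>i. norm (A $ i) * norm x) UNIV"
    by (intro L2_set_mono) (auto simp: matrix_vector_mul_component Cauchy_Schwarz_ineq2)
  also have "\<dots> = norm A * norm x" by (simp add: L2_set_left_distrib norm_vec_def)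
  finally show ?thesis .
qed

text \<open>
  The antisymmetric part of a matrix has a vanishing quadratic form, so the strain alone determines how
  \<open>W \<bullet> \<xi>\<close> changes in the direction \<open>\<xi>\<close>.
\<close>

lemma strain_quadratic:
  assumes "W differentiable (at x)"
  shows "(strain W x *v \<xi>) \<bullet> \<xi> = frechet_derivative W (at x) \<xi> \<bullet> \<xi>"
proof -
  let ?J = "jacobian W (at x)"
  have "frechet_derivative W (at x) = (\<lambda>h. ?J *v h)"
    using assms jacobian_works by (metis frechet_derivative_at)
  moreover have "(transpose ?J *v \<xi>) \<bullet> \<xi> = (?J *v \<xi>) \<bullet> \<xi>"
    using dot_lmul_matrix[of \<xi> ?J \<xi>] by (simp add: inner_commute)
  ultimately show ?thesis
    by (simp add: strain_def matrix_vector_mult_add_rdistrib scaleR_matrix_vector_assoc[symmetric] inner_add_left)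
qed

lemma strain_quadratic_le:
  assumes "W differentiable (at x)"
  shows "\<bar>frechet_derivative W (at x) \<xi> \<bullet> \<xi>\<bar> \<le> (norm \<xi>)\<^sup>2 * norm (strain W x)"
proof -
  have "\<bar>(strain W x *v \<xi>) \<bullet> \<xi>\<bar> \<le> norm (strain W x *v \<xi>) * norm \<xi>" by (rule Cauchy_Schwarz_ineq2)
  also have "\<dots> \<le> norm (strain W x) * norm \<xi> * norm \<xi>"
    by (intro mult_right_mono norm_matrix_vector_le) auto
  finally show ?thesis using strain_quadratic[OF assms, of \<xi>] by (simp add: power2_eq_square mult_ac)
qed

lemma C1_D:
  assumes "Ck_on 1 W UNIV"
  shows "W differentiable (at x)" "continuous_on UNIV (\<lambda>x. frechet_derivative W (at x) v)"
    "continuous_on UNIV W" "W \<in> borel_measurable borel"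
proof -
  show d: "W differentiable (at x)" for x using assms by simp
  show "continuous_on UNIV (\<lambda>x. frechet_derivative W (at x) v)" using assms by simp
  show c: "continuous_on UNIV W"
    using d differentiable_imp_continuous_within by (auto simp: continuous_on_eq_continuous_at)
  show "W \<in> borel_measurable borel" by (rule borel_measurable_continuous_onI[OF c])
qed

lemma continuous_on_strain:
  assumes "Ck_on 1 W UNIV"
  shows "continuous_on UNIV (strain W)"
proof -
  have comp: "strain W x = (\<chi> i j. 1/2 * (frechet_derivative W (at x) (axis j 1) $ i +
      frechet_derivative W (at x) (axis i 1) $ j))" for x
    by (simp add: strain_def vec_eq_iff jacobian_def matrix_def transpose_def)
  show ?thesis
    unfolding comp[abs_def] by (intro continuous_intros C1_D(2)[OF assms])
qed

lemma borel_measurable_strain: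
  "Ck_on 1 W UNIV \<Longrightarrow> strain W \<in> borel_measurable borel"
  by (rule borel_measurable_continuous_onI[OF continuous_on_strain])

text \<open>
  The strain is extended by zero outside \<open>\<Omega>\<close>, so that integrals over segments can be averaged over translations
  of the whole space.
\<close>

definition strain_density :: "(real^3) set \<Rightarrow> (real^3 \<Rightarrow> real^3) \<Rightarrow> real^3 \<Rightarrow> ennreal" where
  "strain_density \<Omega> W x = ennreal (norm (strain W x)) * indicator \<Omega> x"

definition strain_mass :: "(real^3) set \<Rightarrow> (real^3 \<Rightarrow> real^3) \<Rightarrow> ennreal" where
  "strain_mass \<Omega> W = (\<integral>\<^sup>+x. strain_density \<Omega> W x \<partial>lborel)"

abbreviation segment_integral :: "('a::real_vector \<Rightarrow> ennreal) \<Rightarrow> 'a \<Rightarrow> 'a \<Rightarrow> ennreal" where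
  "segment_integral F x \<xi> \<equiv> \<integral>\<^sup>+s\<in>{0..1}. F (x + s *\<^sub>R \<xi>) \<partial>lborel"

abbreviation L1_norm :: "'a measure \<Rightarrow> 'a set \<Rightarrow> ('a \<Rightarrow> real^3) \<Rightarrow> ennreal" where
  "L1_norm M V W \<equiv> \<integral>\<^sup>+x\<in>V. ennreal (norm (W x)) \<partial>M"

lemma borel_measurable_strain_density:
  assumes "Ck_on 1 W UNIV" "open \<Omega>"
  shows "strain_density \<Omega> W \<in> borel_measurable borel"
proof -
  note [measurable] = borel_measurable_strain[OF assms(1)]
  have [measurable]: "\<Omega> \<in> sets borel" using assms(2) by simp
  show ?thesis unfolding strain_density_def[abs_def] by measurable
qed

text \<open>
  The fundamental theorem of calculus for \<open>W \<bullet> \<xi>\<close> along the segment, whose interior has to lie in \<open>\<Omega>\<close>.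
  The end points may lie on the boundary.
\<close>

lemma segment_bound:
  assumes W: "Ck_on 1 W UNIV" and op: "open \<Omega>" and \<tau>: "0 \<le> \<tau>" "\<tau> \<le> 1"
    and seg: "\<And>s. 0 < s \<Longrightarrow> s < \<tau> \<Longrightarrow> x + s *\<^sub>R \<xi> \<in> \<Omega>"
  shows "ennreal \<bar>W (x + \<tau> *\<^sub>R \<xi>) \<bullet> \<xi> - W x \<bullet> \<xi>\<bar> \<le>
    ennreal ((norm \<xi>)\<^sup>2) * segment_integral (strain_density \<Omega> W) x \<xi>"
proof -
  let ?D = "\<lambda>y. frechet_derivative W (at y)"
  define g where "g s = ?D (x + s *\<^sub>R \<xi>) \<xi> \<bullet> \<xi>" for s :: real
  have der: "((\<lambda>s. W (x + s *\<^sub>R \<xi>) \<bullet> \<xi>) has_vector_derivative g s) (at s within {0..\<tau>})" for s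
  proof -
    have 1: "((\<lambda>s. x + s *\<^sub>R \<xi>) has_derivative (\<lambda>h. h *\<^sub>R \<xi>)) (at s within {0..\<tau>})"
      by (auto intro!: derivative_eq_intros)
    have 2: "(W has_derivative ?D (x + s *\<^sub>R \<xi>)) (at (x + s *\<^sub>R \<xi>))"
      using C1_D(1)[OF W] frechet_derivative_works by blast
    have "((\<lambda>s. W (x + s *\<^sub>R \<xi>)) has_derivative (\<lambda>h. ?D (x + s *\<^sub>R \<xi>) (h *\<^sub>R \<xi>))) (at s within {0..\<tau>})"
      using has_derivative_compose[OF 1 2] by simp
    then have "((\<lambda>s. W (x + s *\<^sub>R \<xi>) \<bullet> \<xi>) has_derivative (\<lambda>h. ?D (x + s *\<^sub>R \<xi>) (h *\<^sub>R \<xi>) \<bullet> \<xi>)) (at s within {0..\<tau>})"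
      by (rule has_derivative_inner_left)
    moreover have "?D (x + s *\<^sub>R \<xi>) (h *\<^sub>R \<xi>) \<bullet> \<xi> = h *\<^sub>R g s" for h
      using linear_frechet_derivative[OF C1_D(1)[OF W]] by (simp add: g_def linear_scale)
    ultimately show ?thesis by (simp add: has_vector_derivative_def)
  qed
  have cont: "continuous_on {0..\<tau>} g"
  proof -
    have "continuous_on {0..\<tau>} (\<lambda>s. ?D (x + s *\<^sub>R \<xi>) \<xi>)"
      by (rule continuous_on_compose2[OF C1_D(2)[OF W]]) (auto intro!: continuous_intros)
    then show ?thesis unfolding g_def by (intro continuous_intros)
  qed
  have FTC: "has_bochner_integral lborel (\<lambda>s. indicator {0..\<tau>} s *\<^sub>R g s) (W (x + \<tau> *\<^sub>R \<xi>) \<bullet> \<xi> - W x \<bullet> \<xi>)"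
    using has_bochner_integral_FTC_Icc[OF \<tau>(1) der cont] by simp
  have "ennreal \<bar>W (x + \<tau> *\<^sub>R \<xi>) \<bullet> \<xi> - W x \<bullet> \<xi>\<bar> = ennreal (norm (\<integral>s. indicator {0..\<tau>} s *\<^sub>R g s \<partial>lborel))"
    using has_bochner_integral_integral_eq[OF FTC] by simp
  also have "\<dots> \<le> (\<integral>\<^sup>+s. norm (indicator {0..\<tau>} s *\<^sub>R g s) \<partial>lborel)"
    using FTC by (intro integral_norm_bound_ennreal) (auto simp: has_bochner_integral_iff)
  also have "\<dots> \<le> (\<integral>\<^sup>+s. ennreal ((norm \<xi>)\<^sup>2) * (strain_density \<Omega> W (x + s *\<^sub>R \<xi>) * indicator {0..1} s) \<partial>lborel)"
  proof (rule nn_integral_mono_AE)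
    have "AE s in lborel. s \<noteq> (0::real)" "AE s in lborel. s \<noteq> \<tau>" by (rule AE_lborel_singleton)+
    then show "AE s in lborel. ennreal (norm (indicator {0..\<tau>} s *\<^sub>R g s)) \<le>
      ennreal ((norm \<xi>)\<^sup>2) * (strain_density \<Omega> W (x + s *\<^sub>R \<xi>) * indicator {0..1} s)"
    proof eventually_elim
      case (elim s)
      show ?case
      proof (cases "s \<in> {0..\<tau>}")
        case True
        then have "x + s *\<^sub>R \<xi> \<in> \<Omega>" using elim seg[of s] by auto
        moreover have "\<bar>g s\<bar> \<le> (norm \<xi>)\<^sup>2 * norm (strain W (x + s *\<^sub>R \<xi>))"
          unfolding g_def by (rule strain_quadratic_le[OF C1_D(1)[OF W]])
        ultimately show ?thesis using True \<tau>
          by (auto simp: strain_density_def ennreal_mult[symmetric] intro!: ennreal_leI)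
      qed simp
    qed
  qed
  also have "\<dots> = ennreal ((norm \<xi>)\<^sup>2) * (\<integral>\<^sup>+s. strain_density \<Omega> W (x + s *\<^sub>R \<xi>) * indicator {0..1} s \<partial>lborel)"
  proof (rule nn_integral_cmult)
    note [measurable] = borel_measurable_strain_density[OF W op]
    show "(\<lambda>s. strain_density \<Omega> W (x + s *\<^sub>R \<xi>) * indicator {0..1} s) \<in> borel_measurable lborel"
      by measurable
  qed
  finally show ?thesis .
qed

lemma nn_integral_lborel_shift:
  fixes a :: "'a::euclidean_space"
  assumes [measurable]: "F \<in> borel_measurable borel"
  shows "(\<integral>\<^sup>+x. F (x + a) \<partial>lborel) = (\<integral>\<^sup>+x. F x \<partial>lborel)"
proof -
  have "(\<integral>\<^sup>+x. F x \<partial>lborel) = (\<integral>\<^sup>+x. F x \<partial>distr lborel borel ((+) a))"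
    by (simp add: lborel_distr_plus)
  also have "\<dots> = (\<integral>\<^sup>+x. F (a + x) \<partial>lborel)" by (rule nn_integral_distr) auto
  finally show ?thesis by (simp add: add.commute)
qed

text \<open>
  Tonelli's theorem and translation invariance: a translation-averaged line integral is a volume integral.
\<close>

lemma nn_integral_segments:
  fixes \<xi> :: "'a::euclidean_space"
  assumes [measurable]: "F \<in> borel_measurable borel"
  shows "(\<integral>\<^sup>+x. segment_integral F x \<xi> \<partial>lborel) = (\<integral>\<^sup>+x. F x \<partial>lborel)"
proof -
  have "(\<integral>\<^sup>+x. segment_integral F x \<xi> \<partial>lborel) =
      (\<integral>\<^sup>+s. (\<integral>\<^sup>+x. F (x + s *\<^sub>R \<xi>) * indicator {0..1::real} s \<partial>lborel) \<partial>lborel)"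
    by (rule lborel_pair.Fubini'[symmetric]) measurable
  also have "\<dots> = (\<integral>\<^sup>+s. (\<integral>\<^sup>+x. F x \<partial>lborel) * indicator {0..1::real} s \<partial>lborel)"
    by (intro nn_integral_cong) (simp add: nn_integral_multc nn_integral_lborel_shift)
  also have "\<dots> = (\<integral>\<^sup>+x. F x \<partial>lborel)" by (simp add: nn_integral_cmult_indicator)
  finally show ?thesis .
qed

text \<open>
  \<open>h *\<^sub>R b\<close> is the difference of the two directions \<open>\<xi> + h *\<^sub>R b\<close> and \<open>\<xi>\<close>.
\<close>

lemma norm_le_nearby_directions:
  fixes v :: "'a::euclidean_space"
  assumes "0 < h"
  shows "norm v \<le> (1 / h) * (\<Sum>b\<in>Basis. \<bar>v \<bullet> (\<xi> + h *\<^sub>R b)\<bar> + \<bar>v \<bullet> \<xi>\<bar>)"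
proof -
  have "h * norm v \<le> h * (\<Sum>b\<in>Basis. \<bar>v \<bullet> b\<bar>)"
    using assms by (intro mult_left_mono norm_le_l1) auto
  also have "\<dots> = (\<Sum>b\<in>Basis. \<bar>h * (v \<bullet> b)\<bar>)" using assms by (simp add: sum_distrib_left abs_mult)
  also have "\<dots> \<le> (\<Sum>b\<in>Basis. \<bar>v \<bullet> (\<xi> + h *\<^sub>R b)\<bar> + \<bar>v \<bullet> \<xi>\<bar>)"
    by (intro sum_mono) (simp add: inner_add_right)
  finally show ?thesis using assms by (simp add: field_simps)
qed

text \<open>
  The factor \<open>6\<close> counts the two directions that are used for each of the three coordinates.
\<close>

lemma nn_integral_norm_le_directions:
  fixes W :: "'a \<Rightarrow> real^3"
  assumes [measurable]: "W \<in> borel_measurable M" "V \<in> sets M" and h: "0 < h"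
    and B: "\<And>\<eta>. \<eta> \<in> cball \<xi> h \<Longrightarrow> (\<integral>\<^sup>+x\<in>V. ennreal \<bar>W x \<bullet> \<eta>\<bar> \<partial>M) \<le> B"
  shows "L1_norm M V W \<le> ennreal (6 / h) * B"
proof -
  let ?S = "\<lambda>\<eta>. \<integral>\<^sup>+x\<in>V. ennreal \<bar>W x \<bullet> \<eta>\<bar> \<partial>M"
  have "L1_norm M V W \<le>
    (\<integral>\<^sup>+x. ennreal (1 / h) * (\<Sum>b\<in>Basis. ennreal \<bar>W x \<bullet> (\<xi> + h *\<^sub>R b)\<bar> * indicator V x + ennreal \<bar>W x \<bullet> \<xi>\<bar> * indicator V x) \<partial>M)"
  proof (rule nn_integral_mono)
    fix x
    have "ennreal (norm (W x)) \<le> ennreal ((1 / h) * (\<Sum>b\<in>Basis. \<bar>W x \<bullet> (\<xi> + h *\<^sub>R b)\<bar> + \<bar>W x \<bullet> \<xi>\<bar>))"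
      by (rule ennreal_leI[OF norm_le_nearby_directions[OF h]])
    also have "\<dots> = ennreal (1 / h) * ennreal (\<Sum>b\<in>Basis. \<bar>W x \<bullet> (\<xi> + h *\<^sub>R b)\<bar> + \<bar>W x \<bullet> \<xi>\<bar>)"
      using h by (intro ennreal_mult sum_nonneg) auto
    also have "ennreal (\<Sum>b\<in>Basis. \<bar>W x \<bullet> (\<xi> + h *\<^sub>R b)\<bar> + \<bar>W x \<bullet> \<xi>\<bar>) =
        (\<Sum>b\<in>Basis. ennreal \<bar>W x \<bullet> (\<xi> + h *\<^sub>R b)\<bar> + ennreal \<bar>W x \<bullet> \<xi>\<bar>)"
      by (subst sum_ennreal[symmetric]) (auto simp: ennreal_plus)
    finally show "ennreal (norm (W x)) * indicator V x \<le> ennreal (1 / h) *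
        (\<Sum>b\<in>Basis. ennreal \<bar>W x \<bullet> (\<xi> + h *\<^sub>R b)\<bar> * indicator V x + ennreal \<bar>W x \<bullet> \<xi>\<bar> * indicator V x)"
      by (cases "x \<in> V") auto
  qed
  also have "\<dots> = ennreal (1 / h) * (\<Sum>b\<in>Basis. ?S (\<xi> + h *\<^sub>R b) + ?S \<xi>)"
    by (simp add: nn_integral_cmult nn_integral_sum nn_integral_add)
  also have "\<dots> \<le> ennreal (1 / h) * (\<Sum>b\<in>(Basis::(real^3) set). B + B)"
    using h by (intro mult_left_mono sum_mono add_mono B) (auto simp: dist_norm)
  also have "(\<Sum>b\<in>(Basis::(real^3) set). B + B) = 6 * B"
    by (simp add: mult_2[symmetric] mult.assoc[symmetric])
  also have "ennreal (1 / h) * (6 * B) = ennreal (6 / h) * B"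
  proof -
    have "ennreal (1 / h) * ennreal 6 = ennreal (1 / h * 6)"
      using h by (intro ennreal_mult[symmetric]) auto
    then have "ennreal (1 / h) * 6 = ennreal (6 / h)" by simp
    then show ?thesis by (simp add: mult.assoc[symmetric])
  qed
  finally show ?thesis .
qed

definition vanishing_fields :: "(real^3) set \<Rightarrow> (real^3 \<Rightarrow> real^3) set" where
  "vanishing_fields \<Gamma> = {W. Ck_on 1 W UNIV \<and> (\<forall>x\<in>\<Gamma>. W x = 0)}"

text \<open>
  The constant may depend on \<open>V\<close> but not on the field. The Korn--Poincare inequality is the case \<open>V = \<Omega>\<close>.
\<close>

definition controlled :: "(real^3) set \<Rightarrow> (real^3) set \<Rightarrow> (real^3) set \<Rightarrow> bool" where
  "controlled \<Omega> \<Gamma> V \<longleftrightarrow> (\<exists>C\<ge>0. \<forall>W\<in>vanishing_fields \<Gamma>.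
     L1_norm lborel V W \<le> ennreal C * strain_mass \<Omega> W)"

lemma controlled_mono:
  assumes V: "controlled \<Omega> \<Gamma> V" and sub: "U \<subseteq> V"
  shows "controlled \<Omega> \<Gamma> U"
proof -
  obtain C where C: "0 \<le> C" "\<forall>W\<in>vanishing_fields \<Gamma>.
     L1_norm lborel V W \<le> ennreal C * strain_mass \<Omega> W"
    using V unfolding controlled_def by auto
  have mono: "L1_norm lborel U W \<le> L1_norm lborel V W" for W :: "real^3 \<Rightarrow> real^3"
    using sub by (intro nn_integral_mono mult_left_mono) (auto simp: indicator_def)
  show ?thesis
    unfolding controlled_def
  proof (intro exI[of _ C] conjI ballI)
    fix W assume "W \<in> vanishing_fields \<Gamma>"
    with C(2) have "L1_norm lborel V W \<le> ennreal C * strain_mass \<Omega> W" by (rule bspec)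
    with mono show "L1_norm lborel U W \<le> ennreal C * strain_mass \<Omega> W"
      by (rule order_trans)
  qed (rule C(1))
qed

lemma controlled_UN:
  assumes "finite I" "\<And>i. i \<in> I \<Longrightarrow> controlled \<Omega> \<Gamma> (V i)" "\<And>i. i \<in> I \<Longrightarrow> V i \<in> sets borel"
  shows "controlled \<Omega> \<Gamma> (\<Union>i\<in>I. V i)"
  using assms
proof (induction I rule: finite_induct)
  case empty
  then show ?case by (auto simp: controlled_def)
next
  case (insert i I)
  obtain C where C: "0 \<le> C" "\<forall>W\<in>vanishing_fields \<Gamma>.
     L1_norm lborel (V i) W \<le> ennreal C * strain_mass \<Omega> W"
    using insert.prems(1)[of i] unfolding controlled_def by auto
  have "controlled \<Omega> \<Gamma> (\<Union>i\<in>I. V i)" using insert by auto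
  then obtain D where D: "0 \<le> D" "\<forall>W\<in>vanishing_fields \<Gamma>.
     L1_norm lborel (\<Union>i\<in>I. V i) W \<le> ennreal D * strain_mass \<Omega> W"
    unfolding controlled_def by auto
  have [measurable]: "V i \<in> sets borel" "(\<Union>i\<in>I. V i) \<in> sets borel"
    using insert by auto
  show ?case
    unfolding controlled_def
  proof (intro exI[of _ "C + D"] conjI ballI)
    fix W assume W: "W \<in> vanishing_fields \<Gamma>"
    then have [measurable]: "W \<in> borel_measurable borel" by (auto simp: vanishing_fields_def intro: C1_D)
    have "L1_norm lborel (\<Union>i\<in>insert i I. V i) W \<le>
      (\<integral>\<^sup>+x. ennreal (norm (W x)) * indicator (V i) x + ennreal (norm (W x)) * indicator (\<Union>i\<in>I. V i) x \<partial>lborel)"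
      by (intro nn_integral_mono) (auto simp: indicator_def)
    also have "\<dots> = L1_norm lborel (V i) W + L1_norm lborel (\<Union>i\<in>I. V i) W"
      by (rule nn_integral_add) measurable
    also have "\<dots> \<le> ennreal C * strain_mass \<Omega> W + ennreal D * strain_mass \<Omega> W"
      using C(2) D(2) W by (intro add_mono) auto
    also have "\<dots> = ennreal (C + D) * strain_mass \<Omega> W"
      using C(1) D(1) by (simp add: distrib_right)
    finally show "L1_norm lborel (\<Union>i\<in>insert i I. V i) W \<le> ennreal (C + D) * strain_mass \<Omega> W" .
  qed (use C D in auto)
qed

text \<open>
  For each vector \<open>\<eta>\<close> of the ball, \<open>W x \<bullet> \<eta>\<close> differs from \<open>W (x + \<eta>) \<bullet> \<eta>\<close> by at most the strain along the
  segment between the two points. Integrating over \<open>V\<close> bounds \<open>W \<bullet> \<eta>\<close> there, and these components together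
  determine \<open>W\<close>.
\<close>

lemma controlled_translate:
  assumes op: "open \<Omega>" and V: "V \<in> sets borel" and U: "U \<in> sets borel" "controlled \<Omega> \<Gamma> U" and h: "0 < h"
    and step: "\<And>x \<eta>. x \<in> V \<Longrightarrow> \<eta> \<in> cball \<xi> h \<Longrightarrow> x + \<eta> \<in> U"
    and seg: "\<And>x \<eta> s. x \<in> V \<Longrightarrow> \<eta> \<in> cball \<xi> h \<Longrightarrow> 0 < s \<Longrightarrow> s < 1 \<Longrightarrow> x + s *\<^sub>R \<eta> \<in> \<Omega>"
  shows "controlled \<Omega> \<Gamma> V"
proof -
  obtain C where C: "0 \<le> C" "\<forall>W\<in>vanishing_fields \<Gamma>.
     L1_norm lborel U W \<le> ennreal C * strain_mass \<Omega> W"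
    using U(2) unfolding controlled_def by auto
  note [measurable] = V U(1)
  define R where "R = norm \<xi> + h"
  have R: "0 \<le> R" using h by (simp add: R_def)
  show ?thesis
    unfolding controlled_def
  proof (intro exI[of _ "(6 / h) * (R * C + R\<^sup>2)"] conjI ballI)
    show "0 \<le> (6 / h) * (R * C + R\<^sup>2)" using h R C by simp
    fix W assume W: "W \<in> vanishing_fields \<Gamma>"
    then have W1: "Ck_on 1 W UNIV" by (simp add: vanishing_fields_def)
    note [measurable] = C1_D(4)[OF W1] borel_measurable_strain_density[OF W1 op]
    let ?F = "strain_density \<Omega> W"
    have "L1_norm lborel V W \<le>
      ennreal (6 / h) * (ennreal R * (ennreal C * strain_mass \<Omega> W) + ennreal (R\<^sup>2) * strain_mass \<Omega> W)"
    proof (rule nn_integral_norm_le_directions[where \<xi>=\<xi>])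
      fix \<eta> assume \<eta>: "\<eta> \<in> cball \<xi> h"
      have n\<eta>: "norm \<eta> \<le> R"
        using \<eta> norm_triangle_ineq2[of \<eta> \<xi>] by (simp add: R_def dist_norm norm_minus_commute)
      have "(\<integral>\<^sup>+x\<in>V. ennreal \<bar>W x \<bullet> \<eta>\<bar> \<partial>lborel) \<le>
        (\<integral>\<^sup>+x. ennreal R * (ennreal (norm (W (x + \<eta>))) * indicator U (x + \<eta>)) +
          ennreal (R\<^sup>2) * segment_integral ?F x \<eta> \<partial>lborel)"
      proof (rule nn_integral_mono)
        fix x
        show "ennreal \<bar>W x \<bullet> \<eta>\<bar> * indicator V x \<le> ennreal R * (ennreal (norm (W (x + \<eta>))) * indicator U (x + \<eta>)) +
          ennreal (R\<^sup>2) * segment_integral ?F x \<eta>"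
        proof (cases "x \<in> V")
          case True
          have "\<bar>W (x + \<eta>) \<bullet> \<eta>\<bar> \<le> R * norm (W (x + \<eta>))"
            using Cauchy_Schwarz_ineq2[of "W (x + \<eta>)" \<eta>] mult_left_mono[OF n\<eta>, of "norm (W (x + \<eta>))"]
            by (simp add: mult.commute)
          then have "\<bar>W x \<bullet> \<eta>\<bar> \<le> R * norm (W (x + \<eta>)) + \<bar>W (x + \<eta>) \<bullet> \<eta> - W x \<bullet> \<eta>\<bar>" by linarith
          then have "ennreal \<bar>W x \<bullet> \<eta>\<bar> \<le> ennreal (R * norm (W (x + \<eta>)) + \<bar>W (x + \<eta>) \<bullet> \<eta> - W x \<bullet> \<eta>\<bar>)"
            by (rule ennreal_leI)
          also have "\<dots> = ennreal R * ennreal (norm (W (x + \<eta>))) + ennreal \<bar>W (x + \<eta>) \<bullet> \<eta> - W x \<bullet> \<eta>\<bar>"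
            using R by (simp add: ennreal_plus ennreal_mult)
          also have "\<dots> \<le> ennreal R * ennreal (norm (W (x + \<eta>))) +
              ennreal (R\<^sup>2) * segment_integral ?F x \<eta>"
          proof (rule add_left_mono)
            have "ennreal \<bar>W (x + \<eta>) \<bullet> \<eta> - W x \<bullet> \<eta>\<bar> \<le>
              ennreal ((norm \<eta>)\<^sup>2) * segment_integral ?F x \<eta>"
              using segment_bound[OF W1 op, of 1 x \<eta>] seg[OF True \<eta>] by simp
            also have "\<dots> \<le> ennreal (R\<^sup>2) * segment_integral ?F x \<eta>"
              using n\<eta> by (intro mult_right_mono ennreal_leI power_mono) auto
            finally show "ennreal \<bar>W (x + \<eta>) \<bullet> \<eta> - W x \<bullet> \<eta>\<bar> \<le> \<dots>" .
          qed
          finally show ?thesis using True step[OF True \<eta>] by simp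
        qed simp
      qed
      also have "\<dots> = ennreal R * (\<integral>\<^sup>+x. ennreal (norm (W (x + \<eta>))) * indicator U (x + \<eta>) \<partial>lborel) +
          ennreal (R\<^sup>2) * (\<integral>\<^sup>+x. segment_integral ?F x \<eta> \<partial>lborel)"
        by (subst nn_integral_add) (simp_all add: nn_integral_cmult)
      also have "\<dots> = ennreal R * L1_norm lborel U W + ennreal (R\<^sup>2) * strain_mass \<Omega> W"
        using nn_integral_lborel_shift[of "\<lambda>x. ennreal (norm (W x)) * indicator U x" \<eta>]
          nn_integral_segments[of ?F \<eta>] by (simp add: strain_mass_def)
      also have "\<dots> \<le> ennreal R * (ennreal C * strain_mass \<Omega> W) + ennreal (R\<^sup>2) * strain_mass \<Omega> W"
        using C(2) W by (intro add_right_mono mult_left_mono) auto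
      finally show "(\<integral>\<^sup>+x\<in>V. ennreal \<bar>W x \<bullet> \<eta>\<bar> \<partial>lborel) \<le> \<dots>" .
    qed (use h in measurable)
    also have "\<dots> = ennreal ((6 / h) * (R * C + R\<^sup>2)) * strain_mass \<Omega> W"
    proof -
      have "ennreal ((6 / h) * (R * C + R\<^sup>2)) = ennreal (6 / h) * ennreal (R * C + R\<^sup>2)"
        using h R C(1) by (intro ennreal_mult) auto
      moreover have "ennreal (R * C + R\<^sup>2) = ennreal (R * C) + ennreal (R\<^sup>2)"
        using R C(1) by (intro ennreal_plus) auto
      moreover have "ennreal (R * C) = ennreal R * ennreal C" using R C(1) by (rule ennreal_mult)
      ultimately show ?thesis by (simp only: distrib_left distrib_right mult.assoc)
    qed
    finally show "L1_norm lborel V W \<le> ennreal ((6 / h) * (R * C + R\<^sup>2)) * strain_mass \<Omega> W" .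
  qed
qed

section \<open>A Korn--Poincare inequality for clamped fields\<close>

locale graph_chart = graph_function e L \<Phi> for e L \<Phi> +
  fixes \<Omega> :: "(real^3) set" and p :: "real^3" and r :: real
  assumes open_\<Omega>: "open \<Omega>" and r_pos: "0 < r" and p_frontier: "p \<in> frontier \<Omega>"
    and region: "\<And>x. x \<in> ball p r \<Longrightarrow> x \<in> \<Omega> \<longleftrightarrow> 0 < \<Phi> x"
begin

lemma frontier_iff:
  assumes x: "x \<in> ball p r"
  shows "x \<in> frontier \<Omega> \<longleftrightarrow> \<Phi> x = 0"
proof
  assume "x \<in> frontier \<Omega>"
  then have xc: "x \<in> closure \<Omega>" "x \<notin> \<Omega>" using open_\<Omega> by (auto simp: frontier_def interior_open)
  have "\<not> \<Phi> x < 0"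
  proof
    assume neg: "\<Phi> x < 0"
    let ?S = "{y. \<Phi> y < 0} \<inter> ball p r"
    have "open ?S" using continuous_\<Phi> by (intro open_Int open_Collect_less) auto
    moreover have "?S \<inter> \<Omega> = {}" using region by force
    ultimately have "?S \<inter> closure \<Omega> = {}" by (simp add: open_Int_closure_eq_empty)
    then show False using neg x xc(1) by blast
  qed
  then show "\<Phi> x = 0" using xc(2) region[OF x] by simp
next
  assume z: "\<Phi> x = 0"
  have "x \<in> closure \<Omega>"
    unfolding closure_approachable
  proof (intro allI impI)
    fix \<epsilon> :: real assume \<epsilon>: "0 < \<epsilon>"
    define s where "s = min (\<epsilon> / 2) ((r - dist p x) / 2)"
    have s_le: "s \<le> \<epsilon> / 2" "s \<le> (r - dist p x) / 2"
      unfolding s_def by (rule min.cobounded1, rule min.cobounded2)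
    have s0: "0 < s" using \<epsilon> x by (simp add: s_def)
    have "s < \<epsilon>" "s < r - dist p x" using s_le s0 by auto
    note s = s0 this
    have d: "dist (x + s *\<^sub>R e) x = s" using s norm_e by (simp add: dist_norm)
    have "dist p (x + s *\<^sub>R e) < r" using dist_triangle[of p "x + s *\<^sub>R e" x] d s by (simp add: dist_commute)
    then have "x + s *\<^sub>R e \<in> \<Omega>" using region[of "x + s *\<^sub>R e"] s z by (simp add: shift)
    then show "\<exists>y\<in>\<Omega>. dist y x < \<epsilon>" using d s by (intro bexI[of _ "x + s *\<^sub>R e"]) auto
  qed
  then show "x \<in> frontier \<Omega>" using region[OF x] z open_\<Omega> by (simp add: frontier_def interior_open)
qed

lemma \<Phi>_p: "\<Phi> p = 0" using frontier_iff[of p] p_frontier r_pos by simp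

text \<open>
  Moving in a direction close to \<open>e\<close> raises \<open>\<Phi>\<close> at a definite rate. The opening \<open>a / (2 * L)\<close> of the cone of
  directions is chosen so that the Lipschitz bound takes away at most half of the rate \<open>a\<close>.
\<close>

lemma climb:
  assumes a: "0 < a" and \<eta>: "\<eta> \<in> cball (a *\<^sub>R e) (a / (2 * L))" and s: "0 \<le> s"
  shows "\<Phi> x + s * (a / 2) \<le> \<Phi> (x + s *\<^sub>R \<eta>)"
proof -
  have "x + s *\<^sub>R \<eta> = (x + s *\<^sub>R (\<eta> - a *\<^sub>R e)) + (s * a) *\<^sub>R e" by (simp add: algebra_simps)
  then have eq: "\<Phi> (x + s *\<^sub>R \<eta>) = \<Phi> (x + s *\<^sub>R (\<eta> - a *\<^sub>R e)) + s * a" by (simp only: shift)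
  have "norm (\<eta> - a *\<^sub>R e) \<le> a / (2 * L)" using \<eta> by (simp add: dist_norm norm_minus_commute)
  then have "L * (s * norm (\<eta> - a *\<^sub>R e)) \<le> L * (s * (a / (2 * L)))"
    using s L1 by (intro mult_left_mono) auto
  also have "\<dots> = s * (a / 2)" using L1 by simp
  finally have "\<bar>\<Phi> (x + s *\<^sub>R (\<eta> - a *\<^sub>R e)) - \<Phi> x\<bar> \<le> s * (a / 2)"
    using lip[of "x + s *\<^sub>R (\<eta> - a *\<^sub>R e)" x] s by (simp add: dist_norm)
  then have "\<Phi> x - s * (a / 2) \<le> \<Phi> (x + s *\<^sub>R (\<eta> - a *\<^sub>R e))" by linarith
  then show ?thesis unfolding eq by linarith
qed

lemma direction_norm:
  assumes a: "0 < a" and \<eta>: "\<eta> \<in> cball (a *\<^sub>R e) (a / (2 * L))"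
  shows "norm \<eta> \<le> 2 * a"
proof -
  have "a / (2 * L) \<le> a / 2" using a L1 by (intro divide_left_mono) auto
  then have "norm (\<eta> - a *\<^sub>R e) \<le> a / 2" using \<eta> by (simp add: dist_norm norm_minus_commute)
  moreover have "norm (a *\<^sub>R e) = a" using a norm_e by simp
  ultimately show ?thesis using norm_triangle_sub[of \<eta> "a *\<^sub>R e"] a by linarith
qed

end

text \<open>
  The function \<open>\<gamma>\<close> of the boundary patch is known to be Lipschitz only on bounded sets. Composing it with the nearest-point
  projection onto a disc makes it globally Lipschitz and changes nothing over the ball.
\<close>

lemma graph_chart_exists:
  assumes C1: "C1_boundary \<Omega>" and op: "open \<Omega>" and p: "p \<in> frontier \<Omega>"
  shows "\<exists>e L \<Phi> r. graph_chart e L \<Phi> \<Omega> p r"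
proof -
  obtain r and T :: "real^3 \<Rightarrow> real^3" and \<gamma> :: "real^2 \<Rightarrow> real" where r: "0 < r"
    and T: "orthogonal_transformation T" and \<gamma>: "Ck_on 1 \<gamma> UNIV"
    and region: "\<Omega> \<inter> ball p r = {x \<in> ball p r. \<gamma> (vector [T x $ 1, T x $ 2]) < T x $ 3}"
    using C1 p unfolding C1_boundary_def by blast
  define q :: "real^3 \<Rightarrow> real^2" where "q x = vector [T x $ 1, T x $ 2]" for x
  have linT: "linear T" using T by (simp add: orthogonal_transformation_def)
  have q1: "q x $ 1 = T x $ 1" and q2: "q x $ 2 = T x $ 2" for x by (simp_all add: q_def)
  have normT: "norm (T x) = norm x" for x using T by (simp add: orthogonal_transformation)
  have q_diff: "norm (q x - q y) \<le> norm (x - y)" for x y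
  proof -
    have "(norm (q x - q y))\<^sup>2 \<le> (norm (T (x - y)))\<^sup>2"
      by (simp add: power2_norm_eq_inner inner_vec_def sum_2 sum_3 q1 q2 linear_diff[OF linT])
    then show ?thesis by (simp add: normT)
  qed
  obtain e where e: "T e = axis 3 1"
    using orthogonal_transformation_surj[OF T] by (metis surjD)
  have norm_e: "norm e = 1" using normT[of e] e by simp
  have Te: "T (x + s *\<^sub>R e) = T x + s *\<^sub>R axis 3 1" for x s
    by (simp add: linear_add[OF linT] linear_scale[OF linT] e)
  have qe: "q (x + s *\<^sub>R e) = q x" for x s
    by (simp add: q_def Te axis_def)
  define K where "K = cball (q p) r"
  have K: "convex K" "compact K" "closed K" "K \<noteq> {}" using r by (auto simp: K_def)
  let ?D = "\<lambda>y. frechet_derivative \<gamma> (at y)"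
  have d\<gamma>: "\<gamma> differentiable (at y)" and c\<gamma>: "continuous_on UNIV (\<lambda>y. ?D y v)" for y v
    using \<gamma> by simp_all
  have "continuous_on K (\<lambda>y. \<Sum>b\<in>Basis. \<bar>?D y b\<bar>)"
    by (intro continuous_intros continuous_on_subset[OF c\<gamma>]) auto
  then have "bounded ((\<lambda>y. \<Sum>b\<in>Basis. \<bar>?D y b\<bar>) ` K)"
    using K(2) compact_continuous_image compact_imp_bounded by blast
  then obtain M where M: "0 < M" "\<And>y. y \<in> K \<Longrightarrow> \<bar>\<Sum>b\<in>Basis. \<bar>?D y b\<bar>\<bar> \<le> M"
    unfolding bounded_pos by auto
  have on: "onorm (?D y) \<le> M" if y: "y \<in> K" for y
  proof (rule onorm_le)
    fix v :: "real^2"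
    have lin: "linear (?D y)" by (rule linear_frechet_derivative[OF d\<gamma>])
    have "?D y v = ?D y (\<Sum>b\<in>Basis. (v \<bullet> b) *\<^sub>R b)" by (simp add: euclidean_representation)
    also have "\<dots> = (\<Sum>b\<in>Basis. (v \<bullet> b) * ?D y b)"
      by (simp add: linear_sum[OF lin] linear_scale[OF lin])
    finally have "\<bar>?D y v\<bar> \<le> (\<Sum>b\<in>Basis. \<bar>(v \<bullet> b) * ?D y b\<bar>)" by simp
    also have "\<dots> \<le> (\<Sum>b\<in>Basis. norm v * \<bar>?D y b\<bar>)"
      by (intro sum_mono) (simp add: abs_mult mult_right_mono Basis_le_norm)
    also have "\<dots> = norm v * (\<Sum>b\<in>Basis. \<bar>?D y b\<bar>)" by (simp add: sum_distrib_left)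
    also have "\<dots> \<le> norm v * M" using M(2)[OF y] by (intro mult_left_mono) auto
    finally show "norm (?D y v) \<le> M * norm v" by (simp add: mult.commute)
  qed
  have \<gamma>_lip: "norm (\<gamma> y - \<gamma> z) \<le> M * norm (y - z)" if "y \<in> K" "z \<in> K" for y z
    by (rule differentiable_bound[where f' = "\<lambda>y. ?D y", OF K(1) _ on that])
      (rule has_derivative_at_withinI[OF frechet_derivative_works[THEN iffD1, OF d\<gamma>]])
  define \<pi> where "\<pi> = closest_point K"
  have \<pi>K: "\<pi> y \<in> K" for y unfolding \<pi>_def by (rule closest_point_in_set[OF K(3,4)])
  have \<pi>_lip: "norm (\<pi> y - \<pi> z) \<le> norm (y - z)" for y z
    using closest_point_lipschitz[OF K(1,3,4), of y z] by (simp add: \<pi>_def dist_norm)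
  define \<Phi> where "\<Phi> x = T x $ 3 - \<gamma> (\<pi> (q x))" for x
  have "graph_chart e (1 + M) \<Phi> \<Omega> p r"
  proof
    show "1 \<le> 1 + M" using M by simp
    show "norm e = 1" by (rule norm_e)
    show "\<Phi> (x + s *\<^sub>R e) = \<Phi> x + s" for x s by (simp add: \<Phi>_def qe Te axis_def)
    show "\<bar>\<Phi> x - \<Phi> y\<bar> \<le> (1 + M) * dist x y" for x y
    proof -
      have "\<bar>T x $ 3 - T y $ 3\<bar> \<le> norm (x - y)"
        using component_le_norm_cart[of "T x - T y" 3] normT[of "x - y"] by (simp add: linear_diff[OF linT])
      moreover have "\<bar>\<gamma> (\<pi> (q x)) - \<gamma> (\<pi> (q y))\<bar> \<le> M * norm (x - y)"
      proof -
        have "\<bar>\<gamma> (\<pi> (q x)) - \<gamma> (\<pi> (q y))\<bar> \<le> M * norm (\<pi> (q x) - \<pi> (q y))"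
          using \<gamma>_lip[OF \<pi>K \<pi>K] by simp
        also have "\<dots> \<le> M * norm (x - y)"
          using M(1) order_trans[OF \<pi>_lip q_diff] by (intro mult_left_mono) auto
        finally show ?thesis .
      qed
      ultimately show ?thesis by (simp add: \<Phi>_def dist_norm distrib_right abs_le_iff)
    qed
    show "open \<Omega>" "0 < r" "p \<in> frontier \<Omega>" by (fact op r p)+
    show "x \<in> \<Omega> \<longleftrightarrow> 0 < \<Phi> x" if x: "x \<in> ball p r" for x
    proof -
      have "norm (q p - q x) \<le> r" using q_diff[of p x] x by (simp add: dist_norm)
      then have "q x \<in> K" by (simp add: K_def dist_norm)
      then have "\<pi> (q x) = q x" unfolding \<pi>_def by (rule closest_point_self)
      moreover have "x \<in> \<Omega> \<longleftrightarrow> \<gamma> (q x) < T x $ 3" using region x unfolding q_def by blast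
      ultimately show ?thesis by (simp add: \<Phi>_def)
    qed
  qed
  then show ?thesis by blast
qed

definition good_point :: "(real^3) set \<Rightarrow> (real^3) set \<Rightarrow> real^3 \<Rightarrow> bool" where
  "good_point \<Omega> \<Gamma> x \<longleftrightarrow> (\<exists>\<rho>>0. controlled \<Omega> \<Gamma> (ball x \<rho> \<inter> \<Omega>))"

lemma controlled_compact:
  assumes K: "compact K" and op: "open \<Omega>" and good: "\<And>x. x \<in> K \<Longrightarrow> good_point \<Omega> \<Gamma> x"
  shows "controlled \<Omega> \<Gamma> (K \<inter> \<Omega>)"
proof -
  have "\<forall>x\<in>K. \<exists>\<rho>>0. controlled \<Omega> \<Gamma> (ball x \<rho> \<inter> \<Omega>)" using good by (simp add: good_point_def)
  then obtain \<rho> where \<rho>: "\<And>x. x \<in> K \<Longrightarrow> 0 < \<rho> x \<and> controlled \<Omega> \<Gamma> (ball x (\<rho> x) \<inter> \<Omega>)" by metis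
  have "K \<subseteq> (\<Union>x\<in>K. ball x (\<rho> x))" using \<rho> by force
  then obtain I where I: "I \<subseteq> K" "finite I" "K \<subseteq> (\<Union>x\<in>I. ball x (\<rho> x))"
    using compactE_image[OF K, of K "\<lambda>x. ball x (\<rho> x)"] by blast
  have "controlled \<Omega> \<Gamma> (\<Union>x\<in>I. ball x (\<rho> x) \<inter> \<Omega>)"
    using I \<rho> op by (intro controlled_UN) auto
  then show ?thesis by (rule controlled_mono) (use I in blast)
qed

text \<open>
  Move a small ball around \<open>x\<close> into the ball around \<open>q\<close> on which the bound is known.
\<close>

lemma good_point_nearby:
  assumes op: "open \<Omega>" and \<rho>: "0 < \<rho>" "ball x \<rho> \<subseteq> \<Omega>" and q: "q \<in> ball x (\<rho> / 2)" "good_point \<Omega> \<Gamma> q"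
  shows "good_point \<Omega> \<Gamma> x"
proof -
  obtain \<eta>0 where \<eta>0: "0 < \<eta>0" "controlled \<Omega> \<Gamma> (ball q \<eta>0 \<inter> \<Omega>)" using q(2) by (auto simp: good_point_def)
  define \<eta> where "\<eta> = min \<eta>0 (\<rho> / 4)"
  have \<eta>: "0 < \<eta>" "\<eta> \<le> \<eta>0" "\<eta> \<le> \<rho> / 4" using \<eta>0 \<rho> by (auto simp: \<eta>_def)
  have qx: "norm (q - x) < \<rho> / 2" using q(1) by (simp add: dist_norm norm_minus_commute)
  have dir: "norm (\<zeta> - (q - x)) \<le> \<eta> / 2" if "\<zeta> \<in> cball (q - x) (\<eta> / 2)" for \<zeta>
    using that by (simp add: dist_norm norm_minus_commute)
  have "controlled \<Omega> \<Gamma> (ball x (\<eta> / 2))"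
  proof (rule controlled_translate[OF op, where U = "ball q \<eta>0 \<inter> \<Omega>" and \<xi> = "q - x" and h = "\<eta> / 2"])
    fix y \<zeta> assume y: "y \<in> ball x (\<eta> / 2)" and \<zeta>: "\<zeta> \<in> cball (q - x) (\<eta> / 2)"
    have yx: "norm (y - x) < \<eta> / 2" using y by (simp add: dist_norm norm_minus_commute)
    have n\<zeta>: "norm \<zeta> < \<rho> / 2 + \<eta> / 2" using dir[OF \<zeta>] qx norm_triangle_sub[of \<zeta> "q - x"] by linarith
    have in\<Omega>: "y + s *\<^sub>R \<zeta> \<in> \<Omega>" if "0 \<le> s" "s \<le> 1" for s
    proof -
      have "norm (s *\<^sub>R \<zeta>) \<le> norm \<zeta>" using that by (simp add: mult_left_le_one_le)
      then have "norm (y + s *\<^sub>R \<zeta> - x) < \<rho>"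
        using norm_triangle_ineq[of "y - x" "s *\<^sub>R \<zeta>"] yx n\<zeta> \<eta> \<rho>(1) by (simp add: algebra_simps)
      then show ?thesis using \<rho>(2) by (auto simp: dist_norm norm_minus_commute)
    qed
    then show "y + s *\<^sub>R \<zeta> \<in> \<Omega>" if "0 < s" "s < 1" for s using that by simp
    have "norm (y + \<zeta> - q) < \<eta>0"
      using norm_triangle_ineq[of "y - x" "\<zeta> - (q - x)"] yx dir[OF \<zeta>] \<eta> by (simp add: algebra_simps)
    then show "y + \<zeta> \<in> ball q \<eta>0 \<inter> \<Omega>"
      using in\<Omega>[of 1] by (simp add: dist_norm norm_minus_commute)
  qed (use \<eta> \<eta>0 op in auto)
  then have "controlled \<Omega> \<Gamma> (ball x (\<eta> / 2) \<inter> \<Omega>)" by (rule controlled_mono) auto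
  then show ?thesis using \<eta> unfolding good_point_def by (intro exI[of _ "\<eta> / 2"]) auto
qed

text \<open>
  By the preceding lemma the good points form a set that is both open and closed in \<open>\<Omega>\<close>.
\<close>

lemma good_point_connected:
  assumes op: "open \<Omega>" and con: "connected \<Omega>" and z: "z \<in> \<Omega>" "good_point \<Omega> \<Gamma> z" and x: "x \<in> \<Omega>"
  shows "good_point \<Omega> \<Gamma> x"
proof (rule ccontr)
  assume bad: "\<not> good_point \<Omega> \<Gamma> x"
  let ?A = "{y \<in> \<Omega>. good_point \<Omega> \<Gamma> y}" and ?B = "{y \<in> \<Omega>. \<not> good_point \<Omega> \<Gamma> y}"
  have near: "\<exists>\<rho>>0. \<forall>q\<in>ball y \<rho>. q \<in> \<Omega> \<and> (good_point \<Omega> \<Gamma> q \<longleftrightarrow> good_point \<Omega> \<Gamma> y)" if y: "y \<in> \<Omega>" for y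
  proof -
    obtain \<rho> where \<rho>: "0 < \<rho>" "ball y \<rho> \<subseteq> \<Omega>" using op y openE by blast
    show ?thesis
    proof (intro exI[of _ "\<rho> / 4"] conjI ballI)
      fix q assume q: "q \<in> ball y (\<rho> / 4)"
      then show q\<Omega>: "q \<in> \<Omega>" using \<rho> by auto
      have "ball q (\<rho> / 2) \<subseteq> \<Omega>"
      proof
        fix u assume "u \<in> ball q (\<rho> / 2)"
        then have "dist y u < \<rho>" using q dist_triangle[of y u q] \<rho> by simp
        then show "u \<in> \<Omega>" using \<rho> by auto
      qed
      moreover have "y \<in> ball q (\<rho> / 2 / 2)" using q by (simp add: dist_commute)
      moreover have "q \<in> ball y (\<rho> / 2)" using q \<rho> by simp
      ultimately show "good_point \<Omega> \<Gamma> q \<longleftrightarrow> good_point \<Omega> \<Gamma> y"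
        using good_point_nearby[OF op, of "\<rho> / 2" q y \<Gamma>] good_point_nearby[OF op \<rho>, of q \<Gamma>] \<rho>(1) by auto
    qed (use \<rho> in auto)
  qed
  have "open ?A"
    unfolding open_contains_ball
  proof
    fix y assume "y \<in> ?A"
    with near[of y] show "\<exists>\<rho>>0. ball y \<rho> \<subseteq> ?A" by auto
  qed
  moreover have "open ?B"
    unfolding open_contains_ball
  proof
    fix y assume "y \<in> ?B"
    with near[of y] show "\<exists>\<rho>>0. ball y \<rho> \<subseteq> ?B" by auto
  qed
  ultimately have "?A \<inter> \<Omega> = {} \<or> ?B \<inter> \<Omega> = {}"
    using con by (intro connectedD) auto
  then show False using z x bad by auto
qed

context graph_chart
begin

text \<open>
  From a point \<open>z\<close> slightly above \<open>p\<close>, descend in a direction \<open>- \<eta>\<close> with \<open>\<eta>\<close> close to \<open>e\<close> until \<open>\<Phi>\<close> vanishes.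
  This end point lies on \<open>\<Gamma>\<close>, so the strain along the segment bounds \<open>W z \<bullet> \<eta>\<close>.
\<close>

lemma good_point_above_clamped_boundary:
  assumes \<Gamma>: "frontier \<Omega> \<inter> ball p r \<subseteq> \<Gamma>"
  shows "\<exists>z\<in>\<Omega>. good_point \<Omega> \<Gamma> z"
proof -
  \<comment> \<open>Descents last at most \<open>3 * a \<le> 1\<close> and stay within \<open>ball p (9 * a)\<close>.\<close>
  define a where "a = min (r / 9) (1 / 3)"
  have a: "0 < a" "9 * a \<le> r" "3 * a \<le> 1" using r_pos by (auto simp: a_def)
  define z0 where "z0 = p + a *\<^sub>R e"
  define b where "b = a / (2 * L)"
  have b: "0 < b" "b \<le> a / 2" "L * b = a / 2" using a L1 by (auto simp: b_def field_simps)
  have pz0: "dist p z0 = a" using a norm_e by (simp add: z0_def dist_norm)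
  have \<Phi>z: "a / 2 < \<Phi> z" "\<Phi> z < 3 * a / 2" if "z \<in> ball z0 b" for z
  proof -
    have "\<Phi> z0 = a" by (simp add: z0_def shift \<Phi>_p)
    moreover have "L * dist z0 z < L * b" using that L1 by (intro mult_strict_left_mono) auto
    ultimately show "a / 2 < \<Phi> z" "\<Phi> z < 3 * a / 2" using lip[of z0 z] b(3) by linarith+
  qed
  have pz: "dist p z < 2 * a" if "z \<in> ball z0 b" for z
    using that dist_triangle[of p z z0] pz0 b a by simp
  have sub: "ball z0 b \<subseteq> \<Omega>"
  proof
    fix z assume z: "z \<in> ball z0 b"
    then show "z \<in> \<Omega>" using region[of z] pz[OF z] a \<Phi>z[OF z] by auto
  qed
  have "controlled \<Omega> \<Gamma> (ball z0 b)"
    unfolding controlled_def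
  proof (intro exI[of _ "6 / (1 / (2 * L)) * 4"] conjI ballI)
    show "0 \<le> 6 / (1 / (2 * L)) * 4" using L1 by simp
    fix W assume W: "W \<in> vanishing_fields \<Gamma>"
    then have W1: "Ck_on 1 W UNIV" and W0: "\<And>x. x \<in> \<Gamma> \<Longrightarrow> W x = 0" by (auto simp: vanishing_fields_def)
    note [measurable] = C1_D(4)[OF W1] borel_measurable_strain_density[OF W1 open_\<Omega>]
    let ?F = "strain_density \<Omega> W"
    have "L1_norm lborel (ball z0 b) W \<le>
      ennreal (6 / (1 / (2 * L))) * (ennreal 4 * strain_mass \<Omega> W)"
    proof (rule nn_integral_norm_le_directions[where \<xi>=e])
      fix \<eta> assume \<eta>: "\<eta> \<in> cball e (1 / (2 * L))"
      then have \<eta>': "\<eta> \<in> cball (1 *\<^sub>R e) (1 / (2 * L))" by simp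
      have n\<eta>: "norm \<eta> \<le> 2" using direction_norm[OF _ \<eta>'] by simp
      have "(\<integral>\<^sup>+z\<in>ball z0 b. ennreal \<bar>W z \<bullet> \<eta>\<bar> \<partial>lborel) \<le>
        (\<integral>\<^sup>+z. ennreal 4 * segment_integral ?F z (- \<eta>) \<partial>lborel)"
      proof (rule nn_integral_mono)
        fix z
        show "ennreal \<bar>W z \<bullet> \<eta>\<bar> * indicator (ball z0 b) z \<le>
          ennreal 4 * segment_integral ?F z (- \<eta>)"
        proof (cases "z \<in> ball z0 b")
          case True
          have near: "z + s *\<^sub>R (- \<eta>) \<in> ball p r" if "0 \<le> s" "s \<le> 3 * a" for s
          proof -
            have "s * norm \<eta> \<le> 3 * a * 2" using that n\<eta> a by (intro mult_mono) auto
            then have "norm (s *\<^sub>R (- \<eta>)) \<le> 3 * a * 2" using that by simp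
            then have "dist p (z + s *\<^sub>R (- \<eta>)) < 9 * a"
              using dist_triangle[of p "z + s *\<^sub>R (- \<eta>)" z] pz[OF True] a by (simp add: dist_norm)
            then show ?thesis using a by simp
          qed
          have drop: "\<Phi> (z + t *\<^sub>R (- \<eta>)) + (t - s) / 2 \<le> \<Phi> (z + s *\<^sub>R (- \<eta>))" if "s \<le> t" for s t
            using climb[OF _ \<eta>', of "t - s" "z + t *\<^sub>R (- \<eta>)"] that by (simp add: algebra_simps)
          have "\<exists>s. 0 \<le> s \<and> s \<le> 3 * a \<and> \<Phi> (z + s *\<^sub>R (- \<eta>)) = 0"
          proof (rule IVT2')
            show "\<Phi> (z + (3 * a) *\<^sub>R (- \<eta>)) \<le> 0" using drop[of 0 "3 * a"] \<Phi>z(2)[OF True] a by simp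
            show "0 \<le> \<Phi> (z + 0 *\<^sub>R (- \<eta>))" using \<Phi>z(1)[OF True] a by simp
            show "continuous_on {0..3 * a} (\<lambda>s. \<Phi> (z + s *\<^sub>R (- \<eta>)))"
              by (rule continuous_on_compose2[OF continuous_\<Phi>]) (auto intro!: continuous_intros)
          qed (use a in auto)
          then obtain \<tau> where \<tau>: "0 \<le> \<tau>" "\<tau> \<le> 3 * a" "\<Phi> (z + \<tau> *\<^sub>R (- \<eta>)) = 0" by blast
          have "z + \<tau> *\<^sub>R (- \<eta>) \<in> \<Gamma>" using frontier_iff[OF near[OF \<tau>(1,2)]] \<tau>(3) near[OF \<tau>(1,2)] \<Gamma> by blast
          then have "W (z + \<tau> *\<^sub>R (- \<eta>)) = 0" by (rule W0)
          moreover have "ennreal \<bar>W (z + \<tau> *\<^sub>R (- \<eta>)) \<bullet> (- \<eta>) - W z \<bullet> (- \<eta>)\<bar> \<le>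
            ennreal ((norm (- \<eta>))\<^sup>2) * segment_integral ?F z (- \<eta>)"
          proof (rule segment_bound[OF W1 open_\<Omega>])
            fix s assume s: "0 < s" "s < \<tau>"
            show "z + s *\<^sub>R (- \<eta>) \<in> \<Omega>"
              using region[OF near, of s] drop[of s \<tau>] s \<tau> by auto
          qed (use \<tau> a in auto)
          ultimately have "ennreal \<bar>W z \<bullet> \<eta>\<bar> \<le> ennreal ((norm \<eta>)\<^sup>2) * segment_integral ?F z (- \<eta>)"
            by simp
          also have "\<dots> \<le> ennreal 4 * segment_integral ?F z (- \<eta>)"
            using power_mono[OF n\<eta>, of 2] by (intro mult_right_mono ennreal_leI) auto
          finally show ?thesis using True by simp
        qed simp
      qed
      also have "\<dots> = ennreal 4 * strain_mass \<Omega> W"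
        using nn_integral_segments[of ?F "- \<eta>"] by (subst nn_integral_cmult) (simp_all add: strain_mass_def)
      finally show "(\<integral>\<^sup>+z\<in>ball z0 b. ennreal \<bar>W z \<bullet> \<eta>\<bar> \<partial>lborel) \<le> \<dots>" .
    qed (use L1 in auto)
    also have "\<dots> = ennreal (6 / (1 / (2 * L)) * 4) * strain_mass \<Omega> W"
    proof -
      have "ennreal (6 / (1 / (2 * L)) * 4) = ennreal (6 / (1 / (2 * L))) * ennreal 4"
        using L1 by (intro ennreal_mult) auto
      then show ?thesis by (simp only: mult.assoc)
    qed
    finally show "L1_norm lborel (ball z0 b) W \<le> ennreal (6 / (1 / (2 * L)) * 4) * strain_mass \<Omega> W" .
  qed
  then have "controlled \<Omega> \<Gamma> (ball z0 b \<inter> \<Omega>)" by (rule controlled_mono) auto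
  moreover have "z0 \<in> \<Omega>" using sub b by auto
  ultimately show ?thesis using b unfolding good_point_def by blast
qed

text \<open>
  Moving a neighbourhood of \<open>p\<close> in \<open>\<Omega>\<close> upwards takes it into a compact subset of \<open>\<Omega>\<close>.
\<close>

lemma good_point_frontier:
  assumes good: "\<And>x. x \<in> \<Omega> \<Longrightarrow> good_point \<Omega> \<Gamma> x"
  shows "good_point \<Omega> \<Gamma> p"
proof -
  define a where "a = r / 8"
  have a: "0 < a" "8 * a = r" using r_pos by (auto simp: a_def)
  let ?K = "{x. a / 2 \<le> \<Phi> x} \<inter> cball p (3 * a)"
  have "closed {x. a / 2 \<le> \<Phi> x}" using continuous_\<Phi> by (intro closed_Collect_le) auto
  then have K: "compact ?K" by (intro closed_Int_compact) auto
  have K\<Omega>: "?K \<subseteq> \<Omega>"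
  proof
    fix x assume "x \<in> ?K"
    then show "x \<in> \<Omega>" using region[of x] a by auto
  qed
  have "controlled \<Omega> \<Gamma> (?K \<inter> \<Omega>)"
    using K\<Omega> good by (intro controlled_compact[OF K open_\<Omega>]) blast
  then have cK: "controlled \<Omega> \<Gamma> ?K" by (rule controlled_mono) (use K\<Omega> in blast)
  have "controlled \<Omega> \<Gamma> (ball p a \<inter> \<Omega>)"
  proof (rule controlled_translate[OF open_\<Omega> _ _ cK, where \<xi> = "a *\<^sub>R e" and h = "a / (2 * L)"])
    show "?K \<in> sets borel" using K by (simp add: borel_compact)
    show "ball p a \<inter> \<Omega> \<in> sets borel" using open_\<Omega> by auto
    show "0 < a / (2 * L)" using a L1 by simp
    fix x \<eta> assume x: "x \<in> ball p a \<inter> \<Omega>" and \<eta>: "\<eta> \<in> cball (a *\<^sub>R e) (a / (2 * L))"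
    have n\<eta>: "norm \<eta> \<le> 2 * a" by (rule direction_norm[OF a(1) \<eta>])
    have \<Phi>x: "0 < \<Phi> x" using x region[of x] a by auto
    have near: "dist p (x + s *\<^sub>R \<eta>) < 3 * a" if "0 \<le> s" "s \<le> 1" for s
    proof -
      have "norm (s *\<^sub>R \<eta>) \<le> norm \<eta>" using that by (simp add: mult_left_le_one_le)
      then show ?thesis using dist_triangle[of p "x + s *\<^sub>R \<eta>" x] x n\<eta> by (simp add: dist_norm)
    qed
    have up: "\<Phi> x + s * (a / 2) \<le> \<Phi> (x + s *\<^sub>R \<eta>)" if "0 \<le> s" for s
      by (rule climb[OF a(1) \<eta> that])
    show "x + \<eta> \<in> ?K" using near[of 1] up[of 1] \<Phi>x by simp
    fix s :: real assume s: "0 < s" "s < 1"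
    have "0 \<le> s * (a / 2)" using s a by simp
    then have "0 < \<Phi> (x + s *\<^sub>R \<eta>)" using up[of s] \<Phi>x s by linarith
    then show "x + s *\<^sub>R \<eta> \<in> \<Omega>"
      using region[of "x + s *\<^sub>R \<eta>"] near[of s] s a by auto
  qed
  then show ?thesis using a unfolding good_point_def by blast
qed

end

text \<open>
  The bound starts near a point of \<open>\<Gamma>\<close>, spreads over \<open>\<Omega>\<close> by connectedness, reaches every boundary point, and
  becomes uniform by compactness of the closure.
\<close>

theorem korn_poincare_L1:
  assumes op: "open \<Omega>" and bdd: "bounded \<Omega>" and con: "connected \<Omega>" and C1: "C1_boundary \<Omega>"
    and \<Gamma>: "\<Gamma> \<noteq> {}" "openin (top_of_set (frontier \<Omega>)) \<Gamma>"
  shows "controlled \<Omega> \<Gamma> \<Omega>"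
proof -
  obtain p where p: "p \<in> \<Gamma>" using \<Gamma>(1) by blast
  then have pf: "p \<in> frontier \<Omega>" using \<Gamma>(2) openin_imp_subset by blast
  obtain e L \<Phi> r where ch: "graph_chart e L \<Phi> \<Omega> p r" using graph_chart_exists[OF C1 op pf] by blast
  obtain \<delta> where \<delta>: "0 < \<delta>" "frontier \<Omega> \<inter> ball p \<delta> \<subseteq> \<Gamma>"
    using \<Gamma>(2) p unfolding openin_contains_ball by blast
  have "graph_chart e L \<Phi> \<Omega> p (min r \<delta>)"
    using ch \<delta>(1) by (auto simp: graph_chart_def graph_chart_axioms_def)
  then interpret graph_chart e L \<Phi> \<Omega> p "min r \<delta>" .
  have "frontier \<Omega> \<inter> ball p (min r \<delta>) \<subseteq> \<Gamma>" using \<delta>(2) by auto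
  then obtain z where z: "z \<in> \<Omega>" "good_point \<Omega> \<Gamma> z"
    using good_point_above_clamped_boundary by blast
  have int: "good_point \<Omega> \<Gamma> x" if "x \<in> \<Omega>" for x
    by (rule good_point_connected[OF op con z that])
  have "good_point \<Omega> \<Gamma> x" if "x \<in> closure \<Omega>" for x
  proof (cases "x \<in> \<Omega>")
    case False
    then have "x \<in> frontier \<Omega>" using that op by (simp add: frontier_def interior_open)
    then obtain e' L' \<Phi>' r' where ch': "graph_chart e' L' \<Phi>' \<Omega> x r'"
      using graph_chart_exists[OF C1 op] by blast
    show ?thesis by (rule graph_chart.good_point_frontier[OF ch' int])
  qed (rule int)
  then have "controlled \<Omega> \<Gamma> (closure \<Omega> \<inter> \<Omega>)"
    using bdd op by (intro controlled_compact) auto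
  then show ?thesis by (rule controlled_mono) (use closure_subset in blast)
qed

section \<open>The trace inequality\<close>

context graph_chart
begin

text \<open>
  Along a direction from the cone \<open>\<Phi>\<close> is strictly monotone with slope at least \<open>a / 2\<close>, so the times at which
  its value lies between \<open>0\<close> and \<open>h\<close> form a set of diameter at most \<open>2 * h / a\<close>.
\<close>

lemma time_in_layer_le:
  assumes a: "0 < a" and \<eta>: "\<eta> \<in> cball (a *\<^sub>R e) (a / (2 * L))" and h: "0 < h"
  shows "(\<integral>\<^sup>+s\<in>{0..1}. indicator ({x. 0 < \<Phi> x \<and> \<Phi> x < h} \<inter> B) (z + s *\<^sub>R (- \<eta>)) \<partial>lborel) \<le> ennreal (4 * h / a)"
proof -
  let ?S = "{s. 0 < \<Phi> (z + s *\<^sub>R (- \<eta>)) \<and> \<Phi> (z + s *\<^sub>R (- \<eta>)) < h}"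
  have apart: "t - s < 2 * h / a" if "s \<in> ?S" "t \<in> ?S" "s \<le> t" for s t
  proof -
    have "\<Phi> (z + t *\<^sub>R (- \<eta>)) + (t - s) * (a / 2) \<le> \<Phi> (z + s *\<^sub>R (- \<eta>))"
      using climb[OF a \<eta>, of "t - s" "z + t *\<^sub>R (- \<eta>)"] that by (simp add: algebra_simps)
    then have "(t - s) * (a / 2) < h" using that by simp
    then show ?thesis using a by (simp add: field_simps)
  qed
  show ?thesis
  proof (cases "?S = {}")
    case True
    then have "indicator ({x. 0 < \<Phi> x \<and> \<Phi> x < h} \<inter> B) (z + s *\<^sub>R (- \<eta>)) = (0::ennreal)" for s
      by (auto simp: indicator_def)
    then show ?thesis by simp
  next
    case False
    then obtain t where t: "t \<in> ?S" by blast
    have sub: "s \<in> {t - 2 * h / a..t + 2 * h / a}" if "s \<in> ?S" for s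
      using apart[OF that t] apart[OF t that] h a by (cases "s \<le> t") auto
    have "(\<integral>\<^sup>+s\<in>{0..1}. indicator ({x. 0 < \<Phi> x \<and> \<Phi> x < h} \<inter> B) (z + s *\<^sub>R (- \<eta>)) \<partial>lborel) \<le>
      (\<integral>\<^sup>+s. indicator {t - 2 * h / a..t + 2 * h / a} s \<partial>lborel)"
    proof (rule nn_integral_mono)
      fix s
      show "indicator ({x. 0 < \<Phi> x \<and> \<Phi> x < h} \<inter> B) (z + s *\<^sub>R (- \<eta>)) * indicator {0..1} s
        \<le> (indicator {t - 2 * h / a..t + 2 * h / a} s :: ennreal)"
      proof (cases "s \<in> ?S")
        case True
        from sub[OF this] show ?thesis by (auto simp: indicator_def)
      qed (auto simp: indicator_def)
    qed
    also have "\<dots> = ennreal (4 * h / a)" using h a by simp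
    finally show ?thesis .
  qed
qed

text \<open>
  For a point \<open>z\<close> of the layer, \<open>W z \<bullet> \<eta>\<close> is bounded by an average of \<open>|W|\<close> and \<open>|strain W|\<close> over the segment
  from \<open>z\<close> to \<open>z + \<eta>\<close>. Integrating over the layer and exchanging the integrals, each point of \<open>\<Omega>\<close> is counted
  with the length of time that the line through it spends in the layer, which is of order \<open>h\<close>.
\<close>

lemma surface_trace:
  "\<exists>\<rho>>0. \<exists>C\<ge>0. \<forall>W. Ck_on 1 W UNIV \<longrightarrow>
    L1_norm hausdorff2 (frontier \<Omega> \<inter> ball p \<rho>) W \<le>
    ennreal C * (L1_norm lborel \<Omega> W + strain_mass \<Omega> W)"
proof -
  define a where "a = r / 8"
  have a: "0 < a" "8 * a = r" using r_pos by (auto simp: a_def)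
  let ?A = "\<lambda>h. {x. 0 < \<Phi> x \<and> \<Phi> x < h} \<inter> ball p (2 * a)"
  have fr: "frontier \<Omega> \<inter> ball p a = {x. \<Phi> x = 0} \<inter> ball p a" using frontier_iff a by auto
  define c where "c = 6 / (a / (2 * L))"
  define c1 where "c1 = 2 * a + 4 * a\<^sup>2"
  have c: "0 < c" "0 < c1" using a L1 by (auto simp: c_def c1_def add_pos_pos)
  define C where "C = layer_const * (c * (4 / a) * c1)"
  have lc: "0 < layer_const" using L1 by (simp add: layer_const_def)
  have C: "0 < C" unfolding C_def using c a lc by simp
  show ?thesis
  proof (rule exI[of _ a], rule conjI[OF a(1)], rule exI[of _ C], intro conjI allI impI)
    fix W :: "real^3 \<Rightarrow> real^3" assume W: "Ck_on 1 W UNIV"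
    note [measurable] = C1_D(4)[OF W] borel_measurable_strain_density[OF W open_\<Omega>]
    have [measurable]: "\<Omega> \<in> sets borel" using open_\<Omega> by simp
    have A[measurable]: "?A h \<in> sets borel" for h using open_layer by auto
    define T where "T = L1_norm lborel \<Omega> W + strain_mass \<Omega> W"
    let ?F = "strain_density \<Omega> W"
    define K where "K x = ennreal (2 * a) * (ennreal (norm (W x)) * indicator \<Omega> x) + ennreal (4 * a\<^sup>2) * ?F x" for x
    have K[measurable]: "K \<in> borel_measurable borel" unfolding K_def[abs_def] by measurable
    have intK: "(\<integral>\<^sup>+x. K x \<partial>lborel) \<le> ennreal c1 * T"
    proof -
      have "(\<integral>\<^sup>+x. K x \<partial>lborel) = ennreal (2 * a) * L1_norm lborel \<Omega> W + ennreal (4 * a\<^sup>2) * strain_mass \<Omega> W"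
        unfolding K_def by (subst nn_integral_add) (simp_all add: nn_integral_cmult strain_mass_def)
      also have "\<dots> \<le> ennreal c1 * L1_norm lborel \<Omega> W + ennreal c1 * strain_mass \<Omega> W"
        using a by (intro add_mono mult_right_mono ennreal_leI) (auto simp: c1_def)
      finally show ?thesis by (simp add: T_def distrib_left)
    qed
    have layer: "L1_norm lborel (?A h) W \<le> ennreal (h * (c * (4 / a) * c1)) * T" if h: "0 < h" for h
    proof -
      have "L1_norm lborel (?A h) W \<le> ennreal c * (ennreal (4 * h / a) * (ennreal c1 * T))"
        unfolding c_def
      proof (rule nn_integral_norm_le_directions[where \<xi> = "a *\<^sub>R e"])
        fix \<eta> assume \<eta>: "\<eta> \<in> cball (a *\<^sub>R e) (a / (2 * L))"
        have n\<eta>: "norm \<eta> \<le> 2 * a" by (rule direction_norm[OF a(1) \<eta>])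
        have in\<Omega>: "z + s *\<^sub>R \<eta> \<in> \<Omega>" if z: "z \<in> ?A h" and s: "0 \<le> s" "s \<le> 1" for z s
        proof -
          have "norm (s *\<^sub>R \<eta>) \<le> norm \<eta>" using s by (simp add: mult_left_le_one_le)
          then have "dist p (z + s *\<^sub>R \<eta>) < r"
            using dist_triangle[of p "z + s *\<^sub>R \<eta>" z] z n\<eta> a by (simp add: dist_norm)
          moreover have "0 \<le> s * (a / 2)" using s a by simp
          then have "0 < \<Phi> (z + s *\<^sub>R \<eta>)" using climb[OF a(1) \<eta> s(1), of z] z by simp
          ultimately show ?thesis using region[of "z + s *\<^sub>R \<eta>"] by simp
        qed
        have point: "ennreal \<bar>W z \<bullet> \<eta>\<bar> \<le> segment_integral K z \<eta>" if z: "z \<in> ?A h" for z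
        proof -
          define I where "I = segment_integral ?F z \<eta>"
          have "ennreal \<bar>W z \<bullet> \<eta>\<bar> = (\<integral>\<^sup>+s\<in>{0..1::real}. ennreal \<bar>W z \<bullet> \<eta>\<bar> \<partial>lborel)"
            by (simp add: nn_integral_cmult_indicator)
          also have "\<dots> \<le> (\<integral>\<^sup>+s. ennreal (2 * a) * (ennreal (norm (W (z + s *\<^sub>R \<eta>))) * indicator \<Omega> (z + s *\<^sub>R \<eta>)) * indicator {0..1} s
              + ennreal (4 * a\<^sup>2) * I * indicator {0..1::real} s \<partial>lborel)"
          proof (rule nn_integral_mono)
            fix s :: real
            show "ennreal \<bar>W z \<bullet> \<eta>\<bar> * indicator {0..1} s \<le>
              ennreal (2 * a) * (ennreal (norm (W (z + s *\<^sub>R \<eta>))) * indicator \<Omega> (z + s *\<^sub>R \<eta>)) * indicator {0..1} s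
              + ennreal (4 * a\<^sup>2) * I * indicator {0..1::real} s"
            proof (cases "s \<in> {0..1}")
              case True
              let ?w = "W (z + s *\<^sub>R \<eta>)"
              have "\<bar>?w \<bullet> \<eta>\<bar> \<le> 2 * a * norm ?w"
                using Cauchy_Schwarz_ineq2[of ?w \<eta>] mult_left_mono[OF n\<eta>, of "norm ?w"] by (simp add: mult.commute)
              then have "\<bar>W z \<bullet> \<eta>\<bar> \<le> 2 * a * norm ?w + \<bar>?w \<bullet> \<eta> - W z \<bullet> \<eta>\<bar>" by linarith
              then have "ennreal \<bar>W z \<bullet> \<eta>\<bar> \<le> ennreal (2 * a * norm ?w + \<bar>?w \<bullet> \<eta> - W z \<bullet> \<eta>\<bar>)"
                by (rule ennreal_leI)
              also have "\<dots> = ennreal (2 * a) * ennreal (norm ?w) + ennreal \<bar>?w \<bullet> \<eta> - W z \<bullet> \<eta>\<bar>"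
                using a by (simp add: ennreal_plus ennreal_mult)
              also have "ennreal \<bar>?w \<bullet> \<eta> - W z \<bullet> \<eta>\<bar> \<le> ennreal ((norm \<eta>)\<^sup>2) * I"
                unfolding I_def using True in\<Omega>[OF z] by (intro segment_bound[OF W open_\<Omega>]) auto
              also have "\<dots> \<le> ennreal (4 * a\<^sup>2) * I"
                using power_mono[OF n\<eta>, of 2] by (intro mult_right_mono ennreal_leI) (auto simp: power_mult_distrib)
              finally show ?thesis using True in\<Omega>[OF z, of s] by (simp add: add_left_mono)
            qed simp
          qed
          also have "\<dots> = (\<integral>\<^sup>+s. ennreal (2 * a) * (ennreal (norm (W (z + s *\<^sub>R \<eta>))) * indicator \<Omega> (z + s *\<^sub>R \<eta>)) * indicator {0..1::real} s \<partial>lborel)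
              + ennreal (4 * a\<^sup>2) * I"
            by (subst nn_integral_add) (simp_all add: nn_integral_cmult_indicator)
          also have "ennreal (4 * a\<^sup>2) * I = (\<integral>\<^sup>+s. ennreal (4 * a\<^sup>2) * (?F (z + s *\<^sub>R \<eta>) * indicator {0..1} s) \<partial>lborel)"
            unfolding I_def by (rule nn_integral_cmult[symmetric]) measurable
          also have "(\<integral>\<^sup>+s. ennreal (2 * a) * (ennreal (norm (W (z + s *\<^sub>R \<eta>))) * indicator \<Omega> (z + s *\<^sub>R \<eta>)) * indicator {0..1::real} s \<partial>lborel)
              + (\<integral>\<^sup>+s. ennreal (4 * a\<^sup>2) * (?F (z + s *\<^sub>R \<eta>) * indicator {0..1} s) \<partial>lborel)
            = segment_integral K z \<eta>"
            by (subst nn_integral_add[symmetric]) (simp_all add: K_def distrib_right mult.assoc)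
          finally show ?thesis .
        qed
        have "(\<integral>\<^sup>+z\<in>?A h. ennreal \<bar>W z \<bullet> \<eta>\<bar> \<partial>lborel) \<le>
            (\<integral>\<^sup>+z. (\<integral>\<^sup>+s. K (z + s *\<^sub>R \<eta>) * indicator {0..1::real} s * indicator (?A h) z \<partial>lborel) \<partial>lborel)"
        proof (rule nn_integral_mono)
          fix z
          show "ennreal \<bar>W z \<bullet> \<eta>\<bar> * indicator (?A h) z \<le> (\<integral>\<^sup>+s. K (z + s *\<^sub>R \<eta>) * indicator {0..1::real} s * indicator (?A h) z \<partial>lborel)"
            using point[of z] by (cases "z \<in> ?A h") auto
        qed
        also have "\<dots> = (\<integral>\<^sup>+s. (\<integral>\<^sup>+z. K (z + s *\<^sub>R \<eta>) * indicator {0..1::real} s * indicator (?A h) z \<partial>lborel) \<partial>lborel)"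
          by (rule lborel_pair.Fubini'[symmetric]) measurable
        also have "\<dots> = (\<integral>\<^sup>+s. (\<integral>\<^sup>+z. K z * indicator {0..1::real} s * indicator (?A h) (z + s *\<^sub>R (- \<eta>)) \<partial>lborel) \<partial>lborel)"
        proof (rule nn_integral_cong)
          fix s :: real
          show "(\<integral>\<^sup>+z. K (z + s *\<^sub>R \<eta>) * indicator {0..1::real} s * indicator (?A h) z \<partial>lborel) =
            (\<integral>\<^sup>+z. K z * indicator {0..1::real} s * indicator (?A h) (z + s *\<^sub>R (- \<eta>)) \<partial>lborel)"
            using nn_integral_lborel_shift[of "\<lambda>z. K z * indicator {0..1::real} s * indicator (?A h) (z + s *\<^sub>R (- \<eta>))" "s *\<^sub>R \<eta>"]
            by simp
        qed
        also have "\<dots> = (\<integral>\<^sup>+z. (\<integral>\<^sup>+s. K z * indicator {0..1::real} s * indicator (?A h) (z + s *\<^sub>R (- \<eta>)) \<partial>lborel) \<partial>lborel)"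
          by (rule lborel_pair.Fubini') measurable
        also have "\<dots> = (\<integral>\<^sup>+z. K z * (\<integral>\<^sup>+s\<in>{0..1}. indicator (?A h) (z + s *\<^sub>R (- \<eta>)) \<partial>lborel) \<partial>lborel)"
        proof (rule nn_integral_cong)
          fix z :: "real^3"
          show "(\<integral>\<^sup>+s. K z * indicator {0..1::real} s * indicator (?A h) (z + s *\<^sub>R (- \<eta>)) \<partial>lborel) =
            K z * (\<integral>\<^sup>+s\<in>{0..1}. indicator (?A h) (z + s *\<^sub>R (- \<eta>)) \<partial>lborel)"
          proof (subst nn_integral_cmult[symmetric])
            show "(\<lambda>s. indicator (?A h) (z + s *\<^sub>R (- \<eta>)) * indicator {0..1::real} s :: ennreal) \<in> borel_measurable lborel"
              by (intro borel_measurable_times_ennreal measurable_compose[OF _ borel_measurable_indicator[OF A]]) auto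
          qed (simp add: mult_ac)
        qed
        also have "\<dots> \<le> (\<integral>\<^sup>+z. K z * ennreal (4 * h / a) \<partial>lborel)"
          by (intro nn_integral_mono mult_left_mono time_in_layer_le[OF a(1) \<eta> h]) auto
        also have "\<dots> = (\<integral>\<^sup>+z. K z \<partial>lborel) * ennreal (4 * h / a)" by (rule nn_integral_multc) measurable
        also have "\<dots> \<le> ennreal c1 * T * ennreal (4 * h / a)" by (intro mult_right_mono intK) auto
        finally show "(\<integral>\<^sup>+z\<in>?A h. ennreal \<bar>W z \<bullet> \<eta>\<bar> \<partial>lborel) \<le> ennreal (4 * h / a) * (ennreal c1 * T)"
          by (simp add: mult.commute)
      qed (use a L1 A in auto)
      also have "\<dots> = ennreal (h * (c * (4 / a) * c1)) * T"
      proof -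
        have "ennreal (h * (c * (4 / a) * c1)) = ennreal (c * ((4 * h / a) * c1))" by (simp add: mult_ac)
        also have "\<dots> = ennreal c * ennreal ((4 * h / a) * c1)"
          using c a h by (intro ennreal_mult) auto
        also have "ennreal ((4 * h / a) * c1) = ennreal (4 * h / a) * ennreal c1"
          using c a h by (intro ennreal_mult) auto
        finally show ?thesis by (simp only: mult.assoc)
      qed
      finally show ?thesis .
    qed
    show "L1_norm hausdorff2 (frontier \<Omega> \<inter> ball p a) W \<le>
        ennreal C * (L1_norm lborel \<Omega> W + strain_mass \<Omega> W)"
    proof (cases "T = \<infinity>")
      case True
      then show ?thesis using C unfolding T_def[symmetric] by (simp add: ennreal_mult_top)
    next
      case False
      then obtain T' where T': "0 \<le> T'" "T = ennreal T'" by (cases T) auto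
      have "L1_norm hausdorff2 ({x. \<Phi> x = 0} \<inter> ball p a) W \<le>
          ennreal (layer_const * ((c * (4 / a) * c1) * T'))"
      proof (rule surface_integral_le_layer[OF _ _ a(1), where ?h0.0 = 1])
        show "continuous_on UNIV (\<lambda>x. norm (W x))" by (intro continuous_intros C1_D(3)[OF W])
        show "0 \<le> (c * (4 / a) * c1) * T'" using c a T' by simp
        fix h :: real assume h: "0 < h"
        show "L1_norm lborel (?A h) W \<le> ennreal (h * ((c * (4 / a) * c1) * T'))"
          using layer[OF h] c a h T' by (simp add: ennreal_mult[symmetric] mult.assoc)
      qed auto
      also have "\<dots> = ennreal C * T"
        using C T' by (simp add: C_def ennreal_mult[symmetric] mult.assoc)
      finally show ?thesis unfolding fr T_def .
    qed
  qed (use a C in auto)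
qed

end

theorem trace_inequality_L1:
  assumes op: "open \<Omega>" and bdd: "bounded \<Omega>" and C1: "C1_boundary \<Omega>"
  shows "\<exists>C\<ge>0. \<forall>W. Ck_on 1 W UNIV \<longrightarrow>
    L1_norm hausdorff2 (frontier \<Omega>) W \<le>
    ennreal C * (L1_norm lborel \<Omega> W + strain_mass \<Omega> W)"
proof -
  let ?T = "\<lambda>W. L1_norm lborel \<Omega> W + strain_mass \<Omega> W"
  let ?P = "\<lambda>p \<rho> C. 0 < \<rho> \<and> 0 \<le> C \<and> (\<forall>W. Ck_on 1 W UNIV \<longrightarrow>
    L1_norm hausdorff2 (frontier \<Omega> \<inter> ball p \<rho>) W \<le> ennreal C * ?T W)"
  have "\<forall>p\<in>frontier \<Omega>. \<exists>\<rho>C. ?P p (fst \<rho>C) (snd \<rho>C)"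
  proof
    fix p assume p: "p \<in> frontier \<Omega>"
    obtain e L \<Phi> r where "graph_chart e L \<Phi> \<Omega> p r" using graph_chart_exists[OF C1 op p] by blast
    from graph_chart.surface_trace[OF this] obtain \<rho> C where "?P p \<rho> C" by blast
    then show "\<exists>\<rho>C. ?P p (fst \<rho>C) (snd \<rho>C)" by (intro exI[of _ "(\<rho>, C)"]) simp
  qed
  \<comment> \<open>\<open>g p\<close> pairs the radius with the constant at \<open>p\<close>.\<close>
  from bchoice[OF this] obtain g where g: "\<forall>p\<in>frontier \<Omega>. ?P p (fst (g p)) (snd (g p))" ..
  have "frontier \<Omega> \<subseteq> (\<Union>p\<in>frontier \<Omega>. ball p (fst (g p)))" using g by force
  then obtain I where I: "I \<subseteq> frontier \<Omega>" "finite I" "frontier \<Omega> \<subseteq> (\<Union>p\<in>I. ball p (fst (g p)))"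
    using compactE_image[OF compact_frontier_bounded[OF bdd], of "frontier \<Omega>" "\<lambda>p. ball p (fst (g p))"] by blast
  show ?thesis
  proof (intro exI[of _ "\<Sum>p\<in>I. snd (g p)"] conjI allI impI)
    show "0 \<le> (\<Sum>p\<in>I. snd (g p))" using g I by (intro sum_nonneg) auto
    fix W :: "real^3 \<Rightarrow> real^3" assume W: "Ck_on 1 W UNIV"
    note [measurable] = C1_D(4)[OF W]
    have [measurable]: "frontier \<Omega> \<in> sets borel" by (simp add: borel_closed)
    have [measurable]: "frontier \<Omega> \<inter> ball p \<rho> \<in> sets borel" for p \<rho> by (simp add: borel_closed)
    have "L1_norm hausdorff2 (frontier \<Omega>) W \<le>
      (\<integral>\<^sup>+x. (\<Sum>p\<in>I. ennreal (norm (W x)) * indicator (frontier \<Omega> \<inter> ball p (fst (g p))) x) \<partial>hausdorff2)"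
    proof (rule nn_integral_mono)
      fix x
      show "ennreal (norm (W x)) * indicator (frontier \<Omega>) x \<le>
        (\<Sum>p\<in>I. ennreal (norm (W x)) * indicator (frontier \<Omega> \<inter> ball p (fst (g p))) x)"
      proof (cases "x \<in> frontier \<Omega>")
        case True
        then obtain p where p: "p \<in> I" "x \<in> ball p (fst (g p))" using I(3) by blast
        then have "ennreal (norm (W x)) * indicator (frontier \<Omega>) x =
          ennreal (norm (W x)) * indicator (frontier \<Omega> \<inter> ball p (fst (g p))) x" using True by simp
        also have "\<dots> \<le> (\<Sum>p\<in>I. ennreal (norm (W x)) * indicator (frontier \<Omega> \<inter> ball p (fst (g p))) x)"
          using p I(2) by (intro member_le_sum) auto
        finally show ?thesis .
      qed simp
    qed
    also have "\<dots> = (\<Sum>p\<in>I. \<integral>\<^sup>+x\<in>frontier \<Omega> \<inter> ball p (fst (g p)). ennreal (norm (W x)) \<partial>hausdorff2)"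
      by (rule nn_integral_sum) measurable
    also have "\<dots> \<le> (\<Sum>p\<in>I. ennreal (snd (g p)) * ?T W)"
      using g I W by (intro sum_mono) blast
    also have "\<dots> = ennreal (\<Sum>p\<in>I. snd (g p)) * ?T W"
      using g I by (subst sum_ennreal[symmetric]) (auto simp: sum_distrib_right)
    finally show "L1_norm hausdorff2 (frontier \<Omega>) W \<le> ennreal (\<Sum>p\<in>I. snd (g p)) * ?T W" .
  qed
qed

theorem trace_le_strain_L1:
  assumes op: "open \<Omega>" and bdd: "bounded \<Omega>" and con: "connected \<Omega>" and C1: "C1_boundary \<Omega>"
    and \<Gamma>: "\<Gamma> \<noteq> {}" "openin (top_of_set (frontier \<Omega>)) \<Gamma>"
  shows "\<exists>C\<ge>0. \<forall>W\<in>vanishing_fields \<Gamma>.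
    L1_norm hausdorff2 (frontier \<Omega>) W \<le> ennreal C * strain_mass \<Omega> W"
proof -
  obtain C where C: "0 \<le> C" "\<forall>W\<in>vanishing_fields \<Gamma>.
     L1_norm lborel \<Omega> W \<le> ennreal C * strain_mass \<Omega> W"
    using korn_poincare_L1[OF assms] unfolding controlled_def by auto
  obtain D where D: "0 \<le> D" "\<forall>W. Ck_on 1 W UNIV \<longrightarrow>
    L1_norm hausdorff2 (frontier \<Omega>) W \<le>
    ennreal D * (L1_norm lborel \<Omega> W + strain_mass \<Omega> W)"
    using trace_inequality_L1[OF op bdd C1] by auto
  show ?thesis
  proof (intro exI[of _ "D * (C + 1)"] conjI ballI)
    fix W assume W: "W \<in> vanishing_fields \<Gamma>"
    then have "L1_norm hausdorff2 (frontier \<Omega>) W \<le>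
      ennreal D * (L1_norm lborel \<Omega> W + strain_mass \<Omega> W)"
      using D(2) by (auto simp: vanishing_fields_def)
    also have "\<dots> \<le> ennreal D * (ennreal C * strain_mass \<Omega> W + strain_mass \<Omega> W)"
      using C(2) W by (intro mult_left_mono add_right_mono) auto
    also have "\<dots> = ennreal (D * (C + 1)) * strain_mass \<Omega> W"
    proof -
      have "ennreal (D * (C + 1)) = ennreal D * (ennreal C + 1)"
        using C(1) D(1) by (simp add: ennreal_mult ennreal_plus del: ennreal_plus[symmetric])
      then show ?thesis by (simp add: distrib_right mult.assoc)
    qed
    finally show "L1_norm hausdorff2 (frontier \<Omega>) W \<le> ennreal (D * (C + 1)) * strain_mass \<Omega> W" .
  qed (use C D in auto)
qed

section \<open>Smooth bump fields\<close>

definition smooth :: "('a::real_inner \<Rightarrow> 'b::real_normed_vector) \<Rightarrow> bool" where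
  "smooth f \<longleftrightarrow> (\<forall>k. Ck_on k f UNIV)"

lemma Ck_on_Suc_if_has_derivative:
  assumes "\<And>x. (f has_derivative f' x) (at x)" "\<And>v. Ck_on k (\<lambda>x. f' x v) UNIV"
  shows "Ck_on (Suc k) f UNIV"
proof -
  have "frechet_derivative f (at x) = f' x" for x
    using frechet_derivative_at[OF assms(1)] by simp
  then show ?thesis using assms by (auto simp: differentiable_def)
qed

lemma smooth_has_derivative:
  "smooth f \<Longrightarrow> (f has_derivative frechet_derivative f (at x)) (at x)"
  using frechet_derivative_works unfolding smooth_def by (metis Ck_on.simps(2) UNIV_I)

lemma smooth_continuous: "smooth f \<Longrightarrow> continuous_on UNIV f"
  unfolding smooth_def by (metis Ck_on.simps(1))

lemma smooth_derivative: "smooth f \<Longrightarrow> smooth (\<lambda>x. frechet_derivative f (at x) v)"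
  unfolding smooth_def by (metis Ck_on.simps(2))

lemma Ck_on_add: "Ck_on k f UNIV \<Longrightarrow> Ck_on k g UNIV \<Longrightarrow> Ck_on k (\<lambda>x. f x + g x) UNIV"
proof (induction k arbitrary: f g)
  case 0
  then show ?case by (simp add: continuous_on_add)
next
  case (Suc k)
  show ?case
  proof (rule Ck_on_Suc_if_has_derivative)
    show "((\<lambda>x. f x + g x) has_derivative (\<lambda>v. frechet_derivative f (at x) v + frechet_derivative g (at x) v)) (at x)" for x
      using Suc.prems frechet_derivative_works by (intro has_derivative_add) auto
  qed (use Suc in auto)
qed

lemma Ck_on_scaleR: "smooth f \<Longrightarrow> Ck_on k (\<lambda>x. c *\<^sub>R f x) UNIV"
proof (induction k arbitrary: f)
  case 0
  then show ?case by (simp add: continuous_on_scaleR smooth_continuous)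
next
  case (Suc k)
  show ?case
  proof (rule Ck_on_Suc_if_has_derivative)
    show "((\<lambda>x. c *\<^sub>R f x) has_derivative (\<lambda>v. c *\<^sub>R frechet_derivative f (at x) v)) (at x)" for x
      by (intro has_derivative_scaleR_right smooth_has_derivative Suc.prems)
    show "Ck_on k (\<lambda>x. c *\<^sub>R frechet_derivative f (at x) v) UNIV" for v
      by (intro Suc.IH smooth_derivative Suc.prems)
  qed
qed

lemma smooth_scaleR: "smooth f \<Longrightarrow> smooth (\<lambda>x. c *\<^sub>R f x)"
  by (simp add: smooth_def[of "\<lambda>x. c *\<^sub>R f x"] Ck_on_scaleR)

lemma smooth_const: "smooth (\<lambda>x::'a::real_inner. c :: 'b::real_normed_vector)"
proof -
  have "Ck_on k (\<lambda>x::'a. c) UNIV" for k and c :: 'b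
  proof (induction k arbitrary: c)
    case (Suc k)
    show ?case by (rule Ck_on_Suc_if_has_derivative[OF has_derivative_const]) (rule Suc.IH)
  qed simp
  then show ?thesis by (simp add: smooth_def)
qed

lemma Ck_on_affine_times:
  "smooth f \<Longrightarrow> Ck_on k (\<lambda>x. ((x - a) \<bullet> c) *\<^sub>R f x) UNIV"
proof (induction k arbitrary: f)
  case 0
  then show ?case by (simp add: smooth_continuous continuous_on_scaleR continuous_on_inner continuous_on_diff)
next
  case (Suc k)
  show ?case
  proof (rule Ck_on_Suc_if_has_derivative)
    show "((\<lambda>x. ((x - a) \<bullet> c) *\<^sub>R f x) has_derivative
      (\<lambda>v. ((x - a) \<bullet> c) *\<^sub>R frechet_derivative f (at x) v + (v \<bullet> c) *\<^sub>R f x)) (at x)" for x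
      by (auto intro!: derivative_eq_intros smooth_has_derivative[OF Suc.prems])
    show "Ck_on k (\<lambda>x. ((x - a) \<bullet> c) *\<^sub>R frechet_derivative f (at x) v + (v \<bullet> c) *\<^sub>R f x) UNIV" for v
      by (intro Ck_on_add Suc.IH smooth_derivative Suc.prems Ck_on_scaleR)
  qed
qed

lemma smooth_affine_times: "smooth f \<Longrightarrow> smooth (\<lambda>x. ((x - a) \<bullet> c) *\<^sub>R f x)"
  by (simp add: smooth_def[of "\<lambda>x. ((x - a) \<bullet> c) *\<^sub>R f x"] Ck_on_affine_times)

text \<open>
  The functions \<open>exp (-1/t) / t ^ n\<close> for \<open>t > 0\<close>, extended by \<open>0\<close>. This family is closed under
  differentiation, up to linear combinations.
\<close>

definition flat_exp :: "nat \<Rightarrow> real \<Rightarrow> real" where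
  "flat_exp n t = (if t \<le> 0 then 0 else exp (- (1 / t)) / t ^ n)"

lemma flat_exp_tendsto_0: "(flat_exp n \<longlongrightarrow> 0) (at_right 0)"
proof -
  have "((\<lambda>x::real. x ^ n / exp x) \<longlongrightarrow> 0) at_top" by (rule tendsto_power_div_exp_0)
  then have "((\<lambda>t::real. inverse t ^ n / exp (inverse t)) \<longlongrightarrow> 0) (at_right 0)"
    by (rule filterlim_compose[OF _ filterlim_inverse_at_top_right])
  then show ?thesis
  proof (rule Lim_transform_eventually)
    show "\<forall>\<^sub>F t in at_right 0. inverse t ^ n / exp (inverse t) = flat_exp n t"
      unfolding eventually_at_right_field
      by (intro exI[of _ 1]) (auto simp: flat_exp_def exp_minus field_simps)
  qed
qed

lemma flat_exp_DERIV:
  "(flat_exp n has_real_derivative (flat_exp (n + 2) t - n * flat_exp (n + 1) t)) (at t)"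
proof -
  consider "t < 0" | "t = 0" | "0 < t" by linarith
  then show ?thesis
  proof cases
    case 1
    have "((\<lambda>_. 0) has_real_derivative 0) (at t)" by simp
    then have "(flat_exp n has_real_derivative 0) (at t)"
      by (rule has_field_derivative_transform_within_open[of _ _ _ "{..<0}"])
        (use 1 in \<open>auto simp: flat_exp_def\<close>)
    then show ?thesis using 1 by (simp add: flat_exp_def)
  next
    case 2
    have "((\<lambda>y. (flat_exp n y - flat_exp n 0) / (y - 0)) \<longlongrightarrow> 0) (at 0)"
      unfolding filterlim_at_split
    proof
      show "((\<lambda>y. (flat_exp n y - flat_exp n 0) / (y - 0)) \<longlongrightarrow> 0) (at_left 0)"
        by (rule Lim_transform_eventually[OF tendsto_const])
          (auto simp: eventually_at_left_field flat_exp_def intro!: exI[of _ "-1"])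
      show "((\<lambda>y. (flat_exp n y - flat_exp n 0) / (y - 0)) \<longlongrightarrow> 0) (at_right 0)"
        by (rule Lim_transform_eventually[OF flat_exp_tendsto_0[of "Suc n"]])
          (auto simp: eventually_at_right_field flat_exp_def intro!: exI[of _ 1])
    qed
    then show ?thesis using 2 by (simp add: has_field_derivative_iff flat_exp_def)
  next
    case 3
    have "((\<lambda>t. exp (- (1 / t)) / t ^ n) has_real_derivative
      (exp (- (1 / t)) / t ^ (n + 2) - n * (exp (- (1 / t)) / t ^ (n + 1)))) (at t)"
    proof -
      have "((\<lambda>t. exp (- (1 / t))) has_real_derivative exp (- (1 / t)) / t\<^sup>2) (at t)"
        using 3 by (auto intro!: derivative_eq_intros simp: power2_eq_square)
      from DERIV_divide[OF this DERIV_pow[of n t]] 3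
      have "((\<lambda>t. exp (- (1 / t)) / t ^ n) has_real_derivative
        (exp (- (1 / t)) / t\<^sup>2 * t ^ n - exp (- (1 / t)) * (real n * t ^ (n - Suc 0))) / (t ^ n * t ^ n)) (at t)"
        by simp
      moreover have "(exp (- (1 / t)) / t\<^sup>2 * t ^ n - exp (- (1 / t)) * (real n * t ^ (n - Suc 0))) / (t ^ n * t ^ n)
        = exp (- (1 / t)) / t ^ (n + 2) - n * (exp (- (1 / t)) / t ^ (n + 1))"
        using 3 by (cases n) (simp_all add: field_simps power2_eq_square)
      ultimately show ?thesis by simp
    qed
    then have "(flat_exp n has_real_derivative
      (exp (- (1 / t)) / t ^ (n + 2) - n * (exp (- (1 / t)) / t ^ (n + 1)))) (at t)"
      by (rule has_field_derivative_transform_within_open[of _ _ _ "{0<..}"])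
        (use 3 in \<open>auto simp: flat_exp_def\<close>)
    then show ?thesis using 3 by (simp add: flat_exp_def)
  qed
qed

text \<open>
  The derivatives are sums of terms of the same form, with other \<open>n\<close> and other smooth factors; the induction on
  the order of differentiability therefore runs over all \<open>n\<close> and all smooth \<open>f\<close> at once.
\<close>

lemma smooth_flat_exp_times:
  fixes f :: "'a::real_inner \<Rightarrow> 'b::real_normed_vector"
  shows "smooth f \<Longrightarrow> smooth (\<lambda>x. flat_exp n (\<rho> - (x - a) \<bullet> (x - a)) *\<^sub>R f x)"
proof -
  let ?u = "\<lambda>x::'a. \<rho> - (x - a) \<bullet> (x - a)"
  have "Ck_on k (\<lambda>x. flat_exp n (?u x) *\<^sub>R f x) UNIV" if "smooth f" for k n and f :: "'a \<Rightarrow> 'b"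
    using that
  proof (induction k arbitrary: n f)
    case 0
    have "continuous_on UNIV (flat_exp n)"
      by (intro continuous_at_imp_continuous_on ballI DERIV_isCont[OF flat_exp_DERIV])
    then have "continuous_on UNIV (\<lambda>x. flat_exp n (?u x))"
      by (rule continuous_on_compose2) (auto intro!: continuous_intros)
    then show ?case using 0 by (simp add: continuous_on_scaleR smooth_continuous)
  next
    case (Suc k)
    show ?case
    proof (rule Ck_on_Suc_if_has_derivative)
      fix x :: 'a
      have "(?u has_derivative (\<lambda>v. - 2 * ((x - a) \<bullet> v))) (at x)"
        by (auto intro!: derivative_eq_intros simp: inner_commute)
      from DERIV_compose_FDERIV[OF flat_exp_DERIV this]
      have "((\<lambda>x. flat_exp n (?u x)) has_derivative (\<lambda>v. (- 2 * ((x - a) \<bullet> v)) *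
          (flat_exp (n + 2) (?u x) - n * flat_exp (n + 1) (?u x)))) (at x)" by simp
      from has_derivative_scaleR[OF this smooth_has_derivative[OF Suc.prems]]
      show "((\<lambda>x. flat_exp n (?u x) *\<^sub>R f x) has_derivative
        (\<lambda>v. flat_exp n (?u x) *\<^sub>R frechet_derivative f (at x) v +
          (flat_exp (n + 2) (?u x) *\<^sub>R ((-2) *\<^sub>R (((x - a) \<bullet> v) *\<^sub>R f x)) +
           flat_exp (n + 1) (?u x) *\<^sub>R ((2 * real n) *\<^sub>R (((x - a) \<bullet> v) *\<^sub>R f x))))) (at x)"
        by (rule has_derivative_eq_rhs) (auto simp: fun_eq_iff algebra_simps)
    next
      fix v
      show "Ck_on k (\<lambda>x. flat_exp n (?u x) *\<^sub>R frechet_derivative f (at x) v +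
          (flat_exp (n + 2) (?u x) *\<^sub>R ((-2) *\<^sub>R (((x - a) \<bullet> v) *\<^sub>R f x)) +
           flat_exp (n + 1) (?u x) *\<^sub>R ((2 * real n) *\<^sub>R (((x - a) \<bullet> v) *\<^sub>R f x)))) UNIV"
        by (intro Ck_on_add Suc.IH smooth_derivative smooth_scaleR smooth_affine_times Suc.prems)
    qed
  qed
  then show "smooth f \<Longrightarrow> smooth (\<lambda>x. flat_exp n (\<rho> - (x - a) \<bullet> (x - a)) *\<^sub>R f x)"
    by (simp add: smooth_def[of "\<lambda>x. flat_exp n (?u x) *\<^sub>R f x"])
qed

lemma smooth_bump_exists:
  fixes \<Omega> :: "(real^3) set"
  assumes "open \<Omega>" "\<Omega> \<noteq> {}"
  shows "\<exists>W :: real^3 \<Rightarrow> real^3. smooth W \<and> (\<forall>x. x \<notin> \<Omega> \<longrightarrow> W x = 0) \<and> (\<exists>x\<in>\<Omega>. W x \<noteq> 0)"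
proof -
  obtain a where a: "a \<in> \<Omega>" using assms by blast
  then obtain d where d: "0 < d" "ball a d \<subseteq> \<Omega>" using assms openE by blast
  define W :: "real^3 \<Rightarrow> real^3" where "W x = flat_exp 0 (d\<^sup>2 - (x - a) \<bullet> (x - a)) *\<^sub>R axis 1 1" for x
  have "smooth W" unfolding W_def[abs_def] by (rule smooth_flat_exp_times[OF smooth_const])
  moreover have "W x = 0" if "x \<notin> \<Omega>" for x
  proof -
    have "d \<le> norm (x - a)" using that d by (auto simp: dist_norm norm_minus_commute not_less subset_iff)
    then have "d\<^sup>2 \<le> (x - a) \<bullet> (x - a)"
      using power_mono[of d "norm (x - a)" 2] d by (simp add: power2_norm_eq_inner)
    then show ?thesis by (simp add: W_def flat_exp_def)
  qed
  moreover have "W a \<noteq> 0" using d by (simp add: W_def flat_exp_def axis_eq_0_iff)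
  ultimately show ?thesis using a by blast
qed

section \<open>Optimal stresses\<close>

lemma strain_eq:
  assumes "(W has_derivative W') (at x)"
  shows "strain W x = symmetric_part (matrix W')"
  using frechet_derivative_at[OF assms] by (simp add: strain_def symmetric_part_def jacobian_def)

lemma strain_in_sym: "strain W x \<in> sym_matrices"
  using symmetric_part_in by (simp add: strain_def symmetric_part_def[symmetric])

lemma strain_add:
  assumes "W differentiable (at x)" "V differentiable (at x)"
  shows "strain (\<lambda>x. W x + V x) x = strain W x + strain V x"
proof -
  have W: "(W has_derivative frechet_derivative W (at x)) (at x)"
    and V: "(V has_derivative frechet_derivative V (at x)) (at x)"
    using assms frechet_derivative_works by blast+
  have "matrix (\<lambda>v. frechet_derivative W (at x) v + frechet_derivative V (at x) v) =
    matrix (frechet_derivative W (at x)) + matrix (frechet_derivative V (at x))"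
    by (simp add: matrix_def vec_eq_iff)
  then show ?thesis
    using strain_eq[OF has_derivative_add[OF W V]] strain_eq[OF W] strain_eq[OF V]
    by (simp add: linear_add[OF linear_symmetric_part])
qed

lemma strain_scaleR:
  assumes "W differentiable (at x)"
  shows "strain (\<lambda>x. c *\<^sub>R W x) x = c *\<^sub>R strain W x"
proof -
  have W: "(W has_derivative frechet_derivative W (at x)) (at x)"
    using assms frechet_derivative_works by blast
  have "matrix (\<lambda>v. c *\<^sub>R frechet_derivative W (at x) v) = c *\<^sub>R matrix (frechet_derivative W (at x))"
    by (simp add: matrix_def vec_eq_iff)
  then show ?thesis
    using strain_eq[OF has_derivative_scaleR_right[OF W]] strain_eq[OF W]
    by (simp add: linear_scale[OF linear_symmetric_part])
qed

lemma strain_cong_open: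
  assumes "open S" "x \<in> S" "\<And>y. y \<in> S \<Longrightarrow> w y = W y" "W differentiable (at x)"
  shows "strain w x = strain W x"
proof -
  have W: "(W has_derivative frechet_derivative W (at x)) (at x)"
    using assms(4) frechet_derivative_works by blast
  have "(w has_derivative frechet_derivative W (at x)) (at x)"
    by (rule has_derivative_transform_within_open[OF W assms(1,2)]) (use assms(3) in simp)
  then show ?thesis using strain_eq[OF W] strain_eq by metis
qed

lemma smooth_C1: "smooth W \<Longrightarrow> Ck_on 1 W UNIV"
  by (simp add: smooth_def del: One_nat_def)

lemma smooth_differentiable: "smooth W \<Longrightarrow> W differentiable (at x)"
  using smooth_has_derivative by (auto simp: differentiable_def)

locale clamped_body = sym_norm N for N +
  fixes \<Omega> \<Gamma>0 \<Gamma>t :: "(real^3) set" and t :: "real^3 \<Rightarrow> real^3"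
  assumes open_\<Omega>: "open \<Omega>" and bounded_\<Omega>: "bounded \<Omega>" and connected_\<Omega>: "connected \<Omega>"
    and C1_\<Omega>: "C1_boundary \<Omega>" and \<Gamma>0_nonempty: "\<Gamma>0 \<noteq> {}"
    and openin_\<Gamma>0: "openin (top_of_set (frontier \<Omega>)) \<Gamma>0"
    and openin_\<Gamma>t: "openin (top_of_set (frontier \<Omega>)) \<Gamma>t"
    and t_bounded: "essentially_bounded (restrict_space hausdorff2 \<Gamma>t) t"
begin

abbreviation "\<mu> \<equiv> lebesgue_on \<Omega>"
abbreviation "L \<equiv> traction_power \<Gamma>t t"

text \<open>
  Test fields that are smooth on the whole space. Unlike general test fields, which are arbitrary outside the
  closure, their strain is additive and homogeneous at every point.
\<close>

definition admissible :: "(real^3 \<Rightarrow> real^3) set" where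
  "admissible = {W. smooth W \<and> (\<forall>x\<in>\<Gamma>0. W x = 0)}"

definition strain_L1 :: "(real^3 \<Rightarrow> real^3) \<Rightarrow> real" where
  "strain_L1 W = (\<integral>x. D (strain W x) \<partial>\<mu>)"

lemma \<Gamma>0_closure: "\<Gamma>0 \<subseteq> closure \<Omega>" and \<Gamma>t_frontier: "\<Gamma>t \<subseteq> frontier \<Omega>" and \<Gamma>t_closure: "\<Gamma>t \<subseteq> closure \<Omega>"
  using openin_imp_subset[OF openin_\<Gamma>0] openin_imp_subset[OF openin_\<Gamma>t] by (auto simp: frontier_def)

lemma \<Omega>_nonempty: "\<Omega> \<noteq> {}"
  using \<Gamma>0_nonempty \<Gamma>0_closure by auto

lemma \<Gamma>t_borel: "\<Gamma>t \<in> sets borel"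
proof -
  obtain T where "open T" "\<Gamma>t = frontier \<Omega> \<inter> T" using openin_\<Gamma>t by (auto simp: openin_open)
  then show ?thesis by (simp add: borel_closed borel_open)
qed

lemma finite_\<mu>: "finite_measure \<mu>"
  by (rule finite_measure_lebesgue_on[OF lmeasurable_open[OF bounded_\<Omega> open_\<Omega>]])

lemma measurable_\<mu>: "f \<in> borel_measurable borel \<Longrightarrow> f \<in> borel_measurable \<mu>"
  by (rule measurable_restrict_space1) (simp add: measurable_completion)

lemma integrable_continuous:
  fixes f :: "real^3 \<Rightarrow> 'b::euclidean_space"
  assumes f: "continuous_on UNIV f"
  shows "integrable \<mu> f"
proof -
  have "bounded (f ` closure \<Omega>)"
    using bounded_\<Omega> by (intro compact_imp_bounded compact_continuous_image continuous_on_subset[OF f]) auto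
  then obtain B where B: "\<And>x. x \<in> closure \<Omega> \<Longrightarrow> norm (f x) \<le> B" unfolding bounded_iff by auto
  have "AE x in \<mu>. norm (f x) \<le> B"
    using B closure_subset[of \<Omega>] by (intro AE_I2) auto
  then show ?thesis
    using measurable_\<mu>[OF borel_measurable_continuous_onI[OF f]]
    by (rule finite_measure.integrable_const_bound[OF finite_\<mu>])
qed

lemma integrable_strain: "smooth W \<Longrightarrow> integrable \<mu> (strain W)"
  by (intro integrable_continuous continuous_on_strain smooth_C1)

lemma integrable_dual: "integrable \<mu> f \<Longrightarrow> integrable \<mu> (\<lambda>x. D (f x))"
proof -
  assume f: "integrable \<mu> f"
  obtain K where K: "K > 0" "\<forall>E. D E \<le> K * norm E" using dual_upper by blast
  show ?thesis
  proof (rule Bochner_Integration.integrable_bound)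
    show "integrable \<mu> (\<lambda>x. K * norm (f x))" using f by simp
    show "(\<lambda>x. D (f x)) \<in> borel_measurable \<mu>"
      using f by (intro measurable_compose[OF _ borel_measurable_dual]) auto
    show "AE x in \<mu>. norm (D (f x)) \<le> norm (K * norm (f x))"
      using K dual_nonneg by (intro AE_I2) auto
  qed
qed

lemma strain_mass_eq:
  assumes W: "smooth W"
  shows "strain_mass \<Omega> W = ennreal (\<integral>x. norm (strain W x) \<partial>\<mu>)"
proof -
  have "(\<integral>\<^sup>+x. ennreal (norm (strain W x)) \<partial>\<mu>) = ennreal (\<integral>x. norm (strain W x) \<partial>\<mu>)"
    using integrable_strain[OF W] by (intro nn_integral_eq_integral) auto
  moreover have "(\<integral>\<^sup>+x. ennreal (norm (strain W x)) \<partial>\<mu>) = strain_mass \<Omega> W"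
    using open_\<Omega> by (subst nn_integral_restrict_space)
      (auto simp: nn_integral_completion strain_mass_def strain_density_def)
  ultimately show ?thesis by simp
qed

text \<open>
  The traction is essentially bounded, so its power is at most a multiple of the integral of the norm of \<open>W\<close> over
  the boundary, which the strain bounds. The same estimate gives integrability.
\<close>

lemma traction_le_strain:
  "\<exists>K\<ge>0. \<forall>W\<in>admissible. integrable (restrict_space hausdorff2 \<Gamma>t) (\<lambda>x. t x \<bullet> W x) \<and>
     \<bar>L W\<bar> \<le> K * (\<integral>x. norm (strain W x) \<partial>\<mu>)"
proof -
  let ?M = "restrict_space hausdorff2 \<Gamma>t"
  obtain C where C: "0 \<le> C" "\<forall>W\<in>vanishing_fields \<Gamma>0.
    L1_norm hausdorff2 (frontier \<Omega>) W \<le> ennreal C * strain_mass \<Omega> W"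
    using trace_le_strain_L1[OF open_\<Omega> bounded_\<Omega> connected_\<Omega> C1_\<Omega> \<Gamma>0_nonempty openin_\<Gamma>0] by blast
  have [measurable]: "t \<in> borel_measurable ?M" using t_bounded by (simp add: essentially_bounded_def)
  obtain c' where c': "AE x in ?M. norm (t x) \<le> c'" using t_bounded by (auto simp: essentially_bounded_def)
  define c where "c = max 0 c'"
  have c: "0 \<le> c" "AE x in ?M. norm (t x) \<le> c"
    using c' by (auto simp: c_def elim: eventually_mono)
  show ?thesis
  proof (intro exI[of _ "c * C"] conjI ballI)
    show "0 \<le> c * C" using c C by simp
    fix W assume WY: "W \<in> admissible"
    then have W: "smooth W" and WV: "W \<in> vanishing_fields \<Gamma>0"
      using smooth_C1 by (auto simp: admissible_def vanishing_fields_def simp del: One_nat_def)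
    have "W \<in> borel_measurable hausdorff2"
      using C1_D(4)[OF smooth_C1[OF W]] by (simp cong: measurable_cong_sets)
    then have [measurable]: "W \<in> borel_measurable ?M" by (rule measurable_restrict_space1)
    let ?I = "\<integral>x. norm (strain W x) \<partial>\<mu>"
    have I0: "0 \<le> ?I" by simp
    have "(\<integral>\<^sup>+x. ennreal (norm (t x \<bullet> W x)) \<partial>?M) \<le> (\<integral>\<^sup>+x. ennreal c * ennreal (norm (W x)) \<partial>?M)"
    proof (rule nn_integral_mono_AE)
      show "AE x in ?M. ennreal (norm (t x \<bullet> W x)) \<le> ennreal c * ennreal (norm (W x))"
        using c(2)
      proof eventually_elim
        case (elim x)
        have "norm (t x \<bullet> W x) \<le> norm (t x) * norm (W x)" by (simp add: Cauchy_Schwarz_ineq2)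
        also have "\<dots> \<le> c * norm (W x)" using elim by (intro mult_right_mono) auto
        finally show ?case using c(1) by (simp add: ennreal_mult[symmetric] ennreal_leI)
      qed
    qed
    also have "\<dots> = ennreal c * (\<integral>\<^sup>+x. ennreal (norm (W x)) \<partial>?M)" by (rule nn_integral_cmult) measurable
    also have "(\<integral>\<^sup>+x. ennreal (norm (W x)) \<partial>?M) = L1_norm hausdorff2 \<Gamma>t W"
      using \<Gamma>t_borel by (intro nn_integral_restrict_space) simp
    also have "\<dots> \<le> L1_norm hausdorff2 (frontier \<Omega>) W"
      using \<Gamma>t_frontier by (intro nn_integral_mono mult_left_mono) (auto simp: indicator_def)
    also have "\<dots> \<le> ennreal C * strain_mass \<Omega> W" using C(2) WV by (rule bspec)
    also have "ennreal c * (ennreal C * strain_mass \<Omega> W) = ennreal (c * C * ?I)"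
      using c(1) C(1) I0 by (simp add: strain_mass_eq[OF W] ennreal_mult mult.assoc)
    finally have le: "(\<integral>\<^sup>+x. ennreal (norm (t x \<bullet> W x)) \<partial>?M) \<le> ennreal (c * C * ?I)"
      by (simp add: mult_left_mono)
    show int: "integrable ?M (\<lambda>x. t x \<bullet> W x)"
    proof (rule integrableI_bounded)
      show "(\<integral>\<^sup>+x. ennreal (norm (t x \<bullet> W x)) \<partial>?M) < \<infinity>"
        using le by (rule le_less_trans) simp
    qed measurable
    have "ennreal \<bar>L W\<bar> \<le> ennreal (c * C * ?I)"
      using order_trans[OF integral_norm_bound_ennreal[OF int] le] by (simp add: traction_power_def)
    then show "\<bar>L W\<bar> \<le> c * C * ?I"
      using c(1) C(1) I0 by (subst (asm) ennreal_le_iff) auto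
  qed
qed

lemma strain_L1_nonneg: "0 \<le> strain_L1 W"
  unfolding strain_L1_def by (intro integral_nonneg_AE AE_I2 dual_nonneg)

lemma traction_le_strain_L1: "\<exists>K\<ge>0. \<forall>W\<in>admissible. \<bar>L W\<bar> \<le> K * strain_L1 W"
proof -
  obtain K where K: "K \<ge> 0" "\<forall>W\<in>admissible. integrable (restrict_space hausdorff2 \<Gamma>t) (\<lambda>x. t x \<bullet> W x) \<and>
     \<bar>L W\<bar> \<le> K * (\<integral>x. norm (strain W x) \<partial>\<mu>)" using traction_le_strain by blast
  obtain k where k: "k > 0" "\<forall>E\<in>sym_matrices. norm E \<le> k * D E" using dual_lower by blast
  show ?thesis
  proof (intro exI[of _ "K * k"] conjI ballI)
    fix W assume W: "W \<in> admissible"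
    have int: "integrable \<mu> (strain W)" using W integrable_strain by (simp add: admissible_def)
    have "(\<integral>x. norm (strain W x) \<partial>\<mu>) \<le> (\<integral>x. k * D (strain W x) \<partial>\<mu>)"
      using int k(2) strain_in_sym integrable_dual[OF int] by (intro integral_mono) auto
    also have "\<dots> = k * strain_L1 W" by (simp add: strain_L1_def)
    finally have "K * (\<integral>x. norm (strain W x) \<partial>\<mu>) \<le> K * (k * strain_L1 W)" using K(1) by (rule mult_left_mono)
    then show "\<bar>L W\<bar> \<le> K * k * strain_L1 W" using K(2) W by (fastforce simp: mult.assoc)
  qed (use K k in simp)
qed

lemma admissible_add: "W \<in> admissible \<Longrightarrow> V \<in> admissible \<Longrightarrow> (\<lambda>x. W x + V x) \<in> admissible"
  by (auto simp: admissible_def smooth_def Ck_on_add)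

lemma admissible_scaleR: "W \<in> admissible \<Longrightarrow> (\<lambda>x. c *\<^sub>R W x) \<in> admissible"
  by (auto simp: admissible_def smooth_scaleR)

lemma admissible_differentiable: "W \<in> admissible \<Longrightarrow> W differentiable (at x)"
  by (simp add: admissible_def smooth_differentiable)

lemma strain_admissible_add: "W \<in> admissible \<Longrightarrow> V \<in> admissible \<Longrightarrow> strain (\<lambda>x. W x + V x) = (\<lambda>x. strain W x + strain V x)"
  by (intro ext strain_add admissible_differentiable)

lemma strain_admissible_scaleR: "W \<in> admissible \<Longrightarrow> strain (\<lambda>x. c *\<^sub>R W x) = (\<lambda>x. c *\<^sub>R strain W x)"
  by (intro ext strain_scaleR admissible_differentiable)

lemma integrable_traction: "W \<in> admissible \<Longrightarrow> integrable (restrict_space hausdorff2 \<Gamma>t) (\<lambda>x. t x \<bullet> W x)"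
  using traction_le_strain by blast

lemma L_add: "W \<in> admissible \<Longrightarrow> V \<in> admissible \<Longrightarrow> L (\<lambda>x. W x + V x) = L W + L V"
  using integrable_traction by (simp add: traction_power_def inner_add_right)

lemma L_scaleR: "L (\<lambda>x. c *\<^sub>R W x) = c * L W"
  by (simp add: traction_power_def)

text \<open>
  Replacing a test field by a smooth extension changes neither the power of the traction nor the strain in the
  open set \<open>\<Omega>\<close>.
\<close>

lemma test_fields_extend:
  assumes "w \<in> test_fields \<Omega> \<Gamma>0"
  obtains W where "W \<in> admissible" "\<And>x. x \<in> closure \<Omega> \<Longrightarrow> w x = W x" "L w = L W"
    "\<And>x. x \<in> \<Omega> \<Longrightarrow> strain w x = strain W x"
proof -
  obtain W where W: "smooth W" "\<And>x. x \<in> closure \<Omega> \<Longrightarrow> w x = W x"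
    using assms unfolding test_fields_def smooth_on_closure_def smooth_def by auto
  have "W x = 0" if "x \<in> \<Gamma>0" for x
    using W(2)[of x] that assms \<Gamma>0_closure by (auto simp: test_fields_def)
  then have "W \<in> admissible" using W(1) by (simp add: admissible_def)
  moreover have "L w = L W"
    unfolding traction_power_def using W(2) \<Gamma>t_closure
    by (intro Bochner_Integration.integral_cong) (auto simp: space_restrict_space)
  moreover have "strain w x = strain W x" if "x \<in> \<Omega>" for x
    using W closure_subset[of \<Omega>] by (intro strain_cong_open[OF open_\<Omega> that] smooth_differentiable) auto
  ultimately show thesis using W(2) by (intro that[of W]) auto
qed

lemma admissible_subset_test_fields: "admissible \<subseteq> test_fields \<Omega> \<Gamma>0"
  by (auto simp: admissible_def test_fields_def smooth_on_closure_def smooth_def)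

lemma power_density: "(\<Sum>i\<in>UNIV. \<Sum>j\<in>UNIV. S $ i $ j * E $ i $ j) = S \<bullet> (E :: real^3^3)"
  by (simp add: inner_vec_def)

text \<open>
  It suffices to test with fields that are smooth on the whole space, because every test field extends to one.
\<close>

lemma stress_fields_iff:
  "\<sigma> \<in> stress_fields \<Omega> \<Gamma>0 \<Gamma>t t \<longleftrightarrow> essentially_bounded \<mu> \<sigma> \<and> (\<forall>x\<in>\<Omega>. \<sigma> x \<in> sym_matrices) \<and>
     (\<forall>W\<in>admissible. L W = (\<integral>x. \<sigma> x \<bullet> strain W x \<partial>\<mu>))"
proof -
  have "(\<forall>w\<in>test_fields \<Omega> \<Gamma>0. L w = (\<integral>x. \<sigma> x \<bullet> strain w x \<partial>\<mu>)) \<longleftrightarrow>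
    (\<forall>W\<in>admissible. L W = (\<integral>x. \<sigma> x \<bullet> strain W x \<partial>\<mu>))"
  proof
    assume bal: "\<forall>W\<in>admissible. L W = (\<integral>x. \<sigma> x \<bullet> strain W x \<partial>\<mu>)"
    show "\<forall>w\<in>test_fields \<Omega> \<Gamma>0. L w = (\<integral>x. \<sigma> x \<bullet> strain w x \<partial>\<mu>)"
    proof
      fix w assume "w \<in> test_fields \<Omega> \<Gamma>0"
      then obtain W where W: "W \<in> admissible" "L w = L W" "\<And>x. x \<in> \<Omega> \<Longrightarrow> strain w x = strain W x"
        using test_fields_extend by metis
      have "(\<integral>x. \<sigma> x \<bullet> strain w x \<partial>\<mu>) = (\<integral>x. \<sigma> x \<bullet> strain W x \<partial>\<mu>)"
        using W(3) by (intro Bochner_Integration.integral_cong) auto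
      then show "L w = (\<integral>x. \<sigma> x \<bullet> strain w x \<partial>\<mu>)" using bal W by simp
    qed
  qed (use admissible_subset_test_fields in blast)
  then show ?thesis by (simp add: stress_fields_def power_density)
qed

lemma strain_L1_cong: "(\<And>x. x \<in> \<Omega> \<Longrightarrow> strain w x = strain W x) \<Longrightarrow> (\<integral>x. D (strain w x) \<partial>\<mu>) = strain_L1 W"
  unfolding strain_L1_def by (intro Bochner_Integration.integral_cong) auto

lemma pairing_integral_le:
  assumes \<sigma>: "\<sigma> \<in> borel_measurable \<mu>" "\<And>x. x \<in> \<Omega> \<Longrightarrow> \<sigma> x \<in> sym_matrices"
    and c: "0 \<le> c" "AE x in \<mu>. N (\<sigma> x) \<le> c" and W: "W \<in> admissible"
  shows "\<bar>\<integral>x. \<sigma> x \<bullet> strain W x \<partial>\<mu>\<bar> \<le> c * strain_L1 W"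
proof -
  have int: "integrable \<mu> (strain W)" using W integrable_strain by (simp add: admissible_def)
  have AE: "AE x in \<mu>. \<bar>\<sigma> x \<bullet> strain W x\<bar> \<le> c * D (strain W x)"
    using c(2) AE_space
  proof eventually_elim
    case (elim x)
    then have "\<bar>\<sigma> x \<bullet> strain W x\<bar> \<le> N (\<sigma> x) * D (strain W x)" by (intro pairing_le \<sigma>(2)) simp
    also have "\<dots> \<le> c * D (strain W x)" using elim(1) dual_nonneg by (intro mult_right_mono) auto
    finally show ?case .
  qed
  have intD: "integrable \<mu> (\<lambda>x. c * D (strain W x))" using integrable_dual[OF int] by simp
  have intp: "integrable \<mu> (\<lambda>x. \<sigma> x \<bullet> strain W x)"
  proof (rule Bochner_Integration.integrable_bound[OF intD])
    show "AE x in \<mu>. norm (\<sigma> x \<bullet> strain W x) \<le> norm (c * D (strain W x))"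
      using AE by eventually_elim auto
  qed (use \<sigma>(1) int in auto)
  have "\<bar>\<integral>x. \<sigma> x \<bullet> strain W x \<partial>\<mu>\<bar> \<le> (\<integral>x. \<bar>\<sigma> x \<bullet> strain W x\<bar> \<partial>\<mu>)" by (rule integral_abs_bound)
  also have "\<dots> \<le> (\<integral>x. c * D (strain W x) \<partial>\<mu>)"
    using intp intD AE by (intro integral_mono_AE) auto
  finally show ?thesis by (simp add: strain_L1_def)
qed

text \<open>
  Prescribe the power \<open>L W\<close> as a lower bound at \<open>strain W\<close>. Since \<open>W\<close> and \<open>- W\<close> are both admissible, a
  linear functional respecting these bounds takes the value \<open>L W\<close> at \<open>strain W\<close>. The symmetric part of its density
  is the stress.
\<close>

lemma stress_exists:
  assumes c: "0 \<le> c" and le: "\<And>W. W \<in> admissible \<Longrightarrow> \<bar>L W\<bar> \<le> c * strain_L1 W"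
  shows "\<exists>\<sigma>\<in>stress_fields \<Omega> \<Gamma>0 \<Gamma>t t. stress_sup \<Omega> N \<sigma> \<le> ereal c"
proof -
  let ?V = "{f :: real^3 \<Rightarrow> real^3^3. integrable \<mu> f}"
  define p where "p f = c * (\<integral>x. D (f x) \<partial>\<mu>)" for f
  define K where "K = {(strain W, L W) | W. W \<in> admissible}"
  have zeroY: "(\<lambda>x. 0) \<in> admissible" by (simp add: admissible_def smooth_const)
  obtain k where k: "k > 0" "\<forall>E. D E \<le> k * norm E" using dual_upper by blast
  have p_sub: "sublinear_on ?V p"
    unfolding sublinear_on_def
  proof (intro conjI ballI allI impI)
    fix f g assume "f \<in> ?V" "g \<in> ?V"
    then have fg: "integrable \<mu> f" "integrable \<mu> g" by auto
    have "(\<integral>x. D (f x + g x) \<partial>\<mu>) \<le> (\<integral>x. D (f x) + D (g x) \<partial>\<mu>)"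
      using fg by (intro integral_mono integrable_dual Bochner_Integration.integrable_add dual_triangle)
    then have "(\<integral>x. D (f x + g x) \<partial>\<mu>) \<le> (\<integral>x. D (f x) \<partial>\<mu>) + (\<integral>x. D (g x) \<partial>\<mu>)"
      using fg integrable_dual by simp
    then show "p (\<lambda>x. f x + g x) \<le> p f + p g"
      using mult_left_mono[OF _ c] unfolding p_def by (simp add: distrib_left[symmetric])
  next
    fix f and a :: real assume "0 \<le> a"
    then show "p (\<lambda>x. a *\<^sub>R f x) = a * p f" by (simp add: p_def dual_scale)
  qed
  have KE: "\<exists>W\<in>admissible. f = strain W \<and> s = L W" if "(f, s) \<in> K" for f s
    using that unfolding K_def by blast
  obtain \<phi> where \<phi>: "linear_functional_on ?V \<phi>" "\<And>f. f \<in> ?V \<Longrightarrow> \<phi> f \<le> p f"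
    "\<And>f s. (f, s) \<in> K \<Longrightarrow> s \<le> \<phi> f"
  proof (rule mazur_orlicz_cone[OF function_space_integrable p_sub, of K])
    show "f \<in> ?V \<and> s \<le> p f" if fs: "(f, s) \<in> K" for f s
    proof -
      obtain W where W: "W \<in> admissible" "f = strain W" "s = L W" using KE[OF fs] by blast
      then show ?thesis using le[OF W(1)] integrable_strain by (auto simp: p_def strain_L1_def admissible_def)
    qed
    have "strain (\<lambda>x. 0 *\<^sub>R (0::real^3)) = (\<lambda>x. 0 *\<^sub>R strain (\<lambda>x. 0) x)" by (rule strain_admissible_scaleR[OF zeroY])
    moreover have "L (\<lambda>x. 0) = 0" by (simp add: traction_power_def)
    ultimately show "(\<lambda>x. 0, 0) \<in> K" using zeroY unfolding K_def by (auto intro!: exI[of _ "\<lambda>x. 0"])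
    show "(\<lambda>x. f x + g x, s + u) \<in> K" if fs: "(f, s) \<in> K" and gu: "(g, u) \<in> K" for f s g u
    proof -
      obtain W where W: "W \<in> admissible" "f = strain W" "s = L W" using KE[OF fs] by blast
      obtain V where V: "V \<in> admissible" "g = strain V" "u = L V" using KE[OF gu] by blast
      show ?thesis unfolding K_def mem_Collect_eq
        by (rule exI[of _ "\<lambda>x. W x + V x"])
          (simp add: W V strain_admissible_add[OF W(1) V(1)] L_add[OF W(1) V(1)] admissible_add[OF W(1) V(1)])
    qed
    show "(\<lambda>x. a *\<^sub>R f x, a * s) \<in> K" if fs: "(f, s) \<in> K" for f s a
    proof -
      obtain W where W: "W \<in> admissible" "f = strain W" "s = L W" using KE[OF fs] by blast
      show ?thesis unfolding K_def mem_Collect_eq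
        by (rule exI[of _ "\<lambda>x. a *\<^sub>R W x"])
          (simp add: W strain_admissible_scaleR[OF W(1)] L_scaleR admissible_scaleR[OF W(1)])
    qed
  qed (rule that)
  have \<phi>neg: "\<phi> (\<lambda>x. - f x) = - \<phi> f" if "integrable \<mu> f" for f
  proof -
    have "\<phi> (\<lambda>x. (-1) *\<^sub>R f x) = (-1) * \<phi> f"
      using \<phi>(1) that unfolding linear_functional_on_def by blast
    then show ?thesis by simp
  qed
  have \<phi>L: "\<phi> (strain W) = L W" if W: "W \<in> admissible" for W
  proof (rule antisym)
    have "(strain W, L W) \<in> K" using W unfolding K_def by blast
    then show "L W \<le> \<phi> (strain W)" by (rule \<phi>(3))
    have "(strain (\<lambda>x. (-1) *\<^sub>R W x), L (\<lambda>x. (-1) *\<^sub>R W x)) \<in> K"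
      using admissible_scaleR[OF W, of "-1"] unfolding K_def by blast
    from \<phi>(3)[OF this] have "- L W \<le> \<phi> (\<lambda>x. - strain W x)"
      unfolding strain_admissible_scaleR[OF W] L_scaleR by simp
    then show "\<phi> (strain W) \<le> L W"
      using \<phi>neg integrable_strain W by (simp add: admissible_def)
  qed
  have \<phi>bound: "\<bar>\<phi> f\<bar> \<le> (c * k) * (\<integral>x. norm (f x) \<partial>\<mu>)" if f: "integrable \<mu> f" for f
  proof -
    have up: "\<phi> f \<le> (c * k) * (\<integral>x. norm (f x) \<partial>\<mu>)" if f: "integrable \<mu> f" for f
    proof -
      have "(\<integral>x. D (f x) \<partial>\<mu>) \<le> (\<integral>x. k * norm (f x) \<partial>\<mu>)"
        using f k(2) integrable_dual[OF f] by (intro integral_mono) auto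
      then have "c * (\<integral>x. D (f x) \<partial>\<mu>) \<le> c * (k * (\<integral>x. norm (f x) \<partial>\<mu>))"
        using c by (intro mult_left_mono) auto
      moreover have "\<phi> f \<le> p f" using f by (intro \<phi>(2)) simp
      ultimately show ?thesis by (simp add: p_def mult.assoc)
    qed
    have "\<phi> (\<lambda>x. - f x) \<le> (c * k) * (\<integral>x. norm (- f x) \<partial>\<mu>)" using f by (intro up) simp
    then show ?thesis using up[OF f] \<phi>neg[OF f] by (simp add: abs_le_iff)
  qed
  have "\<exists>g\<in>borel_measurable \<mu>. (\<exists>C. AE x in \<mu>. norm (g x) \<le> C) \<and>
    (\<forall>f. integrable \<mu> f \<longrightarrow> integrable \<mu> (\<lambda>x. f x \<bullet> g x) \<and> \<phi> f = (\<integral>x. f x \<bullet> g x \<partial>\<mu>))"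
    by (rule L1_functional_density_vector[OF finite_\<mu> _ \<phi>(1) \<phi>bound]) (use c k in auto)
  then obtain g C where g: "g \<in> borel_measurable \<mu>" "AE x in \<mu>. norm (g x) \<le> C"
    and rep: "\<forall>f. integrable \<mu> f \<longrightarrow> integrable \<mu> (\<lambda>x. f x \<bullet> g x) \<and> \<phi> f = (\<integral>x. f x \<bullet> g x \<partial>\<mu>)"
    by (elim bexE conjE exE)
  define \<sigma> where "\<sigma> x = symmetric_part (g x)" for x
  have blin: "bounded_linear symmetric_part"
    using linear_symmetric_part linear_conv_bounded_linear by blast
  have \<sigma>sym: "\<sigma> x \<in> sym_matrices" for x by (simp add: \<sigma>_def)
  have \<sigma>meas: "\<sigma> \<in> borel_measurable \<mu>"
    unfolding \<sigma>_def[abs_def]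
    by (rule measurable_compose[OF g(1) borel_measurable_continuous_onI[OF linear_continuous_on[OF blin]]])
  have "essentially_bounded \<mu> \<sigma>"
  proof -
    obtain B where B: "\<And>A. norm (symmetric_part A) \<le> norm A * B" "0 \<le> B"
      using bounded_linear.nonneg_bounded[OF blin] by blast
    have "AE x in \<mu>. norm (\<sigma> x) \<le> C * B"
      using g(2)
    proof eventually_elim
      case (elim x)
      show ?case unfolding \<sigma>_def using B(1)[of "g x"] mult_right_mono[OF elim B(2)] by simp
    qed
    then show ?thesis using \<sigma>meas by (auto simp: essentially_bounded_def)
  qed
  moreover have "L W = (\<integral>x. \<sigma> x \<bullet> strain W x \<partial>\<mu>)" if W: "W \<in> admissible" for W
  proof -
    have "integrable \<mu> (strain W)" using W integrable_strain by (simp add: admissible_def)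
    then have "L W = (\<integral>x. strain W x \<bullet> g x \<partial>\<mu>)" using rep \<phi>L[OF W] by simp
    also have "\<dots> = (\<integral>x. \<sigma> x \<bullet> strain W x \<partial>\<mu>)"
    proof (rule Bochner_Integration.integral_cong[OF refl])
      show "strain W x \<bullet> g x = \<sigma> x \<bullet> strain W x" for x
        using inner_symmetric_part[OF strain_in_sym, of W x "g x"] by (simp add: \<sigma>_def inner_commute)
    qed
    finally show ?thesis .
  qed
  ultimately have \<sigma>: "\<sigma> \<in> stress_fields \<Omega> \<Gamma>0 \<Gamma>t t" using \<sigma>sym by (simp add: stress_fields_iff)
  \<comment> \<open>For fixed \<open>S\<close> the bound on \<open>\<phi>\<close> at \<open>indicator A *\<^sub>R S\<close>, for all \<open>A\<close>, is a pointwise bound on the density.\<close>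
  have pt: "AE x in \<mu>. S \<bullet> g x \<le> c * D S" for S
  proof (rule AE_le_const_if_set_integrals_le[OF finite_\<mu>])
    interpret finite_measure \<mu> by (rule finite_\<mu>)
    have const: "integrable \<mu> (\<lambda>x. S)" by simp
    then show "integrable \<mu> (\<lambda>x. S \<bullet> g x)" using rep by blast
    fix A assume A: "A \<in> sets \<mu>"
    have intA: "integrable \<mu> (\<lambda>x. indicator A x *\<^sub>R S)"
      using integrable_mult_indicator[OF A const] by simp
    have "(\<integral>x. indicator A x * (S \<bullet> g x) \<partial>\<mu>) = (\<integral>x. (indicator A x *\<^sub>R S) \<bullet> g x \<partial>\<mu>)" by simp
    also have "\<dots> = \<phi> (\<lambda>x. indicator A x *\<^sub>R S)" using rep intA by simp
    also have "\<dots> \<le> p (\<lambda>x. indicator A x *\<^sub>R S)" using intA by (intro \<phi>(2)) simp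
    also have "\<dots> = c * (\<integral>x. indicator A x * D S \<partial>\<mu>)" by (simp add: p_def dual_scale)
    also have "\<dots> = c * D S * measure \<mu> A"
      using A sets.sets_into_space[OF A] by (simp add: Int_absorb2)
    finally show "(\<integral>x. indicator A x * (S \<bullet> g x) \<partial>\<mu>) \<le> c * D S * measure \<mu> A" .
  qed
  \<comment> \<open>A countable dense set of \<open>S\<close> makes the exceptional null set independent of \<open>S\<close>.\<close>
  obtain T :: "(real^3^3) set" where T: "countable T" "\<And>X. open X \<Longrightarrow> X \<noteq> {} \<Longrightarrow> \<exists>d\<in>T. d \<in> X"
    by (rule countable_dense_setE) blast
  have "AE x in \<mu>. \<forall>S\<in>T. S \<bullet> g x \<le> c * D S"
    using pt by (intro AE_ball_countable' T(1))
  then have N\<sigma>: "AE x in \<mu>. N (\<sigma> x) \<le> c"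
  proof eventually_elim
    case (elim x)
    let ?F = "{S. S \<bullet> g x \<le> c * D S}"
    have "closed ?F"
      by (intro closed_Collect_le continuous_intros continuous_on_dual)
    have all: "S \<bullet> g x \<le> c * D S" for S
    proof (rule ccontr)
      assume "\<not> S \<bullet> g x \<le> c * D S"
      then have "- ?F \<noteq> {}" "open (- ?F)" using \<open>closed ?F\<close> by auto
      then show False using T(2)[of "- ?F"] elim by auto
    qed
    show ?case
    proof (rule bidual_le[OF \<sigma>sym c])
      fix E
      have "\<sigma> x \<bullet> E = symmetric_part E \<bullet> g x"
        using inner_symmetric_part[OF symmetric_part_in, of "g x" E]
          inner_symmetric_part[OF symmetric_part_in, of E "g x"] by (simp add: \<sigma>_def inner_commute)
      also have "\<dots> \<le> c * D (symmetric_part E)" by (rule all)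
      finally show "\<sigma> x \<bullet> E \<le> c * D E" by (simp add: dual_symmetric_part)
    qed
  qed
  have "(\<lambda>x. N (\<sigma> x)) \<in> borel_measurable \<mu>"
    unfolding \<sigma>_def
    by (rule measurable_compose[OF g(1) borel_measurable_continuous_onI[OF continuous_on_N_symmetric_part]])
  then have "stress_sup \<Omega> N \<sigma> \<le> ereal c"
    unfolding stress_sup_def using N\<sigma> by (intro esssup_I) auto
  with \<sigma> show ?thesis by blast
qed

lemma null_\<mu>_false: "\<not> (AE x in \<mu>. False)"
proof
  assume AE: "AE x in \<mu>. False"
  obtain a where "a \<in> \<Omega>" using \<Omega>_nonempty by blast
  then obtain d where d: "0 < d" "ball a d \<subseteq> \<Omega>" using open_\<Omega> openE by blast
  have "(\<integral>\<^sup>+x. 1 \<partial>\<mu>) = (\<integral>\<^sup>+x. 0 \<partial>\<mu>)" using AE by (intro nn_integral_cong_AE) auto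
  then have "emeasure lborel \<Omega> = 0"
    using open_\<Omega> by (simp add: emeasure_restrict_space)
  then have "emeasure lborel (ball a d) = 0"
    using emeasure_mono[OF d(2), of lborel] open_\<Omega> by simp
  then have "ennreal (unit_ball_vol 3 * d ^ 3) = 0"
    unfolding emeasure_ball_3[OF less_imp_le[OF d(1)]] .
  moreover have "0 < unit_ball_vol 3 * d ^ 3"
    using d(1) by (intro mult_pos_pos unit_ball_vol_pos) auto
  ultimately show False by (simp only: ennreal_eq_0_iff)
qed

lemma stress_sup_nonneg:
  assumes "\<sigma> \<in> stress_fields \<Omega> \<Gamma>0 \<Gamma>t t"
  shows "0 \<le> stress_sup \<Omega> N \<sigma>"
proof (rule ccontr)
  assume neg: "\<not> 0 \<le> stress_sup \<Omega> N \<sigma>"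
  have "AE x in \<mu>. ereal (N (\<sigma> x)) \<le> stress_sup \<Omega> N \<sigma>" unfolding stress_sup_def by (rule esssup_AE)
  then have "AE x in \<mu>. False"
    using AE_space
  proof eventually_elim
    case (elim x)
    then have "ereal (N (\<sigma> x)) < 0" using neg le_less_trans by (metis not_le)
    moreover have "0 \<le> N (\<sigma> x)" using elim(2) assms by (intro N_nonneg) (auto simp: stress_fields_iff)
    ultimately show False by simp
  qed
  then show False using null_\<mu>_false by blast
qed

text \<open>
  When the denominator vanishes, the quotient is \<open>0\<close> and the claim is that the essential supremum is
  nonnegative.
\<close>

lemma ratio_le_stress_sup:
  assumes \<sigma>: "\<sigma> \<in> stress_fields \<Omega> \<Gamma>0 \<Gamma>t t" and W: "W \<in> admissible"
  shows "ereal (\<bar>L W\<bar> / strain_L1 W) \<le> stress_sup \<Omega> N \<sigma>"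
proof (cases "stress_sup \<Omega> N \<sigma>")
  case (real c)
  have c: "0 \<le> c" using stress_sup_nonneg[OF \<sigma>] real by simp
  have "AE x in \<mu>. ereal (N (\<sigma> x)) \<le> stress_sup \<Omega> N \<sigma>" unfolding stress_sup_def by (rule esssup_AE)
  then have AE: "AE x in \<mu>. N (\<sigma> x) \<le> c" using real by simp
  have "\<bar>L W\<bar> \<le> c * strain_L1 W"
    using \<sigma> W pairing_integral_le[OF _ _ c AE W] by (auto simp: stress_fields_iff essentially_bounded_def)
  then have "\<bar>L W\<bar> / strain_L1 W \<le> c"
    using strain_L1_nonneg[of W] c by (cases "strain_L1 W = 0") (auto simp: divide_le_eq less_le)
  then show ?thesis using real by simp
qed (use stress_sup_nonneg[OF \<sigma>] in auto)

theorem optimal_stress_duality: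
  "stress_fields \<Omega> \<Gamma>0 \<Gamma>t t \<noteq> {}
    \<and> (\<exists>\<sigma>hat \<in> stress_fields \<Omega> \<Gamma>0 \<Gamma>t t.
          optimal_stress \<Omega> \<Gamma>0 \<Gamma>t N t = stress_sup \<Omega> N \<sigma>hat)
    \<and> optimal_stress \<Omega> \<Gamma>0 \<Gamma>t N t =
        (SUP w \<in> {w \<in> test_fields \<Omega> \<Gamma>0. \<exists>x \<in> closure \<Omega>. w x \<noteq> 0}.
           ereal (\<bar>L w\<bar> / (\<integral>x. D (strain w x) \<partial>\<mu>)))"
proof -
  let ?T = "{w \<in> test_fields \<Omega> \<Gamma>0. \<exists>x \<in> closure \<Omega>. w x \<noteq> 0}"
  let ?r = "\<lambda>w. ereal (\<bar>L w\<bar> / (\<integral>x. D (strain w x) \<partial>\<mu>))"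
  define R where "R = (SUP w\<in>?T. ?r w)"
  have extend: "\<exists>W\<in>admissible. ?r w = ereal (\<bar>L W\<bar> / strain_L1 W)" if "w \<in> ?T" for w
  proof -
    from that have "w \<in> test_fields \<Omega> \<Gamma>0" by simp
    then obtain W where W: "W \<in> admissible" "L w = L W" "\<And>x. x \<in> \<Omega> \<Longrightarrow> strain w x = strain W x"
      using test_fields_extend by metis
    then show ?thesis using strain_L1_cong[OF W(3)] by auto
  qed
  obtain K where K: "0 \<le> K" "\<forall>W\<in>admissible. \<bar>L W\<bar> \<le> K * strain_L1 W" using traction_le_strain_L1 by blast
  have ratio_le: "\<bar>L W\<bar> / strain_L1 W \<le> K" if "W \<in> admissible" for W
    using K that strain_L1_nonneg[of W] by (cases "strain_L1 W = 0") (auto simp: divide_le_eq less_le)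
  have "R \<le> ereal K"
    unfolding R_def
  proof (rule SUP_least)
    fix w assume "w \<in> ?T"
    then obtain W where "W \<in> admissible" "?r w = ereal (\<bar>L W\<bar> / strain_L1 W)" using extend by blast
    then show "?r w \<le> ereal K" using ratio_le by simp
  qed
  moreover have "0 \<le> R"
  proof -
    \<comment> \<open>A bump field makes the supremum range over a nonempty set.\<close>
    obtain W :: "real^3 \<Rightarrow> real^3" where W: "smooth W" "\<forall>x. x \<notin> \<Omega> \<longrightarrow> W x = 0" "\<exists>x\<in>\<Omega>. W x \<noteq> 0"
      using smooth_bump_exists[OF open_\<Omega> \<Omega>_nonempty] by blast
    have "\<Gamma>0 \<inter> \<Omega> = {}"
      using openin_imp_subset[OF openin_\<Gamma>0] open_\<Omega> by (auto simp: frontier_def interior_open)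
    then have "W \<in> admissible" using W by (auto simp: admissible_def)
    then have WT: "W \<in> ?T" using admissible_subset_test_fields W(3) closure_subset[of \<Omega>] by blast
    have "0 \<le> ?r W" using strain_L1_nonneg[of W] by (simp add: strain_L1_def)
    also have "\<dots> \<le> R" unfolding R_def by (rule SUP_upper[OF WT])
    finally show ?thesis .
  qed
  ultimately obtain c where c: "R = ereal c" "0 \<le> c" by (cases R) auto
  have Lc: "\<bar>L W\<bar> \<le> c * strain_L1 W" if W: "W \<in> admissible" for W
  proof (cases "strain_L1 W = 0 \<or> (\<forall>x\<in>closure \<Omega>. W x = 0)")
    case True
    then have "L W = 0"
    proof
      assume "\<forall>x\<in>closure \<Omega>. W x = 0"
      then have "L W = (\<integral>x. 0 \<partial>restrict_space hausdorff2 \<Gamma>t)"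
        unfolding traction_power_def using \<Gamma>t_closure
        by (intro Bochner_Integration.integral_cong) (auto simp: space_restrict_space)
      then show ?thesis by simp
    qed (use K W in fastforce)
    then show ?thesis using c strain_L1_nonneg by simp
  next
    case False
    then have "W \<in> ?T" using W admissible_subset_test_fields by auto
    then have "?r W \<le> R" unfolding R_def by (rule SUP_upper)
    then have "\<bar>L W\<bar> / strain_L1 W \<le> c" using c by (simp add: strain_L1_def)
    then show ?thesis using False strain_L1_nonneg[of W] by (simp add: divide_le_eq less_le)
  qed
  obtain \<sigma> where \<sigma>: "\<sigma> \<in> stress_fields \<Omega> \<Gamma>0 \<Gamma>t t" "stress_sup \<Omega> N \<sigma> \<le> ereal c"
    using stress_exists[OF c(2) Lc] by blast
  have "R \<le> optimal_stress \<Omega> \<Gamma>0 \<Gamma>t N t"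
    unfolding optimal_stress_def
  proof (rule INF_greatest)
    fix \<tau> assume \<tau>: "\<tau> \<in> stress_fields \<Omega> \<Gamma>0 \<Gamma>t t"
    show "R \<le> stress_sup \<Omega> N \<tau>"
      unfolding R_def
    proof (rule SUP_least)
      fix w assume "w \<in> ?T"
      then obtain W where "W \<in> admissible" "?r w = ereal (\<bar>L W\<bar> / strain_L1 W)" using extend by blast
      then show "?r w \<le> stress_sup \<Omega> N \<tau>" using ratio_le_stress_sup[OF \<tau>] by simp
    qed
  qed
  moreover have "optimal_stress \<Omega> \<Gamma>0 \<Gamma>t N t \<le> stress_sup \<Omega> N \<sigma>"
    unfolding optimal_stress_def by (rule INF_lower[OF \<sigma>(1)])
  ultimately have "optimal_stress \<Omega> \<Gamma>0 \<Gamma>t N t = stress_sup \<Omega> N \<sigma>" "optimal_stress \<Omega> \<Gamma>0 \<Gamma>t N t = R"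
    using \<sigma>(2) c(1) by auto
  then show ?thesis using \<sigma>(1) unfolding R_def by blast
qed

end

theorem theorem1p1:
  fixes \<Omega> \<Gamma>0 \<Gamma>t \<Lambda> :: "(real^3) set"
    and N :: "real^3^3 \<Rightarrow> real"
    and t :: "real^3 \<Rightarrow> real^3"
  assumes "open \<Omega>" and "bounded \<Omega>" and "connected \<Omega>" and "C1_boundary \<Omega>"
    and "\<Gamma>0 \<noteq> {}" and "\<Gamma>t \<noteq> {}" and "\<Gamma>0 \<inter> \<Gamma>t = {}"
    and "openin (top_of_set (frontier \<Omega>)) \<Gamma>0"
    and "openin (top_of_set (frontier \<Omega>)) \<Gamma>t"
    and "closure \<Gamma>0 \<union> closure \<Gamma>t = frontier \<Omega>"
    and "\<Lambda> = top_of_set (frontier \<Omega>) frontier_of \<Gamma>0"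
    and "\<Lambda> = top_of_set (frontier \<Omega>) frontier_of \<Gamma>t"
    and "C1_curve_in_surface (frontier \<Omega>) \<Lambda>"
    and "norm_on_sym N"
    and "essentially_bounded (restrict_space hausdorff2 \<Gamma>t) t"
  shows "stress_fields \<Omega> \<Gamma>0 \<Gamma>t t \<noteq> {}
    \<and> (\<exists>\<sigma>hat \<in> stress_fields \<Omega> \<Gamma>0 \<Gamma>t t.
          optimal_stress \<Omega> \<Gamma>0 \<Gamma>t N t = stress_sup \<Omega> N \<sigma>hat)
    \<and> optimal_stress \<Omega> \<Gamma>0 \<Gamma>t N t =
        (SUP w \<in> {w \<in> test_fields \<Omega> \<Gamma>0. \<exists>x \<in> closure \<Omega>. w x \<noteq> 0}.
           ereal (\<bar>traction_power \<Gamma>t t w\<bar> /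
                  (\<integral>x. dual_norm_sym N (strain w x) \<partial>(lebesgue_on \<Omega>))))"
proof -
  interpret clamped_body N \<Omega> \<Gamma>0 \<Gamma>t t
    by unfold_locales (fact assms)+
  show ?thesis by (rule optimal_stress_duality)
qed

end
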